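(* For every odd positive integer $k$ and every $n\ge1$, the set $\{w\in B_n:w^k=e\}$, endowed with the map $w\mapsto\mathrm{sDes}(w)$, is a fine set for the character $r^B_{n,k}$ of $B_n$. Equivalently, $$\mathrm{ch}(r^B_{n,k})=\sum_{w\in B_n:\,w^k=e}F_{\mathrm{sDes}(w)}(x,y).$$
   Context: $B_n$: signed permutations $w=(w(1),\dots,w(n))$, $e$ the identity; $\{1,\dots,n,\bar1,\dots,\bar n\}$ ordered by $\bar1<_r\cdots<_r\bar n<_r1<_r\cdots<_rn$. $r^B_{n,k}(w)=|\{u\in B_n:u^k=w\}|$; this class function is known to be a (non-virtual) character of $B_n$. $\mathrm{sDes}(w)=(S,\varepsilon)$: $S$ consists of $n$ and all $s\in[n-1]$ with $w(s)>_rw(s+1)$ or with $w(s)$ barred and $w(s+1)$ unbarred; $\varepsilon(s)=-$ iff $w(s)$ barred. For $\sigma=(S,\varepsilon)$ ($n\in S\subseteq[n]$) with $S=\{s_1<\dots<s_m=n\}$, $s_0=0$: sign vector $\tilde\varepsilon(j)=\varepsilon(s_i)$ for $s_{i-1}<j\le s_i$; ${\rm wDes}(\sigma)$ the set of $s_i$, $i<m$, with $\varepsilon(s_i)=\varepsilon(s_{i+1})$ or ($\varepsilon(s_i)=+$, $\varepsilon(s_{i+1})=-$); $F_\sigma(x,y)=\sum z_{i_1}\cdots z_{i_n}$ over $i_1\le\dots\le i_n$ with $i_j<i_{j+1}$ for $j\in{\rm wDes}(\sigma)$, where $z_{i_j}=x_{i_j}$ if $\tilde\varepsilon(j)=+$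 and $y_{i_j}$ otherwise. $\mathrm{ch}(\chi)=\frac{1}{2^nn!}\sum_{w}\chi(w)p^+_\alpha(x,y)p^-_\beta(x,y)$, $(\alpha,\beta)$ the signed cycle type of $w$ (lengths of positive cycles — pairs of disjoint cycles $c,\bar c$ of $w$ on $\{1,\dots,n,\bar1,\dots,\bar n\}$ — and of negative cycles $c=\bar c$, counted with half their length), $p^\pm_j=\sum_i(x_i^j\pm y_i^j)$, $p^\pm_\lambda=\prod p^\pm_{\lambda_i}$. Fine sets: for a signed composition $\gamma=(\gamma_1,\dots,\gamma_m)$ of $n$ (some parts barred), partial sums $r_i$, $r_0=0$, $S(\gamma)=\{r_1,\dots,r_m\}$, blocks $I_i=\{r_{i-1}+1,\dots,r_i\}$: $\mathrm{wt}_\gamma(\sigma)=0$ if for some $i$, $S\cap\{r_{i-1}+1,\dots,r_i-1\}$ is not an initial segment of $\{r_{i-1}+1,\dots,r_i-1\}$ or $\tilde\varepsilon$ is not constant on $I_i$; else $(-1)^{|S\setminus S(\gamma)|+n_\gamma(\sigma)}$ with $n_\gamma(\sigma)$ the number of $i$ with $\tilde\varepsilon=-$ on $I_i$ and $\gamma_i$ barred. A finite set $\mathcal B$ with a map $\mathrm{sDes}$ is fine for a class function $\chi$ if $\chi(\gamma)=\sum_{b\in\mathcal B}\mathrm{wt}_\gamma(\mathrm{sDes}(b))$ for all $\gamma$, where $\chi(\gamma)$ is the value at elements of signed cycle type (sorted unbarred parts of $\gamma$; sorted barred parts of $\gamma$). *)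

theory Defs
  imports Complex_Main "HOL-Library.Multiset" "HOL-Library.FuncSet" "HOL-Combinatorics.Orbits"
begin

section \<open>Formal power series in arbitrarily many commuting variables\<close>

text \<open>
  A monomial in variables from \<open>'v\<close> is a finite multiset of variables; a formal power series
  assigns a coefficient to every monomial.
\<close>

typedef ('v, 'a) mps = "{f :: 'v multiset \<Rightarrow> 'a. True}"
  morphisms mps_coeff Abs_mps
  by simp

lemma mps_eqI: "(\<And>M. mps_coeff f M = mps_coeff g M) \<Longrightarrow> f = g"
  by (simp add: mps_coeff_inject[symmetric] fun_eq_iff)

lemma mps_coeff_Abs [simp]: "mps_coeff (Abs_mps f) = f"
  by (simp add: Abs_mps_inverse)

lemma finite_mset_splits [simp]: "finite {(A, B). A + B = (M :: 'v multiset)}"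
proof -
  have fin: "finite {A. A \<subseteq># M}"
  proof (induction M)
    case (add x M)
    have "{A. A \<subseteq># add_mset x M} \<subseteq> {A. A \<subseteq># M} \<union> add_mset x ` {A. A \<subseteq># M}"
    proof
      fix A assume "A \<in> {A. A \<subseteq># add_mset x M}"
      then have A: "A \<subseteq># add_mset x M" by simp
      show "A \<in> {A. A \<subseteq># M} \<union> add_mset x ` {A. A \<subseteq># M}"
      proof (cases "x \<in># A")
        case True
        then obtain A' where "A = add_mset x A'" by (metis mset_add)
        then show ?thesis using A by auto
      next
        case False
        then have "A \<subseteq># M"
          using A by (metis diff_single_trivial subset_eq_diff_conv add_mset_add_single)
        then show ?thesis by simp
      qed
    qed
    then show ?case using add finite_subset by blast
  qed simp
  have "{(A, B). A + B = M} \<subseteq> {A. A \<subseteq># M} \<times> {A. A \<subseteq># M}" by auto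
  then show ?thesis using fin by (meson finite_SigmaI finite_subset)
qed

instantiation mps :: (type, comm_ring_1) comm_ring_1
begin

definition "0 = Abs_mps (\<lambda>_. 0)"
definition "1 = Abs_mps (\<lambda>M. if M = {#} then 1 else 0)"
definition "f + g = Abs_mps (\<lambda>M. mps_coeff f M + mps_coeff g M)"
definition "f - g = Abs_mps (\<lambda>M. mps_coeff f M - mps_coeff g M)"
definition "- f = Abs_mps (\<lambda>M. - mps_coeff f M)"
definition "f * g = Abs_mps (\<lambda>M. \<Sum>(A, B) | A + B = M. mps_coeff f A * mps_coeff g B)"

instance
proof
  fix f g h :: "('a, 'b) mps"
  show "f * g = g * f"
  proof (rule mps_eqI)
    fix M
    show "mps_coeff (f * g) M = mps_coeff (g * f) M"
      unfolding times_mps_def mps_coeff_Abs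
      by (rule sum.reindex_bij_witness[of _ prod.swap prod.swap])
         (auto simp: add.commute mult.commute)
  qed
  show "f * g * h = f * (g * h)"
  proof (rule mps_eqI)
    fix M
    let ?c = "\<lambda>A B C. mps_coeff f A * mps_coeff g B * mps_coeff h C"
    have "mps_coeff (f * g * h) M =
        (\<Sum>p | fst p + snd p = M. \<Sum>q | fst q + snd q = fst p. ?c (fst q) (snd q) (snd p))"
      by (simp add: times_mps_def case_prod_unfold sum_distrib_right)
    also have "\<dots> = (\<Sum>(p, q) \<in> (SIGMA p:{p. fst p + snd p = M}. {q. fst q + snd q = fst p}).
        ?c (fst q) (snd q) (snd p))"
      using finite_mset_splits by (subst sum.Sigma) (auto simp: case_prod_unfold)
    also have "\<dots> = (\<Sum>(p, q) \<in> (SIGMA p:{p. fst p + snd p = M}. {q. fst q + snd q = snd p}).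
        ?c (fst p) (fst q) (snd q))"
      by (rule sum.reindex_bij_witness
            [of _ "\<lambda>(p, q). ((fst p + fst q, snd q), (fst p, fst q))"
                  "\<lambda>(p, q). ((fst q, snd q + snd p), (snd q, snd p))"])
         (auto simp: add.assoc)
    also have "\<dots> =
        (\<Sum>p | fst p + snd p = M. \<Sum>q | fst q + snd q = snd p. ?c (fst p) (fst q) (snd q))"
      using finite_mset_splits by (subst sum.Sigma) (auto simp: case_prod_unfold)
    also have "\<dots> = mps_coeff (f * (g * h)) M"
      by (simp add: times_mps_def case_prod_unfold sum_distrib_left mult.assoc)
    finally show "mps_coeff (f * g * h) M = mps_coeff (f * (g * h)) M" .
  qed
  show "1 * f = f"
  proof (rule mps_eqI)
    fix M
    have "mps_coeff (1 * f) M =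
        (\<Sum>p\<in>{p. fst p + snd p = M}. if p = ({#}, M) then mps_coeff f M else 0)"
      unfolding times_mps_def one_mps_def mps_coeff_Abs
      by (intro sum.cong) (auto simp: case_prod_unfold)
    also have "\<dots> = mps_coeff f M"
      using finite_mset_splits[of M] by (simp add: case_prod_unfold)
    finally show "mps_coeff (1 * f) M = mps_coeff f M" .
  qed
  show "(f + g) * h = f * h + g * h"
    by (rule mps_eqI)
       (simp add: times_mps_def plus_mps_def case_prod_unfold distrib_right sum.distrib)
  show "(0 :: ('a, 'b) mps) \<noteq> 1"
  proof
    assume "(0 :: ('a, 'b) mps) = 1"
    then have "mps_coeff (0 :: ('a, 'b) mps) {#} = mps_coeff (1 :: ('a, 'b) mps) {#}" by simp
    then show False by (simp add: zero_mps_def one_mps_def)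
  qed
qed (auto intro!: mps_eqI simp: zero_mps_def plus_mps_def minus_mps_def uminus_mps_def)

end

definition mps_const :: "'a::zero \<Rightarrow> ('v, 'a) mps" where
  "mps_const c = Abs_mps (\<lambda>M. if M = {#} then c else 0)"

definition mps_var :: "'v \<Rightarrow> ('v, 'a::zero_neq_one) mps" where
  "mps_var v = Abs_mps (\<lambda>M. if M = {#v#} then 1 else 0)"

text \<open>
  The formal (possibly infinite) sum of a family in which every monomial occurs in only finitely
  many members.  All families used below have this property.
\<close>

definition formal_sum :: "('i \<Rightarrow> ('v, 'a::comm_monoid_add) mps) \<Rightarrow> 'i set \<Rightarrow> ('v, 'a) mps" where
  "formal_sum f I = Abs_mps (\<lambda>M. \<Sum>i | i \<in> I \<and> mps_coeff (f i) M \<noteq> 0. mps_coeff (f i) M)"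


section \<open>Signed permutations\<close>

text \<open>The barred letter \<open>j\<close> is the integer \<open>- j\<close>.\<close>

definition letters :: "nat \<Rightarrow> int set" where
  "letters n = {- int n..int n} - {0}"

definition signed_perms :: "nat \<Rightarrow> (int \<Rightarrow> int) set" where
  "signed_perms n = {w. w permutes letters n \<and> (\<forall>i. w (- i) = - w i)}"

text \<open>\<open>- 1 < - 2 < \<dots> < - n < 1 < 2 < \<dots> < n\<close> in this order.\<close>

definition less_r :: "int \<Rightarrow> int \<Rightarrow> bool" (infix \<open><\<^sub>r\<close> 50) where
  "a <\<^sub>r b \<longleftrightarrow> (a < 0 \<and> 0 < b) \<or> (a < 0 \<and> b < 0 \<and> \<bar>a\<bar> < \<bar>b\<bar>) \<or> (0 < a \<and> 0 < b \<and> a < b)"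

definition root_count :: "nat \<Rightarrow> nat \<Rightarrow> (int \<Rightarrow> int) \<Rightarrow> complex" where
  "root_count n k w = of_nat (card {u \<in> signed_perms n. u ^^ k = w})"

definition cycles :: "nat \<Rightarrow> (int \<Rightarrow> int) \<Rightarrow> int set set" where
  "cycles n w = orbit w ` letters n"

definition bar :: "int set \<Rightarrow> int set" where
  "bar c = uminus ` c"

text \<open>
  For a positive cycle \<open>{c, bar c}\<close>, half the size of \<open>c \<union> bar c\<close> is the common length of \<open>c\<close>
  and \<open>bar c\<close>.
\<close>

definition pos_cycle_type :: "nat \<Rightarrow> (int \<Rightarrow> int) \<Rightarrow> nat multiset" where
  "pos_cycle_type n w =
     image_mset (\<lambda>P. card (\<Union>P) div 2) (mset_set {{c, bar c} | c. c \<in> cycles n w \<and> c \<inter> bar c = {}})"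

definition neg_cycle_type :: "nat \<Rightarrow> (int \<Rightarrow> int) \<Rightarrow> nat multiset" where
  "neg_cycle_type n w = image_mset (\<lambda>c. card c div 2) (mset_set {c \<in> cycles n w. c = bar c})"

definition signed_cycle_type :: "nat \<Rightarrow> (int \<Rightarrow> int) \<Rightarrow> nat multiset \<times> nat multiset" where
  "signed_cycle_type n w = (pos_cycle_type n w, neg_cycle_type n w)"

definition class_function :: "nat \<Rightarrow> ((int \<Rightarrow> int) \<Rightarrow> complex) \<Rightarrow> bool" where
  "class_function n \<chi> \<longleftrightarrow>
     (\<forall>u\<in>signed_perms n. \<forall>v\<in>signed_perms n. \<chi> (v \<circ> u \<circ> inv v) = \<chi> u)"


section \<open>Signed descent sets and the associated quasisymmetric functions\<close>

datatype sign = Plus | Minus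

text \<open>A pair \<open>(S, \<epsilon>)\<close>; only the values of \<open>\<epsilon>\<close> on \<open>S\<close> are relevant.\<close>

type_synonym signed_set = "nat set \<times> (nat \<Rightarrow> sign)"

definition sDes :: "nat \<Rightarrow> (int \<Rightarrow> int) \<Rightarrow> signed_set" where
  "sDes n w =
     (let S = {n} \<union> {s \<in> {1..<n}. w (int (s + 1)) <\<^sub>r w (int s) \<or> w (int s) < 0 \<and> 0 < w (int (s + 1))}
      in (S, restrict (\<lambda>s. if w (int s) < 0 then Minus else Plus) S))"

fun sign_vector :: "signed_set \<Rightarrow> nat \<Rightarrow> sign" where
  "sign_vector (S, \<epsilon>) j = \<epsilon> (LEAST s. s \<in> S \<and> j \<le> s)"

fun wDes :: "nat \<Rightarrow> signed_set \<Rightarrow> nat set" where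
  "wDes n (S, \<epsilon>) =
     {s \<in> S. s \<noteq> n \<and>
        (let t = (LEAST t. t \<in> S \<and> s < t) in \<epsilon> s = \<epsilon> t \<or> \<epsilon> s = Plus \<and> \<epsilon> t = Minus)}"

datatype xy_var = X nat | Y nat

definition F :: "nat \<Rightarrow> signed_set \<Rightarrow> (xy_var, complex) mps" where
  "F n \<sigma> =
     formal_sum
       (\<lambda>i. \<Prod>j\<in>{1..n}. mps_var (case sign_vector \<sigma> j of Plus \<Rightarrow> X (i j) | Minus \<Rightarrow> Y (i j)))
       {i \<in> {1..n} \<rightarrow>\<^sub>E UNIV. (\<forall>j\<in>{1..<n}. i j \<le> i (j + 1)) \<and> (\<forall>j\<in>wDes n \<sigma>. i j < i (j + 1))}"


section \<open>Frobenius characteristic\<close>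

definition power_sum_pos :: "nat \<Rightarrow> (xy_var, complex) mps" where
  "power_sum_pos j = formal_sum (\<lambda>i. mps_var (X i) ^ j + mps_var (Y i) ^ j) UNIV"

definition power_sum_neg :: "nat \<Rightarrow> (xy_var, complex) mps" where
  "power_sum_neg j = formal_sum (\<lambda>i. mps_var (X i) ^ j - mps_var (Y i) ^ j) UNIV"

definition ch :: "nat \<Rightarrow> ((int \<Rightarrow> int) \<Rightarrow> complex) \<Rightarrow> (xy_var, complex) mps" where
  "ch n \<chi> =
     mps_const (1 / (2 ^ n * fact n)) *
     (\<Sum>w\<in>signed_perms n.
        mps_const (\<chi> w) * (\<Prod>j\<in>#pos_cycle_type n w. power_sum_pos j)
          * (\<Prod>j\<in>#neg_cycle_type n w. power_sum_neg j))"


section \<open>Fine sets\<close>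

text \<open>A signed composition is a list of parts with signs; \<open>Minus\<close> marks the barred parts.\<close>

type_synonym signed_comp = "(nat \<times> sign) list"

definition signed_comps :: "nat \<Rightarrow> signed_comp set" where
  "signed_comps n = {\<gamma>. (\<forall>p\<in>set \<gamma>. 0 < fst p) \<and> sum_list (map fst \<gamma>) = n}"

definition comp_type :: "signed_comp \<Rightarrow> nat multiset \<times> nat multiset" where
  "comp_type \<gamma> =
     (mset (map fst (filter (\<lambda>p. snd p = Plus) \<gamma>)), mset (map fst (filter (\<lambda>p. snd p = Minus) \<gamma>)))"

definition partial_sum :: "signed_comp \<Rightarrow> nat \<Rightarrow> nat" where
  "partial_sum \<gamma> i = sum_list (map fst (take i \<gamma>))"

definition comp_set :: "signed_comp \<Rightarrow> nat set" where
  "comp_set \<gamma> = partial_sum \<gamma> ` {1..length \<gamma>}"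

definition block :: "signed_comp \<Rightarrow> nat \<Rightarrow> nat set" where
  "block \<gamma> i = {partial_sum \<gamma> (i - 1) + 1..partial_sum \<gamma> i}"

definition inner_block :: "signed_comp \<Rightarrow> nat \<Rightarrow> nat set" where
  "inner_block \<gamma> i = {partial_sum \<gamma> (i - 1) + 1..<partial_sum \<gamma> i}"

definition initial_segment :: "nat set \<Rightarrow> nat set \<Rightarrow> bool" where
  "initial_segment A B \<longleftrightarrow> A \<subseteq> B \<and> (\<forall>a\<in>A. \<forall>b\<in>B. b \<le> a \<longrightarrow> b \<in> A)"

definition barred_neg_blocks :: "signed_comp \<Rightarrow> signed_set \<Rightarrow> nat" where
  "barred_neg_blocks \<gamma> \<sigma> =
     card {i \<in> {1..length \<gamma>}. (\<forall>j\<in>block \<gamma> i. sign_vector \<sigma> j = Minus) \<and> snd (\<gamma> ! (i - 1)) = Minus}"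

definition wt :: "signed_comp \<Rightarrow> signed_set \<Rightarrow> int" where
  "wt \<gamma> \<sigma> =
     (if \<exists>i\<in>{1..length \<gamma>}.
           \<not> initial_segment (fst \<sigma> \<inter> inner_block \<gamma> i) (inner_block \<gamma> i) \<or>
           \<not> (\<exists>s. \<forall>j\<in>block \<gamma> i. sign_vector \<sigma> j = s)
      then 0
      else (- 1) ^ (card (fst \<sigma> - comp_set \<gamma>) + barred_neg_blocks \<gamma> \<sigma>))"

definition fine_set :: "nat \<Rightarrow> 'b set \<Rightarrow> ('b \<Rightarrow> signed_set) \<Rightarrow> ((int \<Rightarrow> int) \<Rightarrow> complex) \<Rightarrow> bool" where
  "fine_set n \<B> sD \<chi> \<longleftrightarrow>
     finite \<B> \<and> class_function n \<chi> \<and>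
     (\<forall>\<gamma>\<in>signed_comps n. \<forall>w\<in>signed_perms n.
        signed_cycle_type n w = comp_type \<gamma> \<longrightarrow> \<chi> w = of_int (\<Sum>b\<in>\<B>. wt \<gamma> (sD b)))"

end

theory Submission
  imports Defs "HOL-Library.List_Lexorder"
begin

text \<open>
  Order the variables as \<open>y\<^sub>1 < x\<^sub>1 < y\<^sub>2 < x\<^sub>2 < \<dots>\<close> and list a monomial \<open>M\<close> of degree \<open>n\<close> as a
  weakly increasing colouring \<open>f\<^sub>0\<close> of \<open>{1..n}\<close>.  The coefficient of \<open>M\<close> in \<open>F\<^bsub>sDes(w)\<^esub>\<close> is \<open>1\<close> if \<open>w\<close>
  is negative exactly at the \<open>y\<close>-coloured positions and \<open>\<bar>w\<bar>\<close> increases on the fibres of \<open>f\<^sub>0\<close>, and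
  \<open>0\<close> otherwise.  Its coefficient in \<open>2\<^sup>n n! ch(r\<^sub>k)\<close> is a signed count of pairs \<open>(u, f)\<close> in which
  \<open>f\<close> is a colouring of content \<open>M\<close> fixed by \<open>u\<^sup>k\<close>.  Record at a position \<open>j\<close> the cyclic word
  \<open>f(j), f(\<bar>u\<bar>(j)), \<dots>\<close> of length \<open>k\<close>; summing over the signs of \<open>u\<close> keeps the pairs all of whose
  words contain an even number of \<open>y\<close>'s.  Both sides then count rotation-invariant multisets of such
  words: the pairs by orbit counting, the \<open>k\<close>-th roots of the identity by the inverse
  Burrows--Wheeler transform.

  For fineness, \<open>wt\<^sub>\<gamma>\<close> is an alternating sum of compatibility conditions of the above kind, so the
  same count gives \<open>2\<^sup>n n! \<Sum> wt\<^sub>\<gamma>(sDes w) = \<Sum> r\<^sub>k(w) K(w)\<close> for an explicit integer-valued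
  function \<open>K\<close> that does not depend on \<open>k\<close>.  A sign-reversing involution shows that \<open>K\<close> vanishes
  outside the class of type \<open>\<gamma>\<close>, and the case \<open>k = 1\<close> evaluates \<open>\<Sum> K(w) = 2\<^sup>n n!\<close>.
\<close>

section \<open>Signed permutations and increasing listings\<close>

text \<open>The order of the variables is forced by \<open>wDes\<close>: equal indices are allowed
  when a barred position is followed by an unbarred one, but not in the reverse case, so at equal
  index y must come before x. Words of the fixed length \<open>k\<close> replace necklaces of
  varying length, so neither divisors of \<open>k\<close> nor cycle lengths have to be
  distinguished. Passing from the identity for \<open>ch\<close> to fineness by comparing power sum
  expansions would need the independence of products of power sums and the orders of the
  centralisers. The weights are therefore attacked directly. The function K is modelled on the
  expansion of a power sum into complete homogeneous functions, p_m = sum over compositions a of m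
  of (-1)^(l - 1) a_l h_a, where l is the number of parts and a_l the last part. Replacing each
  product of h's by a compatibility condition yields \<open>wt\<close>; replacing it by the value of
  an induced character yields K. Since K is concentrated on one conjugacy class, where
  \<open>root_count\<close> is constant, only its total over the group matters, and no class size is
  computed.\<close>

definition abs_perm :: "(int \<Rightarrow> int) \<Rightarrow> nat \<Rightarrow> nat" where
  "abs_perm w j = nat \<bar>w (int j)\<bar>"

text \<open>A signed permutation fixes 0 and every position above \<open>n\<close>, and the value
  there is 1, so the multiplicative rules below hold without a range condition.\<close>

definition sign_at :: "(int \<Rightarrow> int) \<Rightarrow> nat \<Rightarrow> int" where
  "sign_at w j = (if w (int j) < 0 then - 1 else 1)"

text \<open>The inverse of reading off the absolute permutation and the set of negative positions.
  The factor \<open>sgn i\<close> makes the function odd and sends 0 to 0.\<close>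

definition make_signed :: "(nat \<Rightarrow> nat) \<Rightarrow> nat set \<Rightarrow> int \<Rightarrow> int" where
  "make_signed p N i = (if nat \<bar>i\<bar> \<in> N then - 1 else 1) * sgn i * int (p (nat \<bar>i\<bar>))"

lemma sign_at_cases: "sign_at w j = 1 \<or> sign_at w j = - 1"
  by (simp add: sign_at_def)

lemma signed_value: "w (int j) = sign_at w j * int (abs_perm w j)"
  by (simp add: sign_at_def abs_perm_def)

lemma signed_perms_odd: "w \<in> signed_perms n \<Longrightarrow> w (- i) = - w i"
  by (simp add: signed_perms_def)

lemma signed_perms_permutes: "w \<in> signed_perms n \<Longrightarrow> w permutes letters n"
  by (simp add: signed_perms_def)

lemma signed_perms_eq_0_iff:
  assumes "w \<in> signed_perms n" shows "w i = 0 \<longleftrightarrow> i = 0"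
proof -
  have "w 0 = 0"
    using signed_perms_permutes[OF assms] by (simp add: permutes_def letters_def)
  then show ?thesis
    using permutes_inj[OF signed_perms_permutes[OF assms]] by (metis injD)
qed

lemma int_in_letters: "int j \<in> letters n \<longleftrightarrow> j \<in> {1..n}"
  by (auto simp: letters_def)

lemma nat_abs_in_iff: "nat \<bar>i\<bar> \<in> {1..n} \<longleftrightarrow> i \<in> letters n"
  by (auto simp: letters_def)

lemma finite_letters: "finite (letters n)"
  by (simp add: letters_def)

lemma abs_perm_permutes:
  assumes w: "w \<in> signed_perms n"
  shows "abs_perm w permutes {1..n}"
proof (rule bij_imp_permutes)
  have inj: "inj_on (abs_perm w) {1..n}"
  proof (rule inj_onI)
    fix i j assume ij: "i \<in> {1..n}" "j \<in> {1..n}" "abs_perm w i = abs_perm w j"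
    then have "w (int i) = w (int j) \<or> w (int i) = w (- int j)"
      using signed_perms_odd[OF w, of "int j"] by (auto simp: abs_perm_def)
    then have "int i = int j \<or> int i = - int j"
      using permutes_inj[OF signed_perms_permutes[OF w]] by (metis injD)
    then show "i = j" using ij by auto
  qed
  have "abs_perm w ` {1..n} \<subseteq> {1..n}"
    using permutes_in_image[OF signed_perms_permutes[OF w]] nat_abs_in_iff int_in_letters
    unfolding abs_perm_def by blast
  with inj show "bij_betw (abs_perm w) {1..n} {1..n}"
    by (simp add: bij_betw_def endo_inj_surj)
next
  fix j assume "j \<notin> {1..n}"
  then show "abs_perm w j = j"
    using signed_perms_permutes[OF w] int_in_letters by (simp add: abs_perm_def permutes_def)
qed

lemma signed_perms_comp:
  "v \<in> signed_perms n \<Longrightarrow> w \<in> signed_perms n \<Longrightarrow> v \<circ> w \<in> signed_perms n"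
  by (auto simp: signed_perms_def permutes_compose)

lemma signed_perms_id: "id \<in> signed_perms n"
  by (simp add: signed_perms_def permutes_id)

lemma signed_perms_funpow: "w \<in> signed_perms n \<Longrightarrow> w ^^ k \<in> signed_perms n"
  by (induction k) (auto intro: signed_perms_comp signed_perms_id)

lemma signed_perms_inv:
  assumes "w \<in> signed_perms n" shows "inv w \<in> signed_perms n"
proof -
  have b: "bij w" using permutes_bij[OF signed_perms_permutes[OF assms]] .
  have "inv w (- i) = - inv w i" for i
    using b signed_perms_odd[OF assms, of "inv w i"]
    by (metis bij_inv_eq_iff)
  then show ?thesis
    using permutes_inv[OF signed_perms_permutes[OF assms]] by (simp add: signed_perms_def)
qed

lemma finite_signed_perms: "finite (signed_perms n)"
  by (rule finite_subset[OF _ finite_permutations[OF finite_letters]]) (auto simp: signed_perms_def)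

lemma abs_perm_comp:
  assumes "v \<in> signed_perms n"
  shows "abs_perm (v \<circ> w) = abs_perm v \<circ> abs_perm w"
proof
  fix j
  show "abs_perm (v \<circ> w) j = (abs_perm v \<circ> abs_perm w) j"
    using signed_perms_odd[OF assms, of "w (int j)"]
    by (cases "w (int j) \<ge> 0") (auto simp: abs_perm_def)
qed

lemma abs_perm_id [simp]: "abs_perm id = id"
  by (auto simp: abs_perm_def)

lemma abs_perm_funpow:
  "w \<in> signed_perms n \<Longrightarrow> abs_perm (w ^^ k) = abs_perm w ^^ k"
  by (induction k) (auto simp: abs_perm_comp)

text \<open>Signs form a cocycle: since \<open>v\<close> is odd, replacing \<open>w j\<close> by its
  absolute value changes the sign of its image by the sign of \<open>w j\<close>. Iterated, this
  gives the sign of a power as a product along the orbit.\<close>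

lemma sign_at_comp:
  assumes v: "v \<in> signed_perms n"
  shows "sign_at (v \<circ> w) j = sign_at v (abs_perm w j) * sign_at w j"
proof (cases "w (int j) = 0")
  case True
  then show ?thesis using signed_perms_eq_0_iff[OF v, of 0] by (simp add: sign_at_def abs_perm_def)
next
  case False
  then show ?thesis
    using signed_perms_odd[OF v, of "w (int j)"] signed_perms_eq_0_iff[OF v, of "w (int j)"]
    by (cases "w (int j) > 0") (auto simp: sign_at_def abs_perm_def)
qed

lemma sign_at_funpow:
  assumes w: "w \<in> signed_perms n"
  shows "sign_at (w ^^ k) j = (\<Prod>t<k. sign_at w ((abs_perm w ^^ t) j))"
proof (induction k)
  case 0
  then show ?case by (simp add: sign_at_def)
next
  case (Suc k)
  have "sign_at (w ^^ Suc k) j = sign_at w (abs_perm (w ^^ k) j) * sign_at (w ^^ k) j"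
    using sign_at_comp[OF w] by simp
  then show ?case using Suc by (simp add: abs_perm_funpow[OF w] mult.commute del: funpow.simps)
qed

lemma signed_perms_eqI:
  assumes v: "v \<in> signed_perms n" and w: "w \<in> signed_perms n"
    and "\<And>j. j \<in> {1..n} \<Longrightarrow> abs_perm v j = abs_perm w j"
    and "\<And>j. j \<in> {1..n} \<Longrightarrow> sign_at v j = sign_at w j"
  shows "v = w"
proof
  fix i
  have eq: "v (int j) = w (int j)" for j
  proof (cases "j \<in> {1..n}")
    case True
    then show ?thesis using assms(3,4) signed_value[of v j] signed_value[of w j] by simp
  next
    case False
    then show ?thesis
      using signed_perms_permutes[OF v] signed_perms_permutes[OF w] int_in_letters
      by (simp add: permutes_def)
  qed
  show "v i = w i"
  proof (cases "i \<ge> 0")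
    case True
    then show ?thesis using eq[of "nat i"] by simp
  next
    case False
    then have "v (- i) = w (- i)" using eq[of "nat (- i)"] by simp
    then show ?thesis using signed_perms_odd[OF v, of i] signed_perms_odd[OF w, of i] by simp
  qed
qed

lemma signed_perm_eq_id_iff:
  assumes "w \<in> signed_perms n"
  shows "w = id \<longleftrightarrow> (\<forall>j\<in>{1..n}. abs_perm w j = j \<and> sign_at w j = 1)"
proof
  assume "\<forall>j\<in>{1..n}. abs_perm w j = j \<and> sign_at w j = 1"
  then show "w = id"
    by (intro signed_perms_eqI[OF assms signed_perms_id]) (auto simp: sign_at_def)
qed (auto simp: abs_perm_def sign_at_def)

lemma abs_perm_make_signed:
  assumes "p permutes {1..n}"
  shows "abs_perm (make_signed p N) = p"
proof
  fix j
  have "p 0 = 0" using assms by (simp add: permutes_def)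
  then show "abs_perm (make_signed p N) j = p j"
    by (cases "j = 0") (auto simp: abs_perm_def make_signed_def abs_mult)
qed

lemma sign_at_make_signed:
  assumes p: "p permutes {1..n}" and "j \<in> {1..n}"
  shows "sign_at (make_signed p N) j = (if j \<in> N then - 1 else 1)"
proof -
  have "p j > 0" using permutes_in_image[OF p, of j] assms(2) by auto
  then show ?thesis using assms(2) by (simp add: sign_at_def make_signed_def)
qed

lemma make_signed_in_signed_perms:
  assumes p: "p permutes {1..n}" and N: "N \<subseteq> {1..n}"
  shows "make_signed p N \<in> signed_perms n"
proof -
  let ?w = "make_signed p N"
  have odd: "?w (- i) = - ?w i" for i by (simp add: make_signed_def)
  have nab: "nat \<bar>?w i\<bar> = p (nat \<bar>i\<bar>)" for i
    using p by (cases "i = 0") (auto simp: make_signed_def abs_mult permutes_def)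
  have out: "?w i = i" if "i \<notin> letters n" for i
  proof -
    have "nat \<bar>i\<bar> \<notin> {1..n}" using that nat_abs_in_iff by blast
    then have "nat \<bar>i\<bar> \<notin> N" "p (nat \<bar>i\<bar>) = nat \<bar>i\<bar>" using p N by (auto simp: permutes_def)
    then show ?thesis by (simp add: make_signed_def sgn_mult_abs)
  qed
  have "inj_on ?w (letters n)"
  proof (rule inj_onI)
    fix i j assume ij: "i \<in> letters n" "j \<in> letters n" "?w i = ?w j"
    then have "p (nat \<bar>i\<bar>) = p (nat \<bar>j\<bar>)" using nab by metis
    then have "nat \<bar>i\<bar> = nat \<bar>j\<bar>" using permutes_inj[OF p] by (metis injD)
    then have "i = j \<or> i = - j" by auto
    moreover have "?w j \<noteq> 0"
      using ij(2) nab[of j] permutes_in_image[OF p, of "nat \<bar>j\<bar>"] nat_abs_in_iff[of j n] by auto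
    ultimately show "i = j" using odd[of j] ij(3) by auto
  qed
  moreover have "?w ` letters n \<subseteq> letters n"
    using nab permutes_in_image[OF p] nat_abs_in_iff by (metis image_subsetI)
  ultimately have "bij_betw ?w (letters n) (letters n)"
    by (simp add: bij_betw_def endo_inj_surj finite_letters)
  then show ?thesis using odd out bij_imp_permutes by (auto simp: signed_perms_def)
qed

lemma bij_betw_make_signed:
  "bij_betw (\<lambda>(p, N). make_signed p N) ({p. p permutes {1..n}} \<times> Pow {1..n}) (signed_perms n)"
proof (rule bij_betw_byWitness[where
      f' = "\<lambda>w. (abs_perm w, {j \<in> {1..n}. sign_at w j = - 1})"], goal_cases)
  case 1
  then show ?case by (auto simp: abs_perm_make_signed sign_at_make_signed split: if_splits)
next
  case 2
  show ?case
  proof (intro ballI, clarsimp)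
    fix w assume w: "w \<in> signed_perms n"
    let ?N = "{j. Suc 0 \<le> j \<and> j \<le> n \<and> sign_at w j = - 1}"
    have p: "abs_perm w permutes {1..n}" using abs_perm_permutes[OF w] .
    have N: "?N \<subseteq> {1..n}" by auto
    show "make_signed (abs_perm w) ?N = w"
      by (rule signed_perms_eqI[OF make_signed_in_signed_perms[OF p N] w])
         (use sign_at_cases[of w] in \<open>auto simp: abs_perm_make_signed[OF p] sign_at_make_signed[OF p]\<close>)
  qed
next
  case 3
  then show ?case by (auto intro!: make_signed_in_signed_perms)
next
  case 4
  then show ?case using abs_perm_permutes by auto
qed

lemma sum_signed_perms:
  "(\<Sum>w\<in>signed_perms n. g (abs_perm w) w)
     = (\<Sum>p | p permutes {1..n}. \<Sum>N\<in>Pow {1..n}. g p (make_signed p N))"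
proof -
  have "(\<Sum>w\<in>signed_perms n. g (abs_perm w) w)
      = (\<Sum>(p, N)\<in>{p. p permutes {1..n}} \<times> Pow {1..n}. g p (make_signed p N))"
    by (subst sum.reindex_bij_betw[OF bij_betw_make_signed, symmetric])
       (auto intro!: sum.cong simp: abs_perm_make_signed)
  then show ?thesis by (simp add: sum.cartesian_product)
qed

section \<open>Weakly increasing listings of a multiset\<close>

text \<open>Sorting is unique. Most identifications of functions below rest on this: two weakly
  increasing functions agree as soon as they list the same multiset.\<close>

lemma mono_on_image_mset_unique:
  fixes f g :: "nat \<Rightarrow> 'a::linorder"
  assumes f: "mono_on {1..n} f" and g: "mono_on {1..n} g"
    and eq: "image_mset f (mset_set {1..n}) = image_mset g (mset_set {1..n})"
    and j: "j \<in> {1..n}"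
  shows "f j = g j"
proof -
  have srt: "sorted (map h [1..<Suc n])" if "mono_on {1..n} h" for h :: "nat \<Rightarrow> 'a"
    using that by (auto simp: sorted_map sorted_wrt_iff_nth_less mono_on_def simp del: upt_Suc)
  have ms: "mset (map h [1..<Suc n]) = image_mset h (mset_set {1..n})" for h :: "nat \<Rightarrow> 'a"
    by (simp add: mset_upt atLeastLessThanSuc_atLeastAtMost del: upt_Suc)
  have "map f [1..<Suc n] = map g [1..<Suc n]"
    using properties_for_sort[OF _ srt[OF f]] properties_for_sort[OF _ srt[OF g]] ms eq by metis
  then show ?thesis using j by (auto simp: map_eq_conv simp del: upt_Suc)
qed

lemma mono_on_listing_exists:
  fixes M :: "'a::linorder multiset"
  assumes "size M = n"
  obtains f where "mono_on {1..n} f" "image_mset f (mset_set {1..n}) = M"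
proof
  let ?xs = "sorted_list_of_multiset M"
  let ?f = "\<lambda>j. ?xs ! (j - 1)"
  have len: "length ?xs = n" using assms by (metis size_mset mset_sorted_list_of_multiset)
  show "mono_on {1..n} ?f"
    using len by (auto simp: mono_on_def intro!: sorted_nth_mono)
  have "map ?f [1..<Suc n] = ?xs"
    using len by (auto intro!: nth_equalityI simp del: upt_Suc)
  then have "mset (map ?f [1..<Suc n]) = M" by (metis mset_sorted_list_of_multiset)
  then show "image_mset ?f (mset_set {1..n}) = M"
    by (simp add: mset_upt atLeastLessThanSuc_atLeastAtMost del: upt_Suc)
qed

section \<open>Permutations and rotation-invariant multisets of words\<close>

definition content :: "nat \<Rightarrow> (nat \<Rightarrow> 'c) \<Rightarrow> 'c multiset" where
  "content n f = image_mset f (mset_set {1..n})"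

text \<open>The predicate \<open>neg\<close> is left abstract because two colour systems occur:
  codes of the variables, where \<open>neg\<close> is evenness, and partial sums of a composition,
  where it selects whole blocks.\<close>

definition compat :: "nat \<Rightarrow> (nat \<Rightarrow> 'c) \<Rightarrow> ('c \<Rightarrow> bool) \<Rightarrow> (int \<Rightarrow> int) \<Rightarrow> bool" where
  "compat n f\<^sub>0 neg w \<longleftrightarrow>
     (\<forall>j\<in>{1..n}. w (int j) < 0 \<longleftrightarrow> neg (f\<^sub>0 j)) \<and>
     (\<forall>i\<in>{1..n}. \<forall>j\<in>{1..n}. i < j \<and> f\<^sub>0 i = f\<^sub>0 j \<longrightarrow> abs_perm w i < abs_perm w j)"

definition fixed_colourings :: "nat \<Rightarrow> 'c multiset \<Rightarrow> (nat \<Rightarrow> nat) \<Rightarrow> (nat \<Rightarrow> 'c) set" where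
  "fixed_colourings n M p =
     {f \<in> {1..n} \<rightarrow>\<^sub>E UNIV. content n f = M \<and> (\<forall>j\<in>{1..n}. f (p j) = f j)}"

text \<open>This is the character of B_n induced from the product of the groups B_m, one for each
  colour of multiplicity m in \<open>M\<close>, where the factors of \<open>neg\<close> colours
  carry the linear character that multiplies the signs. The colourings represent the cosets.\<close>

definition signed_fix :: "nat \<Rightarrow> 'c multiset \<Rightarrow> ('c \<Rightarrow> bool) \<Rightarrow> (int \<Rightarrow> int) \<Rightarrow> int" where
  "signed_fix n M neg w =
     (\<Sum>f\<in>fixed_colourings n M (abs_perm w). \<Prod>j\<in>{1..n}. if neg (f j) then sign_at w j else 1)"

definition word :: "nat \<Rightarrow> (nat \<Rightarrow> 'c) \<Rightarrow> (nat \<Rightarrow> nat) \<Rightarrow> nat \<Rightarrow> 'c list" where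
  "word k f p j = map (\<lambda>t. f ((p ^^ t) j)) [0..<k]"

definition even_word :: "('c \<Rightarrow> bool) \<Rightarrow> 'c list \<Rightarrow> bool" where
  "even_word neg \<omega> \<longleftrightarrow> even (length (filter neg \<omega>))"

text \<open>Such multisets encode multisets of necklaces whose lengths divide \<open>k\<close>: a
  primitive necklace of length d is represented by its d rotations, each repeated up to length
  \<open>k\<close>. There is one word for every position, and its head is the colour of that
  position.\<close>

definition rotation_multisets :: "nat \<Rightarrow> ('c \<Rightarrow> bool) \<Rightarrow> 'c multiset \<Rightarrow> 'c list multiset set" where
  "rotation_multisets k neg M =
     {m. (\<forall>\<omega>\<in>#m. length \<omega> = k \<and> even_word neg \<omega>) \<and> image_mset rotate1 m = m \<and> image_mset hd m = M}"

lemma set_mset_content: "set_mset (content n f) = f ` {1..n}"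
  by (simp add: content_def)

lemma size_content: "size (content n f) = n"
  by (simp add: content_def)

lemma content_cong: "(\<And>j. j \<in> {1..n} \<Longrightarrow> f j = g j) \<Longrightarrow> content n f = content n g"
  unfolding content_def by (intro image_mset_cong) auto

lemma content_comp: "content n (\<lambda>j. h (f j)) = image_mset h (content n f)"
  by (simp add: content_def multiset.map_comp o_def)

lemma content_permute:
  assumes "p permutes {1..n}" shows "content n (\<lambda>j. f (p j)) = content n f"
proof -
  have "image_mset p (mset_set {1..n}) = mset_set {1..n}"
    using image_mset_mset_set[of p "{1..n}"] permutes_inj_on[OF assms] permutes_image[OF assms]
    by simp
  then show ?thesis by (metis content_def content_comp)
qed

lemma finite_fixed_colourings: "finite (fixed_colourings n M p)"
proof (rule finite_subset)
  show "fixed_colourings n M p \<subseteq> {1..n} \<rightarrow>\<^sub>E set_mset M"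
    by (auto simp: fixed_colourings_def set_mset_content)
qed (auto intro: finite_PiE)

lemma funpow_permutes: "p permutes A \<Longrightarrow> (p ^^ t) permutes A"
  by (induction t) (auto intro: permutes_compose simp: permutes_id)

lemma funpow_in: "p permutes A \<Longrightarrow> j \<in> A \<Longrightarrow> (p ^^ t) j \<in> A"
  using permutes_in_image[OF funpow_permutes] by metis

section \<open>Colour words and their lexicographic order\<close>

lemma length_word [simp]: "length (word k f p j) = k"
  by (simp add: word_def)

lemma hd_word: "k > 0 \<Longrightarrow> hd (word k f p j) = f j"
  by (simp add: word_def hd_map)

lemma word_Suc: "word (Suc k) f p j = f j # word k f p (p j)"
proof -
  have "word (Suc k) f p j = f j # map (\<lambda>t. f ((p ^^ Suc t) j)) [0..<k]"
    unfolding word_def by (simp add: upt_conv_Cons map_Suc_upt[symmetric] o_def del: upt_Suc funpow.simps)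
  then show ?thesis by (simp add: word_def funpow_swap1)
qed

text \<open>The letter that enters at the end is the colour of the \<open>k\<close>-th iterate,
  which by hypothesis is the letter dropped at the front. Only the colour has to return after
  \<open>k\<close> steps, not the position.\<close>

lemma word_rotate1:
  assumes "f ((p ^^ k) j) = f j"
  shows "word k f p (p j) = rotate1 (word k f p j)"
proof (cases k)
  case (Suc k')
  have "word k f p (p j) = map (\<lambda>t. f ((p ^^ Suc t) j)) [0..<Suc k']"
    by (simp add: Suc word_def funpow_swap1)
  also have "\<dots> = map (\<lambda>t. f ((p ^^ Suc t) j)) [0..<k'] @ [f j]"
    using assms Suc by simp
  finally show ?thesis
    by (simp add: Suc word_Suc) (simp add: word_def funpow_swap1)
qed (simp add: word_def)

lemma rotate1_inject:
  assumes "length xs = length ys" "rotate1 xs = rotate1 ys" shows "xs = ys"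
  using assms by (cases xs; cases ys) auto

lemma append_same_mono:
  fixes xs ys :: "'a::linorder list"
  assumes "length xs = length ys" "xs \<le> ys" shows "xs @ [a] \<le> ys @ [a]"
  using assms by (induction xs ys rule: list_induct2) auto

text \<open>With equal heads the comparison is decided by the tails, and both tails receive the same
  last letter.\<close>

lemma rotate1_mono:
  fixes xs ys :: "'a::linorder list"
  assumes "length xs = length ys" "xs \<le> ys" "hd xs = hd ys"
  shows "rotate1 xs \<le> rotate1 ys"
  using assms by (cases xs; cases ys) (auto intro: append_same_mono)

lemma hd_mono:
  fixes xs ys :: "'a::linorder list"
  assumes "length xs = length ys" "xs \<le> ys"
  shows "hd xs \<le> hd ys"
  using assms by (cases xs; cases ys) auto

text \<open>A tie in the first letter is passed on by \<open>inc\<close> to the images of the two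
  positions, in the same order; hence the first difference along the two orbits agrees with the
  order of the starting points.\<close>

lemma word_mono:
  fixes f :: "nat \<Rightarrow> 'c::linorder"
  assumes p: "p permutes {1..n}" and f: "mono_on {1..n} f"
    and inc: "\<And>i j. i \<in> {1..n} \<Longrightarrow> j \<in> {1..n} \<Longrightarrow> i < j \<Longrightarrow> f i = f j \<Longrightarrow> p i < p j"
    and "i \<in> {1..n}" "j \<in> {1..n}" "i \<le> j"
  shows "word k f p i \<le> word k f p j"
  using assms(4-6)
proof (induction k arbitrary: i j)
  case 0
  then show ?case by (simp add: word_def)
next
  case (Suc k)
  have le: "f i \<le> f j" using f Suc.prems by (auto simp: mono_on_def)
  show ?case
  proof (cases "f i = f j")
    case True
    then have "p i \<le> p j" using inc[of i j] Suc.prems by (cases "i = j") auto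
    moreover have "p i \<in> {1..n}" "p j \<in> {1..n}"
      using permutes_in_image[OF p] Suc.prems by blast+
    ultimately show ?thesis using Suc.IH[of "p i" "p j"] True by (simp add: word_Suc)
  qed (use le in \<open>simp add: word_Suc\<close>)
qed

section \<open>Recovering a permutation by sorting\<close>

text \<open>The permutation \<open>q \<circ> inv p\<close> is weakly increasing, and so is the
  identity, with the same values.\<close>

lemma permutes_eqI_order:
  fixes p q :: "nat \<Rightarrow> nat"
  assumes p: "p permutes {1..n}" and q: "q permutes {1..n}"
    and le: "\<And>i j. i \<in> {1..n} \<Longrightarrow> j \<in> {1..n} \<Longrightarrow> p i \<le> p j \<Longrightarrow> q i \<le> q j"
  shows "p = q"
proof -
  have ip: "inv p permutes {1..n}" using permutes_inv[OF p] .
  have qp: "(q \<circ> inv p) permutes {1..n}" using permutes_compose[OF ip q] .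
  have mono: "mono_on {1..n} (q \<circ> inv p)"
  proof (rule mono_onI)
    fix i j assume ij: "i \<in> {1..n}" "j \<in> {1..n}" "i \<le> j"
    then have "inv p i \<in> {1..n}" "inv p j \<in> {1..n}" using permutes_in_image[OF ip] by blast+
    then show "(q \<circ> inv p) i \<le> (q \<circ> inv p) j"
      using le[of "inv p i" "inv p j"] ij(3) permutes_inverses(1)[OF p] by simp
  qed
  have "content n (q \<circ> inv p) = content n (\<lambda>j. j)"
    using content_permute[OF qp, of "\<lambda>j. j"] by (simp add: o_def)
  then have "(q \<circ> inv p) j = j" if "j \<in> {1..n}" for j
    using mono_on_image_mset_unique[OF mono, of "\<lambda>j. j"] that
    by (simp add: content_def mono_on_def)
  then have "q (inv p j) = j" for j
    using permutes_not_in[OF qp] by (cases "j \<in> {1..n}") auto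
  then show ?thesis using permutes_inverses(2)[OF p] by (metis ext)
qed

text \<open>Stable sorting: \<open>p j\<close> is the rank of \<open>j\<close> when positions are
  ordered by \<open>key\<close>, with ties broken by position.\<close>

lemma rank_permutation_exists:
  fixes key :: "nat \<Rightarrow> 'a::linorder"
  obtains p where "p permutes {1..n}"
    "\<And>i j. i \<in> {1..n} \<Longrightarrow> j \<in> {1..n} \<Longrightarrow> key i < key j \<Longrightarrow> p i < p j"
    "\<And>i j. i \<in> {1..n} \<Longrightarrow> j \<in> {1..n} \<Longrightarrow> key i = key j \<Longrightarrow> i < j \<Longrightarrow> p i < p j"
proof -
  define r where "r i j \<longleftrightarrow> key i < key j \<or> key i = key j \<and> i \<le> j" for i j
  define p where "p j = (if j \<in> {1..n} then card {i \<in> {1..n}. r i j} else j)" for j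
  have less: "p i < p j" if "i \<in> {1..n}" "j \<in> {1..n}" "r i j" "i \<noteq> j" for i j
  proof -
    have "{l \<in> {1..n}. r l i} \<subset> {l \<in> {1..n}. r l j}"
      using that by (force simp: r_def)
    then show ?thesis using that by (auto simp: p_def intro: psubset_card_mono)
  qed
  have tot: "r i j \<or> r j i" for i j by (auto simp: r_def)
  have "inj_on p {1..n}" using less tot by (metis inj_onI less_irrefl)
  moreover have "p ` {1..n} \<subseteq> {1..n}"
  proof
    fix y assume "y \<in> p ` {1..n}"
    then obtain j where j: "j \<in> {1..n}" "y = card {i \<in> {1..n}. r i j}" by (auto simp: p_def)
    have "j \<in> {i \<in> {1..n}. r i j}" using j by (auto simp: r_def)
    then have "y > 0" using j by (auto simp: card_gt_0_iff)
    moreover have "y \<le> card {1..n}" unfolding j(2) by (rule card_mono) auto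
    ultimately show "y \<in> {1..n}" by simp
  qed
  ultimately have "bij_betw p {1..n} {1..n}"
    by (simp add: bij_betw_def endo_inj_surj)
  then have "p permutes {1..n}"
    by (rule bij_imp_permutes) (auto simp: p_def)
  then show ?thesis using less by (intro that[of p]) (auto simp: r_def)
qed

text \<open>The t-th letter of \<open>g j\<close> is the head of its t-th rotation, which is the
  word placed at the t-th iterate of \<open>j\<close>. Thus a family of words on which
  \<open>p\<close> acts by rotation is the family of colour words of its own heads.\<close>

lemma word_of_rotation:
  assumes p: "p permutes {1..n}" and g: "\<And>j. j \<in> {1..n} \<Longrightarrow> g (p j) = rotate1 (g j)"
    and len: "\<And>j. j \<in> {1..n} \<Longrightarrow> length (g j) = k" and f: "\<And>j. j \<in> {1..n} \<Longrightarrow> f j = hd (g j)"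
    and j: "j \<in> {1..n}"
  shows "word k f p j = g j" and "g ((p ^^ k) j) = g j"
proof -
  have rt: "g ((p ^^ t) j) = rotate t (g j)" for t
  proof (induction t)
    case (Suc t)
    then show ?case using g[OF funpow_in[OF p j]] by simp
  qed simp
  show "g ((p ^^ k) j) = g j" using rt len[OF j] by simp
  show "word k f p j = g j"
  proof (rule nth_equalityI)
    fix t assume "t < length (word k f p j)"
    then have t: "t < k" by simp
    have "f ((p ^^ t) j) = hd (rotate t (g j))"
      using f[OF funpow_in[OF p j]] rt by simp
    also have "\<dots> = g j ! t"
      using t len[OF j] by (subst hd_rotate_conv_nth) auto
    finally show "word k f p j ! t = g j ! t" using t by (simp add: word_def)
  qed (simp add: len[OF j])
qed

text \<open>A permutation that increases on the fibres of a weakly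
  increasing colouring is recovered from the multiset of its colour words, because the words of the
  positions \<open>1, \<dots>, n\<close> appear in lexicographic order.\<close>

definition increasing_roots :: "nat \<Rightarrow> nat \<Rightarrow> (nat \<Rightarrow> 'c) \<Rightarrow> ('c \<Rightarrow> bool) \<Rightarrow> (nat \<Rightarrow> nat) set" where
  "increasing_roots n k f\<^sub>0 neg =
     {p. p permutes {1..n} \<and>
         (\<forall>i\<in>{1..n}. \<forall>j\<in>{1..n}. i < j \<and> f\<^sub>0 i = f\<^sub>0 j \<longrightarrow> p i < p j) \<and>
         (\<forall>j\<in>{1..n}. (p ^^ k) j = j \<and> even_word neg (word k f\<^sub>0 p j))}"

text \<open>The word at \<open>p i\<close> is the rotation of the word at \<open>i\<close>, and
  words increase with the position. Equal rotations come from equal words, hence from equal colours,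
  and there \<open>p\<close> is increasing. So \<open>p\<close> is the stable ranking of the rotated
  words and is determined by the words.\<close>

lemma increasing_roots_order:
  fixes f\<^sub>0 :: "nat \<Rightarrow> 'c::linorder"
  assumes p: "p \<in> increasing_roots n k f\<^sub>0 neg" and k: "k > 0"
    and mono: "mono_on {1..n} (word k f\<^sub>0 p)" and i: "i \<in> {1..n}" and j: "j \<in> {1..n}"
    and "p i < p j"
  shows "rotate1 (word k f\<^sub>0 p i) < rotate1 (word k f\<^sub>0 p j) \<or>
         rotate1 (word k f\<^sub>0 p i) = rotate1 (word k f\<^sub>0 p j) \<and> i < j"
proof -
  let ?g = "word k f\<^sub>0 p"
  have pp: "p permutes {1..n}" using p by (simp add: increasing_roots_def)
  have "p i \<in> {1..n}" "p j \<in> {1..n}" using permutes_in_image[OF pp] i j by blast+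
  then have "?g (p i) \<le> ?g (p j)" using mono \<open>p i < p j\<close> by (auto simp: mono_on_def)
  moreover have "?g (p l) = rotate1 (?g l)" if "l \<in> {1..n}" for l
    using that p by (intro word_rotate1) (simp add: increasing_roots_def)
  ultimately have le: "rotate1 (?g i) \<le> rotate1 (?g j)" using i j by simp
  have "i < j" if eq: "rotate1 (?g i) = rotate1 (?g j)"
  proof (rule ccontr)
    assume "\<not> i < j"
    moreover have "f\<^sub>0 i = f\<^sub>0 j" using rotate1_inject[OF _ eq] hd_word[OF k] by (metis length_word)
    moreover have "p j < p i" if "j < i" "f\<^sub>0 j = f\<^sub>0 i"
      using p i j that unfolding increasing_roots_def by blast
    ultimately show False using \<open>p i < p j\<close> by (cases "i = j") auto
  qed
  with le show ?thesis by auto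
qed

text \<open>Injectivity: the words appear sorted, so their multiset determines them, and
  \<open>p\<close> is the stable ranking of their rotations. Surjectivity: list the multiset in
  increasing order as \<open>g\<close> and let \<open>p\<close> rank the rotations stably. Then
  \<open>g\<close> and the rotated words read in the order of \<open>p\<close> are two sorted
  listings of one multiset, so \<open>p\<close> acts on the words by rotation.\<close>

lemma bij_betw_increasing_roots:
  fixes f\<^sub>0 :: "nat \<Rightarrow> 'c::linorder"
  assumes k: "k > 0" and f0: "mono_on {1..n} f\<^sub>0"
  shows "bij_betw (\<lambda>p. content n (word k f\<^sub>0 p)) (increasing_roots n k f\<^sub>0 neg)
           (rotation_multisets k neg (content n f\<^sub>0))"
proof (rule bij_betw_imageI)
  have mono: "mono_on {1..n} (word k f\<^sub>0 p)" if "p \<in> increasing_roots n k f\<^sub>0 neg" for p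
  proof (rule mono_onI)
    fix i j assume ij: "i \<in> {1..n}" "j \<in> {1..n}" "i \<le> j"
    have "p permutes {1..n}"
      and "\<And>i j. i \<in> {1..n} \<Longrightarrow> j \<in> {1..n} \<Longrightarrow> i < j \<Longrightarrow> f\<^sub>0 i = f\<^sub>0 j \<Longrightarrow> p i < p j"
      using that unfolding increasing_roots_def by blast+
    from word_mono[OF this(1) f0 this(2) ij] show "word k f\<^sub>0 p i \<le> word k f\<^sub>0 p j" .
  qed
  show "inj_on (\<lambda>p. content n (word k f\<^sub>0 p)) (increasing_roots n k f\<^sub>0 neg)"
  proof (rule inj_onI)
    fix p q assume p: "p \<in> increasing_roots n k f\<^sub>0 neg" and q: "q \<in> increasing_roots n k f\<^sub>0 neg"
      and eq: "content n (word k f\<^sub>0 p) = content n (word k f\<^sub>0 q)"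
    have g: "word k f\<^sub>0 p j = word k f\<^sub>0 q j" if "j \<in> {1..n}" for j
      using mono_on_image_mset_unique[OF mono[OF p] mono[OF q]] eq that by (simp add: content_def)
    show "p = q"
    proof (rule permutes_eqI_order)
      fix i j assume ij: "i \<in> {1..n}" "j \<in> {1..n}" "p i \<le> p j"
      have pp: "p permutes {1..n}" using p by (simp add: increasing_roots_def)
      show "q i \<le> q j"
      proof (rule ccontr)
        assume "\<not> q i \<le> q j"
        then have "q j < q i" by simp
        note r2 = increasing_roots_order[OF q k mono[OF q] ij(2,1) this]
        have "p i < p j" using ij \<open>q j < q i\<close> permutes_inj[OF pp]
          by (metis injD le_neq_implies_less less_irrefl)
        note r1 = increasing_roots_order[OF p k mono[OF p] ij(1,2) this]
        show False using r1 r2 g ij by auto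
      qed
    qed (use p q in \<open>simp_all add: increasing_roots_def\<close>)
  qed
  show "(\<lambda>p. content n (word k f\<^sub>0 p)) ` increasing_roots n k f\<^sub>0 neg
          = rotation_multisets k neg (content n f\<^sub>0)"
  proof (intro equalityI subsetI)
    fix m assume "m \<in> (\<lambda>p. content n (word k f\<^sub>0 p)) ` increasing_roots n k f\<^sub>0 neg"
    then obtain p where p: "p \<in> increasing_roots n k f\<^sub>0 neg" and m: "m = content n (word k f\<^sub>0 p)"
      by auto
    have pp: "p permutes {1..n}" using p by (simp add: increasing_roots_def)
    have "image_mset rotate1 m = content n (\<lambda>j. word k f\<^sub>0 p (p j))"
      unfolding m content_comp[symmetric]
      by (intro content_cong word_rotate1[symmetric]) (use p in \<open>simp add: increasing_roots_def\<close>)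
    then have "image_mset rotate1 m = m" using content_permute[OF pp] m by simp
    moreover have "image_mset hd m = content n f\<^sub>0"
      by (simp add: m content_comp[symmetric] hd_word[OF k])
    ultimately show "m \<in> rotation_multisets k neg (content n f\<^sub>0)"
      unfolding rotation_multisets_def mem_Collect_eq m set_mset_content
      using p by (simp add: increasing_roots_def)
  next
    fix m assume m: "m \<in> rotation_multisets k neg (content n f\<^sub>0)"
    then have hdm: "image_mset hd m = content n f\<^sub>0" and rot: "image_mset rotate1 m = m"
      by (auto simp: rotation_multisets_def)
    have "size m = n" using hdm size_content by (metis size_image_mset)
    then obtain g where g: "mono_on {1..n} g" "content n g = m"
      using mono_on_listing_exists[of m n] unfolding content_def by blast
    have gm: "length (g j) = k" "even_word neg (g j)" if "j \<in> {1..n}" for j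
    proof -
      have "g j \<in># m" using g(2) that by (metis set_mset_content imageI)
      then show "length (g j) = k" "even_word neg (g j)" using m by (auto simp: rotation_multisets_def)
    qed
    obtain p where p: "p permutes {1..n}"
      and p1: "\<And>i j. i \<in> {1..n} \<Longrightarrow> j \<in> {1..n} \<Longrightarrow> rotate1 (g i) < rotate1 (g j) \<Longrightarrow> p i < p j"
      and p2: "\<And>i j. i \<in> {1..n} \<Longrightarrow> j \<in> {1..n} \<Longrightarrow> rotate1 (g i) = rotate1 (g j) \<Longrightarrow> i < j \<Longrightarrow> p i < p j"
      using rank_permutation_exists[of n "\<lambda>j. rotate1 (g j)"] by blast
    have ip: "inv p permutes {1..n}" using permutes_inv[OF p] .
    have mr: "mono_on {1..n} (\<lambda>j. rotate1 (g (inv p j)))"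
    proof (rule mono_onI, rule ccontr)
      fix i j assume ij: "i \<in> {1..n}" "j \<in> {1..n}" "i \<le> j"
        and "\<not> rotate1 (g (inv p i)) \<le> rotate1 (g (inv p j))"
      then have "rotate1 (g (inv p j)) < rotate1 (g (inv p i))" by simp
      moreover have "inv p i \<in> {1..n}" "inv p j \<in> {1..n}" using permutes_in_image[OF ip] ij by blast+
      ultimately have "p (inv p j) < p (inv p i)" by (intro p1)
      then show False using ij permutes_inverses(1)[OF p] by simp
    qed
    have "content n (\<lambda>j. rotate1 (g (inv p j))) = content n g"
      using content_permute[OF ip, of "\<lambda>j. rotate1 (g j)"] content_comp[of n rotate1 g] rot g(2) by simp
    then have gi: "rotate1 (g (inv p j)) = g j" if "j \<in> {1..n}" for j
      using mono_on_image_mset_unique[OF mr g(1) _ that] by (simp add: content_def)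
    have gp: "g (p j) = rotate1 (g j)" if "j \<in> {1..n}" for j
    proof -
      have "p j \<in> {1..n}" using permutes_in_image[OF p] that by blast
      from gi[OF this] show ?thesis by (simp add: permutes_inverses(2)[OF p])
    qed
    have mh: "mono_on {1..n} (\<lambda>j. hd (g j))"
      using g(1) gm by (auto simp: mono_on_def intro!: hd_mono)
    have "content n (\<lambda>j. hd (g j)) = content n f\<^sub>0"
      using hdm g(2) content_comp[of n hd g] by simp
    then have hdg: "hd (g j) = f\<^sub>0 j" if "j \<in> {1..n}" for j
      using mono_on_image_mset_unique[OF mh f0 _ that] by (simp add: content_def)
    have rt: "g ((p ^^ t) j) = rotate t (g j)" if "j \<in> {1..n}" for t j
    proof (induction t)
      case (Suc t)
      then show ?case using gp[OF funpow_in[OF p that]] by simp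
    qed simp
    have word: "word k f\<^sub>0 p j = g j" if j: "j \<in> {1..n}" for j
    proof (rule word_of_rotation(1)[OF p _ _ _ j])
      fix i assume i: "i \<in> {1..n}"
      show "g (p i) = rotate1 (g i)" by (rule gp[OF i])
      show "length (g i) = k" by (rule gm(1)[OF i])
      show "f\<^sub>0 i = hd (g i)" by (rule hdg[OF i, symmetric])
    qed
    have inc: "p i < p j" if ij: "i \<in> {1..n}" "j \<in> {1..n}" "i < j" "f\<^sub>0 i = f\<^sub>0 j" for i j
    proof -
      have "rotate1 (g i) \<le> rotate1 (g j)"
      proof (rule rotate1_mono)
        show "length (g i) = length (g j)" using gm(1)[OF ij(1)] gm(1)[OF ij(2)] by simp
        show "g i \<le> g j" using mono_onD[OF g(1) ij(1,2)] ij(3) by simp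
        show "hd (g i) = hd (g j)" using hdg[OF ij(1)] hdg[OF ij(2)] ij(4) by simp
      qed
      then show ?thesis using p1[OF ij(1,2)] p2[OF ij(1,2) _ ij(3)] by (auto simp: le_less)
    qed
    have strict: "p i < p j" if ij: "i \<in> {1..n}" "j \<in> {1..n}" "g i = g j" "i < j" for i j
      using inc[OF ij(1,2,4)] hdg[OF ij(1)] hdg[OF ij(2)] ij(3) by simp
    have pk: "(p ^^ t) i < (p ^^ t) j" if ij: "i \<in> {1..n}" "j \<in> {1..n}" "g i = g j" "i < j" for t i j
    proof (induction t)
      case (Suc t)
      have "g ((p ^^ t) i) = g ((p ^^ t) j)" using rt[OF ij(1)] rt[OF ij(2)] ij(3) by simp
      then show ?case using strict[OF funpow_in[OF p ij(1)] funpow_in[OF p ij(2)]] Suc by simp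
    qed (use ij in simp)
    \<comment> \<open>The \<open>k\<close>-th power of \<open>p\<close> fixes every word and, by
      \<open>pk\<close>, keeps the order of positions that share a word. As the words are sorted, it
      keeps the order of all positions.\<close>
    have id: "(p ^^ k) j = j" if j: "j \<in> {1..n}" for j
    proof -
      have q: "(p ^^ k) permutes {1..n}" using funpow_permutes[OF p] .
      have gq: "g ((p ^^ k) i) = g i" if "i \<in> {1..n}" for i using rt[OF that] gm[OF that] by simp
      have "p ^^ k = id"
      proof (rule permutes_eqI_order[OF q permutes_id])
        fix i j assume ij: "i \<in> {1..n}" "j \<in> {1..n}" "(p ^^ k) i \<le> (p ^^ k) j"
        have "g ((p ^^ k) i) \<le> g ((p ^^ k) j)"
          using mono_onD[OF g(1) funpow_in[OF p ij(1)] funpow_in[OF p ij(2)] ij(3)] .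
        then have le: "g i \<le> g j" using gq[OF ij(1)] gq[OF ij(2)] by simp
        show "id i \<le> id j"
        proof (rule ccontr)
          assume "\<not> id i \<le> id j"
          then have ji: "j < i" by simp
          then have "g j \<le> g i" using mono_onD[OF g(1) ij(2,1)] by simp
          with le have "g j = g i" by simp
          from pk[OF ij(2,1) this ji, of k] ij(3) show False by simp
        qed
      qed
      then show ?thesis by simp
    qed
    have "p \<in> increasing_roots n k f\<^sub>0 neg"
      unfolding increasing_roots_def
    proof (intro CollectI conjI ballI impI)
      fix j assume j: "j \<in> {1..n}"
      show "even_word neg (word k f\<^sub>0 p j)" using gm(2)[OF j] word[OF j] by simp
      show "(p ^^ k) j = j" by (rule id[OF j])
    next
      fix i j assume "i \<in> {1..n}" "j \<in> {1..n}" "i < j \<and> f\<^sub>0 i = f\<^sub>0 j"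
      then show "p i < p j" using inc by blast
    qed (rule p)
    moreover have "content n (word k f\<^sub>0 p) = content n g"
      by (rule content_cong) (rule word)
    ultimately show "m \<in> (\<lambda>p. content n (word k f\<^sub>0 p)) ` increasing_roots n k f\<^sub>0 neg"
      unfolding g(2) by (intro image_eqI[where x = p]) simp_all
  qed
qed

section \<open>Summation over the signs of a permutation\<close>

lemma sum_Pow_prod: "finite A \<Longrightarrow> (\<Sum>N\<in>Pow A. \<Prod>i\<in>N. a i) = (\<Prod>i\<in>A. 1 + (a i :: 'b::comm_ring_1))"
  using prod_add[of A a "\<lambda>_. 1"] by (simp add: add.commute)

text \<open>Collect the factors by the point at which the sign is taken. The point reached from
  \<open>i\<close> after \<open>k - 1\<close> steps is met from the \<open>k\<close> iterates
  \<open>i\<close>, \<open>p i\<close>, ... whose colours spell the word of \<open>i\<close>, once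
  for each \<open>neg\<close> letter; only the parity of this number matters.\<close>

lemma prod_sign_word:
  fixes s :: "nat \<Rightarrow> int"
  assumes p: "p permutes {1..n}" and s: "\<And>i. s i = 1 \<or> s i = - 1"
  shows "(\<Prod>j\<in>{1..n}. if neg (f j) then \<Prod>t<k. s ((p ^^ t) j) else 1)
       = (\<Prod>i\<in>{1..n}. if even_word neg (word k f p i) then 1 else s ((p ^^ (k - 1)) i))"
proof -
  define h where "h j i = (if neg (f j) then s i else 1)" for j i
  have "(\<Prod>j\<in>{1..n}. if neg (f j) then \<Prod>t<k. s ((p ^^ t) j) else 1)
      = (\<Prod>j\<in>{1..n}. \<Prod>t<k. h j ((p ^^ t) j))"
    by (rule prod.cong) (auto simp: h_def)
  also have "\<dots> = (\<Prod>t<k. \<Prod>j\<in>{1..n}. h j ((p ^^ t) j))"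
    by (rule prod.swap)
  \<comment> \<open>Substituting the iterate of order \<open>k - Suc t\<close> for \<open>j\<close>
    moves the sign to the same point for all \<open>t\<close>.\<close>
  also have "\<dots> = (\<Prod>t<k. \<Prod>i\<in>{1..n}. h ((p ^^ (k - Suc t)) i) ((p ^^ (k - 1)) i))"
  proof (rule prod.cong)
    fix t assume "t \<in> {..<k}"
    then have "t + (k - Suc t) = k - 1" by auto
    then have "(p ^^ t) ((p ^^ (k - Suc t)) i) = (p ^^ (k - 1)) i" for i
      by (metis comp_apply funpow_add)
    then show "(\<Prod>j\<in>{1..n}. h j ((p ^^ t) j))
        = (\<Prod>i\<in>{1..n}. h ((p ^^ (k - Suc t)) i) ((p ^^ (k - 1)) i))"
      using prod.permute[OF funpow_permutes[OF p], of "\<lambda>j. h j ((p ^^ t) j)" "k - Suc t"]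
      by (simp add: o_def)
  qed simp
  also have "\<dots> = (\<Prod>i\<in>{1..n}. \<Prod>t<k. h ((p ^^ (k - Suc t)) i) ((p ^^ (k - 1)) i))"
    by (rule prod.swap)
  also have "\<dots> = (\<Prod>i\<in>{1..n}. \<Prod>t<k. h ((p ^^ t) i) ((p ^^ (k - 1)) i))"
    by (rule prod.cong) (simp_all add: prod.nat_diff_reindex[of "\<lambda>t. h ((p ^^ t) _) _"])
  also have "\<dots> = (\<Prod>i\<in>{1..n}. s ((p ^^ (k - 1)) i) ^ length (filter neg (word k f p i)))"
  proof (rule prod.cong)
    fix i
    have "(\<Prod>t<l. h ((p ^^ t) i) x) = s x ^ length (filter neg (word l f p i))" for l x
      unfolding word_def h_def by (induction l) auto
    then show "(\<Prod>t<k. h ((p ^^ t) i) ((p ^^ (k - 1)) i))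
        = s ((p ^^ (k - 1)) i) ^ length (filter neg (word k f p i))" .
  qed simp
  also have "\<dots> = (\<Prod>i\<in>{1..n}. if even_word neg (word k f p i) then 1 else s ((p ^^ (k - 1)) i))"
  proof (rule prod.cong)
    fix i
    show "s ((p ^^ (k - 1)) i) ^ length (filter neg (word k f p i))
        = (if even_word neg (word k f p i) then 1 else s ((p ^^ (k - 1)) i))"
      using s[of "(p ^^ (k - 1)) i"] by (auto simp: even_word_def)
  qed simp
  finally show ?thesis .
qed

text \<open>By \<open>prod_sign_word\<close> the summand is a product over the positions in
  \<open>N\<close> of 1 or -1, according to the parity of a word, so the sum over all
  \<open>N\<close> is a product of factors 1 + 1 or 1 - 1.\<close>

lemma sum_over_signs:
  assumes p: "p permutes {1..n}"
  shows "(\<Sum>N\<in>Pow {1..n}. \<Prod>j\<in>{1..n}. if neg (f j) then sign_at (make_signed p N ^^ k) j else 1)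
       = (if \<forall>j\<in>{1..n}. even_word neg (word k f p j) then 2 ^ n else 0)"
proof -
  define q where "q = p ^^ (k - 1)"
  have q: "q permutes {1..n}" using funpow_permutes[OF p] by (simp add: q_def)
  \<comment> \<open>The sign at \<open>i\<close> is governed by the word that ends at
    \<open>i\<close>, and this word starts at \<open>inv q i\<close>.\<close>
  define a :: "nat \<Rightarrow> int" where "a i = (if even_word neg (word k f p (inv q i)) then 1 else - 1)" for i
  have "(\<Prod>j\<in>{1..n}. if neg (f j) then sign_at (make_signed p N ^^ k) j else 1) = (\<Prod>i\<in>N. a i)"
    if N: "N \<in> Pow {1..n}" for N
  proof -
    let ?s = "\<lambda>i. if i \<in> N then - 1 else 1 :: int"
    have w: "make_signed p N \<in> signed_perms n" using make_signed_in_signed_perms[OF p] N by blast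
    have "sign_at (make_signed p N ^^ k) j = (\<Prod>t<k. ?s ((p ^^ t) j))" if "j \<in> {1..n}" for j
      unfolding sign_at_funpow[OF w] abs_perm_make_signed[OF p]
      by (rule prod.cong) (auto simp: sign_at_make_signed[OF p funpow_in[OF p that]])
    then have "(\<Prod>j\<in>{1..n}. if neg (f j) then sign_at (make_signed p N ^^ k) j else 1)
        = (\<Prod>j\<in>{1..n}. if neg (f j) then \<Prod>t<k. ?s ((p ^^ t) j) else 1)"
      by (intro prod.cong) auto
    also have "\<dots> = (\<Prod>i\<in>{1..n}. if even_word neg (word k f p i) then 1 else ?s (q i))"
      unfolding q_def by (rule prod_sign_word[OF p]) auto
    also have "\<dots> = (\<Prod>i\<in>{1..n}. if even_word neg (word k f p (inv q i)) then 1 else ?s i)"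
      using prod.permute[OF permutes_inv[OF q], of "\<lambda>i. if even_word neg (word k f p i) then 1 else ?s (q i)"]
      by (simp add: o_def permutes_inverses(1)[OF q] cong: if_cong)
    also have "\<dots> = (\<Prod>i\<in>N. a i)"
      by (rule prod.mono_neutral_cong_right) (use N in \<open>auto simp: a_def\<close>)
    finally show ?thesis .
  qed
  then have "(\<Sum>N\<in>Pow {1..n}. \<Prod>j\<in>{1..n}. if neg (f j) then sign_at (make_signed p N ^^ k) j else 1)
      = (\<Sum>N\<in>Pow {1..n}. \<Prod>i\<in>N. a i)"
    by (rule sum.cong[OF refl])
  also have "\<dots> = (\<Prod>i\<in>{1..n}. 1 + a i)" by (simp add: sum_Pow_prod)
  also have "\<dots> = (\<Prod>i\<in>{1..n}. 1 + a (q i))"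
    using prod.permute[OF q, of "\<lambda>i. 1 + a i"] by (simp add: o_def)
  also have "\<dots> = (\<Prod>i\<in>{1..n}. if even_word neg (word k f p i) then 2 else 0)"
    by (rule prod.cong) (auto simp: a_def permutes_inverses(2)[OF q])
  also have "\<dots> = (if \<forall>j\<in>{1..n}. even_word neg (word k f p j) then 2 ^ n else 0)"
    by (auto simp: prod_zero_iff)
  finally show ?thesis .
qed

section \<open>Coloured permutations counted by their multisets of words\<close>

definition even_pairs :: "nat \<Rightarrow> nat \<Rightarrow> ('c \<Rightarrow> bool) \<Rightarrow> 'c multiset \<Rightarrow> ((nat \<Rightarrow> nat) \<times> (nat \<Rightarrow> 'c)) set" where
  "even_pairs n k neg M =
     (SIGMA p:{p. p permutes {1..n}}. {f \<in> fixed_colourings n M (p ^^ k).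
        \<forall>j\<in>{1..n}. even_word neg (word k f p j)})"

lemma finite_even_pairs: "finite (even_pairs n k neg M)"
  unfolding even_pairs_def
  by (intro finite_SigmaI finite_permutations finite_subset[OF Collect_restrict finite_fixed_colourings]) simp

lemma sum_signed_fix_power:
  "(\<Sum>u\<in>signed_perms n. signed_fix n M neg (u ^^ k)) = 2 ^ n * int (card (even_pairs n k neg M))"
proof -
  have "(\<Sum>u\<in>signed_perms n. signed_fix n M neg (u ^^ k))
      = (\<Sum>u\<in>signed_perms n. \<Sum>f\<in>fixed_colourings n M (abs_perm u ^^ k).
           \<Prod>j\<in>{1..n}. if neg (f j) then sign_at (u ^^ k) j else 1)"
    by (rule sum.cong) (simp_all add: signed_fix_def abs_perm_funpow)
  also have "\<dots> = (\<Sum>p | p permutes {1..n}. \<Sum>N\<in>Pow {1..n}. \<Sum>f\<in>fixed_colourings n M (p ^^ k).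
           \<Prod>j\<in>{1..n}. if neg (f j) then sign_at (make_signed p N ^^ k) j else 1)"
    by (rule sum_signed_perms[of "\<lambda>p u. \<Sum>f\<in>fixed_colourings n M (p ^^ k).
           \<Prod>j\<in>{1..n}. if neg (f j) then sign_at (u ^^ k) j else 1"])
  also have "\<dots> = (\<Sum>p | p permutes {1..n}. \<Sum>f\<in>fixed_colourings n M (p ^^ k).
           if \<forall>j\<in>{1..n}. even_word neg (word k f p j) then 2 ^ n else 0)"
  proof (rule sum.cong)
    fix p assume "p \<in> {p. p permutes {1..n}}"
    then have p: "p permutes {1..n}" by simp
    show "(\<Sum>N\<in>Pow {1..n}. \<Sum>f\<in>fixed_colourings n M (p ^^ k).
           \<Prod>j\<in>{1..n}. if neg (f j) then sign_at (make_signed p N ^^ k) j else 1)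
        = (\<Sum>f\<in>fixed_colourings n M (p ^^ k).
           if \<forall>j\<in>{1..n}. even_word neg (word k f p j) then 2 ^ n else 0)"
      by (subst sum.swap) (simp only: sum_over_signs[OF p])
  qed simp
  also have "\<dots> = (\<Sum>p | p permutes {1..n}. 2 ^ n * int (card {f \<in> fixed_colourings n M (p ^^ k).
           \<forall>j\<in>{1..n}. even_word neg (word k f p j)}))"
  proof (rule sum.cong)
    fix p
    show "(\<Sum>f\<in>fixed_colourings n M (p ^^ k).
           if \<forall>j\<in>{1..n}. even_word neg (word k f p j) then 2 ^ n else 0)
        = 2 ^ n * int (card {f \<in> fixed_colourings n M (p ^^ k).
           \<forall>j\<in>{1..n}. even_word neg (word k f p j)})"
      using finite_fixed_colourings[of n M "p ^^ k"]
      by (subst sum.inter_filter[symmetric]) auto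
  qed simp
  also have "\<dots> = 2 ^ n * int (card (even_pairs n k neg M))"
    unfolding even_pairs_def
    by (subst card_SigmaI) (auto simp: finite_permutations finite_fixed_colourings sum_distrib_left)
  finally show ?thesis .
qed

text \<open>Choose \<open>a\<close> with rotation of \<open>g\<close> equal to
  \<open>g \<circ> a\<close>, and \<open>b\<close> with \<open>g\<close> equal to
  \<open>g\<^sub>0 \<circ> b\<close>. Composition with \<open>b\<close> and \<open>inv a\<close>
  then matches the two conditions. The second count is easy to sum over \<open>g\<close>, since
  \<open>g\<^sub>0\<close> does not vary.\<close>

lemma card_rotation_fibre:
  assumes m: "image_mset rotate1 m = m" and g: "content n g = m" and g0: "content n g\<^sub>0 = m"
  shows "card {p. p permutes {1..n} \<and> (\<forall>j\<in>{1..n}. g (p j) = rotate1 (g j))}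
       = card {q. q permutes {1..n} \<and> (\<forall>j\<in>{1..n}. g\<^sub>0 (q j) = g j)}" (is "card ?P = card ?Q")
proof -
  have "image_mset (\<lambda>j. rotate1 (g j)) (mset_set {1..n}) = image_mset g (mset_set {1..n})"
    using m g content_comp[of n rotate1 g] by (simp add: content_def)
  then obtain a where a: "a permutes {1..n}" "\<forall>j\<in>{1..n}. rotate1 (g j) = g (a j)"
    by (rule image_mset_eq_implies_permutes[rotated]) auto
  have "image_mset g (mset_set {1..n}) = image_mset g\<^sub>0 (mset_set {1..n})"
    using g g0 by (simp add: content_def)
  then obtain b where b: "b permutes {1..n}" "\<forall>j\<in>{1..n}. g j = g\<^sub>0 (b j)"
    by (rule image_mset_eq_implies_permutes[rotated]) auto
  have mem: "q j \<in> {1..n}" if "q permutes {1..n}" "j \<in> {1..n}" for q j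
    using permutes_in_image[OF that(1)] that(2) by blast
  have "bij_betw (\<lambda>p. b \<circ> p \<circ> inv a) ?P ?Q"
  proof (rule bij_betw_byWitness[where f' = "\<lambda>q. inv b \<circ> q \<circ> a"])
    show "\<forall>p\<in>?P. inv b \<circ> (b \<circ> p \<circ> inv a) \<circ> a = p"
      by (auto simp: fun_eq_iff permutes_inverses[OF a(1)] permutes_inverses[OF b(1)])
    show "\<forall>q\<in>?Q. b \<circ> (inv b \<circ> q \<circ> a) \<circ> inv a = q"
      by (auto simp: fun_eq_iff permutes_inverses[OF a(1)] permutes_inverses[OF b(1)])
    show "(\<lambda>p. b \<circ> p \<circ> inv a) ` ?P \<subseteq> ?Q"
    proof (intro image_subsetI CollectI conjI ballI)
      fix p j assume p: "p \<in> ?P" and j: "j \<in> {1..n}"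
      have ij: "inv a j \<in> {1..n}" using mem[OF permutes_inv[OF a(1)] j] .
      have "g\<^sub>0 (b (p (inv a j))) = g (p (inv a j))" using b(2) mem[of p] p ij by simp
      also have "\<dots> = g (a (inv a j))" using p ij a(2) by simp
      finally show "g\<^sub>0 ((b \<circ> p \<circ> inv a) j) = g j" by (simp add: permutes_inverses(1)[OF a(1)])
    qed (use a(1) b(1) in \<open>simp_all add: permutes_compose permutes_inv\<close>)
    show "(\<lambda>q. inv b \<circ> q \<circ> a) ` ?Q \<subseteq> ?P"
    proof (intro image_subsetI CollectI conjI ballI)
      fix q j assume q: "q \<in> ?Q" and j: "j \<in> {1..n}"
      have aj: "a j \<in> {1..n}" using mem[OF a(1) j] .
      have "inv b (q (a j)) \<in> {1..n}" using mem[OF permutes_inv[OF b(1)]] mem[of q] q aj by simp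
      then have "g (inv b (q (a j))) = g\<^sub>0 (q (a j))" using b(2) by (simp add: permutes_inverses(1)[OF b(1)])
      also have "\<dots> = g (a j)" using q aj by simp
      finally show "g ((inv b \<circ> q \<circ> a) j) = rotate1 (g j)" using a(2) j by simp
    qed (use a(1) b(1) in \<open>simp_all add: permutes_compose permutes_inv\<close>)
  qed
  then show ?thesis by (rule bij_betw_same_card)
qed

text \<open>A pair with word multiset \<open>m\<close> amounts to a listing \<open>g\<close> of
  \<open>m\<close> together with a permutation acting on \<open>g\<close> by rotation; the colouring
  consists of the heads. By \<open>card_rotation_fibre\<close> the permutations for a given
  \<open>g\<close> are as many as those that carry a fixed listing \<open>g\<^sub>0\<close> to
  \<open>g\<close>, and each of the n! permutations does this for exactly one
  \<open>g\<close>.\<close>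

lemma card_even_pairs_fibre:
  assumes k: "k > 0" and m: "m \<in> rotation_multisets k neg M" and size: "size M = n"
  shows "card {(p, f) \<in> even_pairs n k neg M. content n (word k f p) = m} = fact n"
proof -
  let ?A = "{1..n}"
  let ?T = "{(p, f) \<in> even_pairs n k neg M. content n (word k f p) = m}"
  let ?G = "{g \<in> ?A \<rightarrow>\<^sub>E UNIV. content n g = m}"
  let ?P = "\<lambda>g. {p. p permutes ?A \<and> (\<forall>j\<in>?A. g (p j) = rotate1 (g j))}"
  have rot: "image_mset rotate1 m = m" and hdm: "image_mset hd m = M"
    and mem: "\<And>\<omega>. \<omega> \<in># m \<Longrightarrow> length \<omega> = k \<and> even_word neg \<omega>"
    using m by (auto simp: rotation_multisets_def)
  have "size m = n" using hdm size by (metis size_image_mset)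
  moreover obtain xs where xs: "mset xs = m" using ex_mset by blast
  ultimately have "length xs = n" by (metis size_mset)
  then have "map (\<lambda>j. xs ! (j - 1)) [1..<Suc n] = xs"
    by (auto intro!: nth_equalityI simp del: upt_Suc)
  then have "mset (map (\<lambda>j. xs ! (j - 1)) [1..<Suc n]) = m" using xs by simp
  then have g0: "content n (\<lambda>j. xs ! (j - 1)) = m"
    by (simp add: content_def mset_upt atLeastLessThanSuc_atLeastAtMost del: upt_Suc)
  define g\<^sub>0 where "g\<^sub>0 = (\<lambda>j. xs ! (j - 1))"
  have g0: "content n g\<^sub>0 = m" using g0 by (simp add: g\<^sub>0_def)
  have finG: "finite ?G"
    by (rule finite_subset[of _ "?A \<rightarrow>\<^sub>E set_mset m"])
       (auto simp: set_mset_content intro: finite_PiE)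
  have wordG: "length (g j) = k \<and> even_word neg (g j)" if "content n g = m" "j \<in> ?A" for g j
    by (rule mem) (use that in \<open>auto simp: set_mset_content\<close>)
  have "bij_betw (\<lambda>(p, f). (restrict (word k f p) ?A, p)) ?T (SIGMA g:?G. ?P g)"
  proof (rule bij_betw_byWitness[where f' = "\<lambda>(g, p). (p, restrict (\<lambda>j. hd (g j)) ?A)"])
    show "\<forall>x\<in>?T. (\<lambda>(g, p). (p, restrict (\<lambda>j. hd (g j)) ?A)) ((\<lambda>(p, f). (restrict (word k f p) ?A, p)) x) = x"
    proof (intro ballI)
      fix x assume "x \<in> ?T"
      then obtain p f where x: "x = (p, f)" "f \<in> extensional ?A"
        by (auto simp: even_pairs_def fixed_colourings_def PiE_def)
      have "restrict (\<lambda>j. hd (restrict (word k f p) ?A j)) ?A = f"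
        using x(2) by (intro extensionalityI[of _ ?A]) (simp_all add: hd_word[OF k])
      then show "(\<lambda>(g, p). (p, restrict (\<lambda>j. hd (g j)) ?A)) ((\<lambda>(p, f). (restrict (word k f p) ?A, p)) x) = x"
        using x(1) by simp
    qed
    have inv: "(p, restrict (\<lambda>j. hd (g j)) ?A) \<in> ?T \<and>
        restrict (word k (restrict (\<lambda>j. hd (g j)) ?A) p) ?A = g"
      if g: "g \<in> ?G" and p: "p \<in> ?P g" for g p
    proof -
      let ?f = "restrict (\<lambda>j. hd (g j)) ?A"
      have pp: "p permutes ?A" and gp: "\<And>j. j \<in> ?A \<Longrightarrow> g (p j) = rotate1 (g j)" using p by blast+
      have cg: "content n g = m" using g by blast
      have len: "length (g j) = k" if "j \<in> ?A" for j using wordG[OF cg that] by blast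
      have f: "?f j = hd (g j)" if "j \<in> ?A" for j using that by simp
      have w: "word k ?f p j = g j" "g ((p ^^ k) j) = g j" if "j \<in> ?A" for j
        by (rule word_of_rotation[where f = ?f, OF pp gp len f that]; assumption)+
      have 1: "restrict (word k ?f p) ?A = g"
        using g w(1) by (intro extensionalityI[of _ ?A]) (auto simp: PiE_def)
      have 2: "content n (word k ?f p) = m"
        using content_cong[of n "word k ?f p" g] w(1) cg by blast
      have 3: "content n ?f = M"
        using content_cong[of n ?f "\<lambda>j. hd (g j)"] content_comp[of n hd g] cg hdm f by simp
      have 4: "?f ((p ^^ k) j) = ?f j" if "j \<in> ?A" for j
        using f[OF that] f[OF funpow_in[OF pp that]] w(2)[OF that] by simp
      have 5: "even_word neg (word k ?f p j)" if "j \<in> ?A" for j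
        using w(1)[OF that] wordG[OF cg that] by simp
      have "?f \<in> fixed_colourings n M (p ^^ k)"
        unfolding fixed_colourings_def using 3 4 by simp
      then show ?thesis using 1 2 5 pp by (simp add: even_pairs_def)
    qed
    show "\<forall>x\<in>SIGMA g:?G. ?P g. (\<lambda>(p, f). (restrict (word k f p) ?A, p))
        ((\<lambda>(g, p). (p, restrict (\<lambda>j. hd (g j)) ?A)) x) = x"
    proof (intro ballI)
      fix x assume "x \<in> (SIGMA g:?G. ?P g)"
      then obtain g p where "x = (g, p)" "g \<in> ?G" "p \<in> ?P g" by (rule SigmaE)
      with inv[of g p] show "(\<lambda>(p, f). (restrict (word k f p) ?A, p))
        ((\<lambda>(g, p). (p, restrict (\<lambda>j. hd (g j)) ?A)) x) = x" by simp
    qed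
    show "(\<lambda>(g, p). (p, restrict (\<lambda>j. hd (g j)) ?A)) ` (SIGMA g:?G. ?P g) \<subseteq> ?T"
    proof (intro image_subsetI)
      fix x assume "x \<in> (SIGMA g:?G. ?P g)"
      then obtain g p where "x = (g, p)" "g \<in> ?G" "p \<in> ?P g" by (rule SigmaE)
      with inv[of g p] show "(\<lambda>(g, p). (p, restrict (\<lambda>j. hd (g j)) ?A)) x \<in> ?T" by simp
    qed
    show "(\<lambda>(p, f). (restrict (word k f p) ?A, p)) ` ?T \<subseteq> (SIGMA g:?G. ?P g)"
    proof (intro image_subsetI)
      fix x assume "x \<in> ?T"
      then obtain p f where x: "x = (p, f)" "p permutes ?A" "f \<in> fixed_colourings n M (p ^^ k)"
        "content n (word k f p) = m" by (auto simp: even_pairs_def)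
      have "restrict (word k f p) ?A \<in> ?G"
        using x(4) content_cong[of n "restrict (word k f p) ?A" "word k f p"] by simp
      moreover have "restrict (word k f p) ?A (p j) = rotate1 (restrict (word k f p) ?A j)"
        if "j \<in> ?A" for j
      proof -
        have "p j \<in> ?A" using permutes_in_image[OF x(2)] that by blast
        moreover have "f ((p ^^ k) j) = f j" using x(3) that by (simp add: fixed_colourings_def)
        ultimately show ?thesis using word_rotate1[of f k p j] that by simp
      qed
      ultimately show "(\<lambda>(p, f). (restrict (word k f p) ?A, p)) x \<in> (SIGMA g:?G. ?P g)"
        using x(1,2) by simp
    qed
  qed
  then have "card ?T = card (SIGMA g:?G. ?P g)" by (rule bij_betw_same_card)
  also have "\<dots> = (\<Sum>g\<in>?G. card (?P g))"
    using finG by (intro card_SigmaI) (auto intro: finite_subset[OF _ finite_permutations[of ?A]])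
  also have "\<dots> = (\<Sum>g\<in>?G. card {q. q permutes ?A \<and> (\<forall>j\<in>?A. g\<^sub>0 (q j) = g j)})"
    by (intro sum.cong refl card_rotation_fibre[OF rot _ g0]) auto
  also have "\<dots> = (\<Sum>g\<in>?G. \<Sum>q\<in>{q \<in> {q. q permutes ?A}. restrict (\<lambda>j. g\<^sub>0 (q j)) ?A = g}. 1)"
  proof (rule sum.cong)
    fix g assume g: "g \<in> ?G"
    have "{q. q permutes ?A \<and> (\<forall>j\<in>?A. g\<^sub>0 (q j) = g j)}
        = {q \<in> {q. q permutes ?A}. restrict (\<lambda>j. g\<^sub>0 (q j)) ?A = g}"
    proof (intro set_eqI)
      fix q
      have "(\<forall>j\<in>?A. g\<^sub>0 (q j) = g j) \<longleftrightarrow> restrict (\<lambda>j. g\<^sub>0 (q j)) ?A = g"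
      proof
        assume "\<forall>j\<in>?A. g\<^sub>0 (q j) = g j"
        then show "restrict (\<lambda>j. g\<^sub>0 (q j)) ?A = g"
          using g by (intro extensionalityI[of _ ?A]) (auto simp: PiE_def)
      qed (use restrict_apply' in metis)
      then show "q \<in> {q. q permutes ?A \<and> (\<forall>j\<in>?A. g\<^sub>0 (q j) = g j)} \<longleftrightarrow>
        q \<in> {q \<in> {q. q permutes ?A}. restrict (\<lambda>j. g\<^sub>0 (q j)) ?A = g}" by blast
    qed
    then show "card {q. q permutes ?A \<and> (\<forall>j\<in>?A. g\<^sub>0 (q j) = g j)}
        = (\<Sum>q\<in>{q \<in> {q. q permutes ?A}. restrict (\<lambda>j. g\<^sub>0 (q j)) ?A = g}. 1)" by simp
  qed simp
  also have "\<dots> = (\<Sum>q\<in>{q. q permutes ?A}. 1)"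
  proof (rule sum.group)
    show "(\<lambda>q. restrict (\<lambda>j. g\<^sub>0 (q j)) ?A) ` {q. q permutes ?A} \<subseteq> ?G"
    proof (intro image_subsetI)
      fix q assume "q \<in> {q. q permutes ?A}"
      then show "restrict (\<lambda>j. g\<^sub>0 (q j)) ?A \<in> ?G"
        using content_permute[of q n g\<^sub>0] g0 content_cong[of n "restrict (\<lambda>j. g\<^sub>0 (q j)) ?A" "\<lambda>j. g\<^sub>0 (q j)"]
        by simp
    qed
  qed (use finG in \<open>simp_all add: finite_permutations\<close>)
  also have "\<dots> = fact n" by (simp add: card_permutations)
  finally show ?thesis .
qed

text \<open>All fibres over the multisets have size n!. Finiteness of the set of multisets is
  supplied later by its bijection with a set of permutations.\<close>

lemma card_even_pairs:
  assumes k: "k > 0" and size: "size M = n" and fin: "finite (rotation_multisets k neg M)"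
  shows "card (even_pairs n k neg M) = fact n * card (rotation_multisets k neg M)"
proof -
  have sub: "(\<lambda>(p, f). content n (word k f p)) ` even_pairs n k neg M \<subseteq> rotation_multisets k neg M"
  proof (intro image_subsetI)
    fix x assume "x \<in> even_pairs n k neg M"
    then obtain p f where x: "x = (p, f)" "p permutes {1..n}" "f \<in> fixed_colourings n M (p ^^ k)"
      "\<forall>j\<in>{1..n}. even_word neg (word k f p j)" by (auto simp: even_pairs_def)
    have "image_mset rotate1 (content n (word k f p)) = content n (\<lambda>j. word k f p (p j))"
      unfolding content_comp[of n rotate1 "word k f p", symmetric]
      by (intro content_cong word_rotate1[symmetric]) (use x(3) in \<open>simp add: fixed_colourings_def\<close>)
    then have 1: "image_mset rotate1 (content n (word k f p)) = content n (word k f p)"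
      using content_permute[OF x(2), of "word k f p"] by simp
    have "image_mset hd (content n (word k f p)) = content n f"
      unfolding content_comp[of n hd "word k f p", symmetric] by (simp add: hd_word[OF k])
    then have 2: "image_mset hd (content n (word k f p)) = M"
      using x(3) by (simp add: fixed_colourings_def)
    show "(\<lambda>(p, f). content n (word k f p)) x \<in> rotation_multisets k neg M"
      unfolding rotation_multisets_def mem_Collect_eq x(1) case_prod_conv set_mset_content
      using 1 2 x(4) by simp
  qed
  have "card (even_pairs n k neg M) = (\<Sum>x\<in>even_pairs n k neg M. 1)" by simp
  also have "\<dots> = (\<Sum>m\<in>rotation_multisets k neg M.
      \<Sum>x\<in>{x \<in> even_pairs n k neg M. (\<lambda>(p, f). content n (word k f p)) x = m}. 1)"
    by (rule sum.group[symmetric]) (use fin finite_even_pairs sub in auto)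
  also have "\<dots> = (\<Sum>m\<in>rotation_multisets k neg M. fact n)"
  proof (rule sum.cong)
    fix m assume "m \<in> rotation_multisets k neg M"
    from card_even_pairs_fibre[OF k this size]
    show "(\<Sum>x\<in>{x \<in> even_pairs n k neg M. (\<lambda>(p, f). content n (word k f p)) x = m}. 1) = fact n"
      by (simp add: case_prod_unfold)
  qed simp
  finally show ?thesis by simp
qed

section \<open>Compatible roots of the identity\<close>

text \<open>Compatibility prescribes all signs through \<open>f\<^sub>0\<close>, so \<open>w\<close>
  is determined by its absolute permutation. The sign of the \<open>k\<close>-th power at
  \<open>j\<close> is then the parity of the number of \<open>neg\<close> letters in the word of
  \<open>j\<close>.\<close>

lemma card_compat_roots:
  "card {w \<in> signed_perms n. w ^^ k = id \<and> compat n f\<^sub>0 neg w} = card (increasing_roots n k f\<^sub>0 neg)"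
proof (rule bij_betw_same_card)
  let ?N = "{j \<in> {1..n}. neg (f\<^sub>0 j)}"
  have N: "?N \<subseteq> {1..n}" by auto
  have pw: "(\<Prod>t<k. if neg (f\<^sub>0 ((p ^^ t) j)) then - 1 else 1 :: int) = 1
      \<longleftrightarrow> even_word neg (word k f\<^sub>0 p j)" for p j
  proof -
    have "(\<Prod>t<k. if neg (f\<^sub>0 ((p ^^ t) j)) then - 1 else 1 :: int)
        = (- 1) ^ length (filter neg (word k f\<^sub>0 p j))"
      unfolding word_def by (induction k) auto
    then show ?thesis by (simp add: even_word_def minus_one_power_iff)
  qed
  have root: "w ^^ k = id \<longleftrightarrow> (\<forall>j\<in>{1..n}. (abs_perm w ^^ k) j = j \<and> even_word neg (word k f\<^sub>0 (abs_perm w) j))"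
    if w: "w \<in> signed_perms n" and s: "\<And>j. j \<in> {1..n} \<Longrightarrow> sign_at w j = (if neg (f\<^sub>0 j) then - 1 else 1)"
    for w
  proof -
    have "sign_at (w ^^ k) j = (\<Prod>t<k. if neg (f\<^sub>0 ((abs_perm w ^^ t) j)) then - 1 else 1)"
      if j: "j \<in> {1..n}" for j
      unfolding sign_at_funpow[OF w]
      by (intro prod.cong refl s funpow_in[OF abs_perm_permutes[OF w] j])
    then show ?thesis
      unfolding signed_perm_eq_id_iff[OF signed_perms_funpow[OF w]] abs_perm_funpow[OF w]
      using pw by simp
  qed
  show "bij_betw abs_perm {w \<in> signed_perms n. w ^^ k = id \<and> compat n f\<^sub>0 neg w} (increasing_roots n k f\<^sub>0 neg)"
  proof (rule bij_betw_byWitness[where f' = "\<lambda>p. make_signed p ?N"])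
    have s: "sign_at w j = (if neg (f\<^sub>0 j) then - 1 else 1)" if "compat n f\<^sub>0 neg w" "j \<in> {1..n}" for w j
      using that by (simp add: compat_def sign_at_def)
    show "\<forall>w\<in>{w \<in> signed_perms n. w ^^ k = id \<and> compat n f\<^sub>0 neg w}. make_signed (abs_perm w) ?N = w"
    proof
      fix w assume "w \<in> {w \<in> signed_perms n. w ^^ k = id \<and> compat n f\<^sub>0 neg w}"
      then have w: "w \<in> signed_perms n" and c: "compat n f\<^sub>0 neg w" by auto
      note p = abs_perm_permutes[OF w]
      show "make_signed (abs_perm w) ?N = w"
        by (rule signed_perms_eqI[OF make_signed_in_signed_perms[OF p N] w])
           (simp_all add: abs_perm_make_signed[OF p] sign_at_make_signed[OF p] s[OF c])
    qed
    show "\<forall>p\<in>increasing_roots n k f\<^sub>0 neg. abs_perm (make_signed p ?N) = p"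
      unfolding increasing_roots_def using abs_perm_make_signed by blast
    show "abs_perm ` {w \<in> signed_perms n. w ^^ k = id \<and> compat n f\<^sub>0 neg w} \<subseteq> increasing_roots n k f\<^sub>0 neg"
    proof (intro image_subsetI)
      fix w assume "w \<in> {w \<in> signed_perms n. w ^^ k = id \<and> compat n f\<^sub>0 neg w}"
      then have w: "w \<in> signed_perms n" "w ^^ k = id" and c: "compat n f\<^sub>0 neg w" by auto
      show "abs_perm w \<in> increasing_roots n k f\<^sub>0 neg"
        unfolding increasing_roots_def mem_Collect_eq
        using abs_perm_permutes[OF w(1)] root[OF w(1) s[OF c]] w(2) c by (simp add: compat_def)
    qed
    show "(\<lambda>p. make_signed p ?N) ` increasing_roots n k f\<^sub>0 neg
        \<subseteq> {w \<in> signed_perms n. w ^^ k = id \<and> compat n f\<^sub>0 neg w}"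
    proof (intro image_subsetI)
      fix p assume p: "p \<in> increasing_roots n k f\<^sub>0 neg"
      then have pp: "p permutes {1..n}" by (simp add: increasing_roots_def)
      note w = make_signed_in_signed_perms[OF pp N]
      have sg: "sign_at (make_signed p ?N) j = (if neg (f\<^sub>0 j) then - 1 else 1)" if "j \<in> {1..n}" for j
        using sign_at_make_signed[OF pp that] that by simp
      have lt: "make_signed p ?N (int j) < 0 \<longleftrightarrow> neg (f\<^sub>0 j)" if "j \<in> {1..n}" for j
        using sg[OF that] unfolding sign_at_def by (simp split: if_splits)
      have "make_signed p ?N ^^ k = id"
        using root[OF w sg] p unfolding abs_perm_make_signed[OF pp] by (simp add: increasing_roots_def)
      moreover have "compat n f\<^sub>0 neg (make_signed p ?N)"
        unfolding compat_def abs_perm_make_signed[OF pp]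
        using lt p unfolding increasing_roots_def by simp
      ultimately show "make_signed p ?N \<in> {w \<in> signed_perms n. w ^^ k = id \<and> compat n f\<^sub>0 neg w}"
        using w by simp
    qed
  qed
qed

text \<open>The factor 2^n comes from the choice of signs for a pair all of whose words are even,
  the factor n! from the pairs over a single multiset of words.\<close>

theorem count_compat_roots:
  fixes f\<^sub>0 :: "nat \<Rightarrow> 'c::linorder"
  assumes k: "k > 0" and f0: "mono_on {1..n} f\<^sub>0"
  shows "(\<Sum>u\<in>signed_perms n. signed_fix n (content n f\<^sub>0) neg (u ^^ k))
       = 2 ^ n * fact n * int (card {w \<in> signed_perms n. w ^^ k = id \<and> compat n f\<^sub>0 neg w})"
proof -
  note bij = bij_betw_increasing_roots[OF k f0, of neg]
  have "finite (increasing_roots n k f\<^sub>0 neg)"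
    by (rule finite_subset[OF _ finite_permutations[of "{1..n}"]]) (auto simp: increasing_roots_def)
  then have fin: "finite (rotation_multisets k neg (content n f\<^sub>0))"
    using bij_betw_finite[OF bij] by simp
  have "card (even_pairs n k neg (content n f\<^sub>0)) = fact n * card (increasing_roots n k f\<^sub>0 neg)"
    using card_even_pairs[OF k size_content fin] bij_betw_same_card[OF bij] by simp
  then show ?thesis by (simp add: sum_signed_fix_power card_compat_roots)
qed

section \<open>Signed cycle types\<close>

definition orbit_sign :: "(int \<Rightarrow> int) \<Rightarrow> nat set \<Rightarrow> int" where
  "orbit_sign w b = (\<Prod>j\<in>b. sign_at w j)"

definition plus_minus :: "nat set \<Rightarrow> int set" where
  "plus_minus b = {i. nat \<bar>i\<bar> \<in> b}"

lemma permutation_abs_perm: "w \<in> signed_perms n \<Longrightarrow> permutation (abs_perm w)"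
  using abs_perm_permutes permutation_permutes by blast

lemma permutation_signed_perm: "w \<in> signed_perms n \<Longrightarrow> permutation w"
  using signed_perms_permutes finite_letters permutation_permutes by blast

lemma orbit_eq_if_mem: "permutation f \<Longrightarrow> y \<in> orbit f x \<Longrightarrow> orbit f y = orbit f x"
  by (rule orbit_cyclic_eq3[OF cyclic_on_orbit'])

lemma orbit_card_funpow:
  assumes "permutation f" and L: "L = card (orbit f x)"
  shows "L > 0" "(f ^^ L) x = x" "inj_on (\<lambda>t. (f ^^ t) x) {..<L}"
    "orbit f x = (\<lambda>t. (f ^^ t) x) ` {..<L}"
proof -
  have x: "x \<in> orbit f x" using permutation_self_in_orbit[OF assms(1)] .
  have inj: "inj_on (\<lambda>t. (f ^^ t) x) {0..<funpow_dist1 f x x}" by (rule inj_on_funpow_dist1[OF x])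
  have eq: "orbit f x = (\<lambda>t. (f ^^ t) x) ` {0..<funpow_dist1 f x x}"
    by (rule orbit_conv_funpow_dist1[OF x])
  have d: "funpow_dist1 f x x = L" unfolding L eq card_image[OF inj] by simp
  show "L > 0" unfolding d[symmetric] by simp
  show "(f ^^ L) x = x" unfolding d[symmetric] by (rule funpow_dist1_prop[OF x])
  show "inj_on (\<lambda>t. (f ^^ t) x) {..<L}" using inj unfolding d atLeast0LessThan .
  show "orbit f x = (\<lambda>t. (f ^^ t) x) ` {..<L}" using eq unfolding d atLeast0LessThan .
qed

lemma nat_abs_signed_perm:
  assumes "w \<in> signed_perms n" shows "nat \<bar>w i\<bar> = abs_perm w (nat \<bar>i\<bar>)"
  using signed_perms_odd[OF assms, of i] by (cases "i \<ge> 0") (auto simp: abs_perm_def)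

lemma nat_abs_funpow:
  assumes "w \<in> signed_perms n" shows "nat \<bar>(w ^^ t) i\<bar> = (abs_perm w ^^ t) (nat \<bar>i\<bar>)"
  using nat_abs_signed_perm[OF signed_perms_funpow[OF assms]] abs_perm_funpow[OF assms] by metis

lemma nat_abs_orbit:
  assumes w: "w \<in> signed_perms n"
  shows "(\<lambda>i. nat \<bar>i\<bar>) ` orbit w i = orbit (abs_perm w) (nat \<bar>i\<bar>)"
  unfolding orbit_altdef using nat_abs_funpow[OF w] by (auto simp: image_iff) metis+

lemma bar_orbit:
  assumes w: "w \<in> signed_perms n" shows "bar (orbit w i) = orbit w (- i)"
proof -
  have "(w ^^ t) (- i) = - (w ^^ t) i" for t
    using signed_perms_odd[OF signed_perms_funpow[OF w]] .
  then show ?thesis by (auto simp: bar_def orbit_altdef image_iff)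
qed

lemma orbit_Un_bar:
  assumes w: "w \<in> signed_perms n"
  shows "orbit w i \<union> bar (orbit w i) = plus_minus (orbit (abs_perm w) (nat \<bar>i\<bar>))"
proof (intro equalityI subsetI)
  fix x assume "x \<in> plus_minus (orbit (abs_perm w) (nat \<bar>i\<bar>))"
  then have "nat \<bar>x\<bar> \<in> (\<lambda>i. nat \<bar>i\<bar>) ` orbit w i"
    unfolding plus_minus_def nat_abs_orbit[OF w] by simp
  then obtain y where "y \<in> orbit w i" "nat \<bar>x\<bar> = nat \<bar>y\<bar>" by blast
  moreover from this(2) have "x = y \<or> x = - y" by auto
  ultimately show "x \<in> orbit w i \<union> bar (orbit w i)" by (auto simp: bar_def)
next
  fix x assume "x \<in> orbit w i \<union> bar (orbit w i)"
  then have "nat \<bar>x\<bar> \<in> (\<lambda>i. nat \<bar>i\<bar>) ` orbit w i" by (auto simp: bar_def)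
  then show "x \<in> plus_minus (orbit (abs_perm w) (nat \<bar>i\<bar>))"
    unfolding plus_minus_def nat_abs_orbit[OF w] by simp
qed

text \<open>One turn around the orbit of the absolute value meets every sign of the orbit exactly
  once.\<close>

lemma signed_funpow_orbit:
  assumes w: "w \<in> signed_perms n" and b: "b = orbit (abs_perm w) (nat \<bar>i\<bar>)"
  shows "(w ^^ card b) i = orbit_sign w b * i"
proof -
  let ?j = "nat \<bar>i\<bar>"
  note o = orbit_card_funpow[OF permutation_abs_perm[OF w] refl, of ?j, folded b]
  have "sign_at (w ^^ card b) ?j = (\<Prod>t<card b. sign_at w ((abs_perm w ^^ t) ?j))"
    by (rule sign_at_funpow[OF w])
  also have "\<dots> = orbit_sign w b"
    unfolding orbit_sign_def by (subst (2) o(4)) (simp add: prod.reindex[OF o(3)])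
  finally have "(w ^^ card b) (int ?j) = orbit_sign w b * int ?j"
    using signed_value[of "w ^^ card b" ?j] o(2) by (simp add: abs_perm_funpow[OF w])
  then show ?thesis
    using signed_perms_odd[OF signed_perms_funpow[OF w], of "card b" "i"]
    by (cases "i \<ge> 0") auto
qed

lemma orbit_sign_cases: "orbit_sign w b = 1 \<or> orbit_sign w b = - 1"
proof (cases "finite b")
  case True
  then show ?thesis unfolding orbit_sign_def
  proof (induction b rule: finite_induct)
    case (insert x b)
    then show ?case using sign_at_cases[of w x] by auto
  qed simp
qed (simp add: orbit_sign_def)

text \<open>If the orbit sign is 1, then \<open>i\<close> itself returns after \<open>card b\<close>
  steps, so \<open>- i\<close> would have to occur earlier; but \<open>card b\<close> is the first
  return time of the absolute value.\<close>

lemma uminus_in_orbit_iff: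
  assumes w: "w \<in> signed_perms n" and i: "i \<noteq> 0" and b: "b = orbit (abs_perm w) (nat \<bar>i\<bar>)"
  shows "- i \<in> orbit w i \<longleftrightarrow> orbit_sign w b = - 1"
proof
  note o = orbit_card_funpow[OF permutation_abs_perm[OF w] refl, of "nat \<bar>i\<bar>", folded b]
  assume "- i \<in> orbit w i"
  then obtain t where t: "(w ^^ t) i = - i" by (auto simp: orbit_altdef)
  show "orbit_sign w b = - 1"
  proof (rule ccontr)
    assume "orbit_sign w b \<noteq> - 1"
    then have "(w ^^ card b) i = i" using orbit_sign_cases[of w b] signed_funpow_orbit[OF w b] by simp
    then have t': "(w ^^ (t mod card b)) i = - i" using funpow_mod_eq t by metis
    then have "(abs_perm w ^^ (t mod card b)) (nat \<bar>i\<bar>) = (abs_perm w ^^ 0) (nat \<bar>i\<bar>)"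
      using nat_abs_funpow[OF w, of "t mod card b" i] by simp
    then have "t mod card b = 0"
      using inj_onD[OF o(3), of "t mod card b" 0] o(1) by simp
    then show False using t' i by simp
  qed
next
  note o = orbit_card_funpow[OF permutation_abs_perm[OF w] refl, of "nat \<bar>i\<bar>", folded b]
  assume "orbit_sign w b = - 1"
  then have "(w ^^ card b) i = - i" using signed_funpow_orbit[OF w b] by simp
  then show "- i \<in> orbit w i" using o(1) by (auto simp: orbit_altdef intro!: exI[of _ "card b"])
qed

text \<open>Orbits are equal or disjoint, and the bar of the orbit of \<open>i\<close> is the orbit
  of \<open>- i\<close>. Hence an orbit of the absolute permutation lifts to a pair of cycles if its
  sign is 1, and to a single self-conjugate cycle if its sign is -1.\<close>

lemma orbit_eq_bar_iff:
  assumes w: "w \<in> signed_perms n" and i: "i \<noteq> 0" and b: "b = orbit (abs_perm w) (nat \<bar>i\<bar>)"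
  shows "orbit w i = bar (orbit w i) \<longleftrightarrow> orbit_sign w b = - 1"
    and "orbit w i \<inter> bar (orbit w i) = {} \<longleftrightarrow> orbit_sign w b = 1"
proof -
  note pw = permutation_signed_perm[OF w]
  have self: "i \<in> orbit w i" "- i \<in> orbit w (- i)" using permutation_self_in_orbit[OF pw] by auto
  have eq: "orbit w i = bar (orbit w i)" if "x \<in> orbit w i" "x \<in> bar (orbit w i)" for x
    using that orbit_eq_if_mem[OF pw] unfolding bar_orbit[OF w] by metis
  show *: "orbit w i = bar (orbit w i) \<longleftrightarrow> orbit_sign w b = - 1"
    unfolding uminus_in_orbit_iff[OF w i b, symmetric]
    using orbit_eq_if_mem[OF pw] self unfolding bar_orbit[OF w] by metis
  have "orbit w i \<inter> bar (orbit w i) = {} \<longleftrightarrow> orbit w i \<noteq> bar (orbit w i)"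
    using eq self by blast
  then show "orbit w i \<inter> bar (orbit w i) = {} \<longleftrightarrow> orbit_sign w b = 1"
    using * orbit_sign_cases[of w b] by auto
qed

lemma nat_abs_plus_minus: "(\<lambda>i. nat \<bar>i\<bar>) ` plus_minus b = b"
proof (intro equalityI subsetI)
  fix j assume "j \<in> b"
  then show "j \<in> (\<lambda>i. nat \<bar>i\<bar>) ` plus_minus b"
    by (intro image_eqI[where x = "int j"]) (auto simp: plus_minus_def)
qed (auto simp: plus_minus_def)

lemma card_plus_minus:
  assumes "finite b" "0 \<notin> b" shows "card (plus_minus b) = 2 * card b"
proof -
  have "plus_minus b = int ` b \<union> (\<lambda>j. - int j) ` b"
  proof (intro equalityI subsetI)
    fix i assume "i \<in> plus_minus b"
    then show "i \<in> int ` b \<union> (\<lambda>j. - int j) ` b"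
      by (cases "i \<ge> 0") (auto simp: plus_minus_def image_iff intro!: bexI[of _ "nat \<bar>i\<bar>"])
  qed (auto simp: plus_minus_def)
  moreover have "x = 0" if "int x = - int y" for x y using that by linarith
  then have "int ` b \<inter> (\<lambda>j. - int j) ` b = {}" using assms(2) by blast
  moreover have "card (int ` b) = card b" "card ((\<lambda>j. - int j) ` b) = card b"
    by (auto intro!: card_image inj_onI)
  ultimately show ?thesis using assms(1) by (simp add: card_Un_disjoint)
qed

section \<open>Cycle types read from the orbits of the absolute permutation\<close>

definition abs_orbits :: "nat \<Rightarrow> (int \<Rightarrow> int) \<Rightarrow> nat set set" where
  "abs_orbits n w = orbit (abs_perm w) ` {1..n}"

lemma finite_abs_orbits: "finite (abs_orbits n w)"
  by (simp add: abs_orbits_def)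

lemma abs_orbits_subset:
  assumes "w \<in> signed_perms n" "b \<in> abs_orbits n w" shows "b \<subseteq> {1..n}" "finite b" "b \<noteq> {}"
proof -
  obtain j where j: "j \<in> {1..n}" "b = orbit (abs_perm w) j" using assms(2) by (auto simp: abs_orbits_def)
  show "b \<subseteq> {1..n}" unfolding j(2) by (rule permutes_orbit_subset[OF abs_perm_permutes[OF assms(1)] j(1)])
  then show "finite b" using finite_subset by blast
  show "b \<noteq> {}" unfolding j(2) by (rule orbit_nonempty)
qed

lemma mem_abs_orbits:
  assumes "w \<in> signed_perms n" "b \<in> abs_orbits n w" "j \<in> b"
  shows "orbit (abs_perm w) j = b"
proof -
  obtain i where "b = orbit (abs_perm w) i" using assms(2) by (auto simp: abs_orbits_def)
  then show ?thesis using orbit_eq_if_mem[OF permutation_abs_perm[OF assms(1)]] assms(3) by metis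
qed

lemma Union_abs_orbits:
  assumes w: "w \<in> signed_perms n" shows "\<Union>(abs_orbits n w) = {1..n}"
proof
  show "\<Union>(abs_orbits n w) \<subseteq> {1..n}" using abs_orbits_subset(1)[OF w] by (rule Union_least)
  show "{1..n} \<subseteq> \<Union>(abs_orbits n w)"
  proof
    fix j assume "j \<in> {1..n}"
    then show "j \<in> \<Union>(abs_orbits n w)"
      unfolding abs_orbits_def
      using permutation_self_in_orbit[OF permutation_abs_perm[OF w], of j] by (rule UN_I)
  qed
qed

lemma abs_orbits_disjoint:
  assumes "w \<in> signed_perms n" "b \<in> abs_orbits n w" "c \<in> abs_orbits n w" "b \<noteq> c"
  shows "b \<inter> c = {}"
proof (rule ccontr)
  assume "b \<inter> c \<noteq> {}"
  then obtain j where "j \<in> b" "j \<in> c" by blast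
  then show False using mem_abs_orbits[OF assms(1)] assms(2-4) by metis
qed

lemma abs_orbits_eq_letters:
  assumes w: "w \<in> signed_perms n"
  shows "abs_orbits n w = (\<lambda>i. orbit (abs_perm w) (nat \<bar>i\<bar>)) ` letters n"
proof -
  have "(\<lambda>i. nat \<bar>i\<bar>) ` letters n = {1..n}"
  proof (intro equalityI subsetI)
    fix j assume j: "j \<in> {1..n}"
    then show "j \<in> (\<lambda>i. nat \<bar>i\<bar>) ` letters n"
      by (intro image_eqI[where x = "int j"]) (simp_all only: int_in_letters nat_int abs_of_nat)
  next
    fix j assume "j \<in> (\<lambda>i. nat \<bar>i\<bar>) ` letters n"
    then show "j \<in> {1..n}" using nat_abs_in_iff by blast
  qed
  then show ?thesis unfolding abs_orbits_def by (metis image_image)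
qed

lemma image_mset_bij_inverse:
  assumes "\<And>x. x \<in> S \<Longrightarrow> h' (h x) = x" "\<And>x. x \<in> S \<Longrightarrow> f x = g (h x)"
  shows "image_mset f (mset_set S) = image_mset g (mset_set (h ` S))"
proof -
  have "inj_on h S" by (rule inj_on_inverseI[where g = h']) (rule assms(1))
  then have "image_mset g (mset_set (h ` S)) = image_mset (\<lambda>x. g (h x)) (mset_set S)"
    by (simp add: image_mset_mset_set[symmetric] multiset.map_comp o_def)
  also have "\<dots> = image_mset f (mset_set S)"
    by (cases "finite S") (auto intro!: image_mset_cong simp: assms(2))
  finally show ?thesis by simp
qed

text \<open>The map from a pair of cycles to its set of absolute values is inverted by collecting
  the \<open>w\<close>-orbits of all letters above \<open>b\<close>. The union of the pair has two
  letters above each element of \<open>b\<close>, which is why half its size is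
  \<open>card b\<close>.\<close>

lemma pos_cycle_type_eq:
  assumes w: "w \<in> signed_perms n"
  shows "pos_cycle_type n w = image_mset card (mset_set {b \<in> abs_orbits n w. orbit_sign w b = 1})"
proof -
  let ?S = "{{c, bar c} | c. c \<in> cycles n w \<and> c \<inter> bar c = {}}"
  let ?h = "\<lambda>P. (\<lambda>i. nat \<bar>i\<bar>) ` \<Union>P"
  let ?b = "\<lambda>i. orbit (abs_perm w) (nat \<bar>i\<bar>)"
  have S: "?S = (\<lambda>i. {orbit w i, bar (orbit w i)}) ` {i \<in> letters n. orbit_sign w (?b i) = 1}"
  proof -
    have "orbit w i \<inter> bar (orbit w i) = {} \<longleftrightarrow> orbit_sign w (?b i) = 1" if "i \<in> letters n" for i
      using that by (intro orbit_eq_bar_iff(2)[OF w]) (auto simp: letters_def)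
    then show ?thesis by (auto simp: cycles_def)
  qed
  have U: "\<Union>{orbit w i, bar (orbit w i)} = plus_minus (?b i)" for i
    using orbit_Un_bar[OF w, of i] by simp
  have h: "?h {orbit w i, bar (orbit w i)} = ?b i" for i
    unfolding U nat_abs_plus_minus ..
  have P: "(\<lambda>b. orbit w ` plus_minus b) (?h {orbit w i, bar (orbit w i)}) = {orbit w i, bar (orbit w i)}" for i
  proof -
    note pw = permutation_signed_perm[OF w]
    have "orbit w ` (orbit w i \<union> bar (orbit w i)) = {orbit w i, bar (orbit w i)}"
    proof (intro equalityI subsetI)
      fix c assume "c \<in> orbit w ` (orbit w i \<union> bar (orbit w i))"
      then show "c \<in> {orbit w i, bar (orbit w i)}"
        using orbit_eq_if_mem[OF pw] unfolding bar_orbit[OF w] by blast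
    next
      fix c assume "c \<in> {orbit w i, bar (orbit w i)}"
      then show "c \<in> orbit w ` (orbit w i \<union> bar (orbit w i))"
        using permutation_self_in_orbit[OF pw] unfolding bar_orbit[OF w] by blast
    qed
    then show ?thesis unfolding h orbit_Un_bar[OF w] .
  qed
  have "pos_cycle_type n w = image_mset card (mset_set (?h ` ?S))"
    unfolding pos_cycle_type_def
  proof (rule image_mset_bij_inverse[where h' = "\<lambda>b. orbit w ` plus_minus b"])
    fix x assume "x \<in> ?S"
    then obtain i where i: "i \<in> letters n" "x = {orbit w i, bar (orbit w i)}" unfolding S by blast
    show "orbit w ` plus_minus (?h x) = x" unfolding i(2) by (rule P)
    have "?b i \<in> abs_orbits n w" unfolding abs_orbits_eq_letters[OF w] using i(1) by blast
    from abs_orbits_subset[OF w this] have "finite (?b i)" "0 \<notin> ?b i" by auto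
    then show "card (\<Union>x) div 2 = card (?h x)"
      unfolding i(2) h U by (simp add: card_plus_minus nat_abs_plus_minus)
  qed
  also have "?h ` ?S = {b \<in> abs_orbits n w. orbit_sign w b = 1}"
    unfolding S image_image h abs_orbits_eq_letters[OF w] by blast
  finally show ?thesis .
qed

text \<open>A negative cycle consists of all letters above its set of absolute values, so
  \<open>plus_minus\<close> is the inverse map.\<close>

lemma neg_cycle_type_eq:
  assumes w: "w \<in> signed_perms n"
  shows "neg_cycle_type n w = image_mset card (mset_set {b \<in> abs_orbits n w. orbit_sign w b = - 1})"
proof -
  let ?S = "{c \<in> cycles n w. c = bar c}"
  let ?h = "\<lambda>c. (\<lambda>i. nat \<bar>i\<bar>) ` c"
  let ?b = "\<lambda>i. orbit (abs_perm w) (nat \<bar>i\<bar>)"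
  have eq: "orbit w i = bar (orbit w i) \<longleftrightarrow> orbit_sign w (?b i) = - 1" if "i \<in> letters n" for i
    using that by (intro orbit_eq_bar_iff(1)[OF w]) (auto simp: letters_def)
  have S: "?S = orbit w ` {i \<in> letters n. orbit_sign w (?b i) = - 1}"
    using eq by (auto simp: cycles_def)
  have h: "?h (orbit w i) = ?b i" for i by (rule nat_abs_orbit[OF w])
  have "neg_cycle_type n w = image_mset card (mset_set (?h ` ?S))"
    unfolding neg_cycle_type_def
  proof (rule image_mset_bij_inverse[where h' = plus_minus])
    fix x assume "x \<in> ?S"
    then obtain i where i: "i \<in> letters n" "x = orbit w i" "orbit_sign w (?b i) = - 1" unfolding S by blast
    have x: "plus_minus (?b i) = x"
      using orbit_Un_bar[OF w, of i] eq[OF i(1)] i(2,3) by simp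
    then show "plus_minus (?h x) = x" unfolding i(2) h by simp
    have "?b i \<in> abs_orbits n w" unfolding abs_orbits_eq_letters[OF w] using i(1) by blast
    from abs_orbits_subset[OF w this] have "finite (?b i)" "0 \<notin> ?b i" by auto
    then have "card (plus_minus (?b i)) div 2 = card (?b i)" by (simp add: card_plus_minus)
    then show "card x div 2 = card (?h x)" unfolding x unfolding i(2) h .
  qed
  also have "?h ` ?S = {b \<in> abs_orbits n w. orbit_sign w b = - 1}"
    unfolding S image_image h abs_orbits_eq_letters[OF w] by blast
  finally show ?thesis .
qed

section \<open>Coefficients of the Frobenius characteristic\<close>

definition monom :: "'a::zero \<Rightarrow> 'v multiset \<Rightarrow> ('v, 'a) mps" where
  "monom c N = Abs_mps (\<lambda>M. if M = N then c else 0)"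

lemma mps_coeff_monom: "mps_coeff (monom c N) M = (if M = N then c else 0)"
  by (simp add: monom_def)

lemma mps_const_eq_monom: "mps_const c = monom c {#}"
  by (simp add: mps_const_def monom_def)

lemma mps_var_eq_monom: "mps_var v = monom 1 {#v#}"
  by (simp add: mps_var_def monom_def)

lemma one_eq_monom: "(1 :: ('v, 'a::comm_ring_1) mps) = monom 1 {#}"
  by (simp add: one_mps_def monom_def)

lemma mps_coeff_mult:
  "mps_coeff (f * g) M = (\<Sum>(A, B) | A + B = M. mps_coeff f A * mps_coeff g B)"
  by (simp add: times_mps_def)

lemma mps_coeff_sum: "mps_coeff (\<Sum>x\<in>S. f x :: ('v, 'a::comm_ring_1) mps) M = (\<Sum>x\<in>S. mps_coeff (f x) M)"
proof (induction S rule: infinite_finite_induct)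
  case (insert x S)
  then show ?case by (simp add: plus_mps_def)
qed (simp_all add: zero_mps_def)

lemma monom_mult:
  fixes c d :: "'a::comm_ring_1"
  shows "monom c N * monom d N' = (monom (c * d) (N + N') :: ('v, 'a) mps)"
proof (rule mps_eqI)
  fix M
  have "mps_coeff (monom c N * monom d N') M
      = (\<Sum>p\<in>{(A, B). A + B = M}. if p = (N, N') then c * d else 0)"
    unfolding mps_coeff_mult by (rule sum.cong) (auto simp: mps_coeff_monom split: if_splits)
  also have "\<dots> = (if N + N' = M then c * d else 0)"
    by (simp add: sum.delta')
  finally show "mps_coeff (monom c N * monom d N') M = mps_coeff (monom (c * d) (N + N')) M"
    by (auto simp: mps_coeff_monom)
qed

lemma mps_coeff_const_mult:
  fixes c :: "'a::comm_ring_1"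
  shows "mps_coeff (mps_const c * f) M = c * mps_coeff f M"
proof -
  have "mps_coeff (mps_const c * f) M
      = (\<Sum>p\<in>{(A, B). A + B = M}. if p = ({#}, M) then c * mps_coeff f M else 0)"
    unfolding mps_coeff_mult by (rule sum.cong) (auto simp: mps_coeff_monom mps_const_eq_monom split: if_splits)
  also have "\<dots> = c * mps_coeff f M"
    by (simp add: sum.delta')
  finally show ?thesis .
qed

lemma monom_power: "monom (1 :: 'a::comm_ring_1) {#v#} ^ l = monom 1 (replicate_mset l v)"
  by (induction l) (simp_all add: one_eq_monom monom_mult)

lemma prod_monom:
  fixes a :: "'i \<Rightarrow> 'a::comm_ring_1"
  assumes "finite S"
  shows "(\<Prod>j\<in>S. monom (a j) {#v j#}) = monom (\<Prod>j\<in>S. a j) (image_mset v (mset_set S))"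
  using assms by (induction S rule: finite_induct) (simp_all add: one_eq_monom monom_mult)

text \<open>The coefficient at \<open>M\<close> sees only coefficients at submultisets of
  \<open>M\<close>. This allows infinite power sums to be replaced by finite ones before a product
  is expanded.\<close>

lemma mps_coeff_mult_cong:
  fixes f f' g g' :: "('v, 'a::comm_ring_1) mps"
  assumes "\<And>B. B \<subseteq># M \<Longrightarrow> mps_coeff f B = mps_coeff f' B"
    and "\<And>B. B \<subseteq># M \<Longrightarrow> mps_coeff g B = mps_coeff g' B"
  shows "mps_coeff (f * g) M = mps_coeff (f' * g') M"
  unfolding mps_coeff_mult
  by (rule sum.cong) (use assms in \<open>auto simp: mset_subset_eq_add_left mset_subset_eq_add_right\<close>)

lemma mps_coeff_prod_cong:
  fixes f g :: "'i \<Rightarrow> ('v, 'a::comm_ring_1) mps"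
  assumes "\<And>x B. x \<in> S \<Longrightarrow> B \<subseteq># M \<Longrightarrow> mps_coeff (f x) B = mps_coeff (g x) B"
  shows "mps_coeff (\<Prod>x\<in>S. f x) M = mps_coeff (\<Prod>x\<in>S. g x) M"
  using assms
proof (induction S arbitrary: M rule: infinite_finite_induct)
  case (insert x S)
  have "mps_coeff (f x * prod f S) M = mps_coeff (g x * prod g S) M"
  proof (rule mps_coeff_mult_cong)
    fix B assume B: "B \<subseteq># M"
    show "mps_coeff (f x) B = mps_coeff (g x) B" using insert.prems B by simp
    show "mps_coeff (prod f S) B = mps_coeff (prod g S) B"
    proof (rule insert.IH)
      fix y C assume "y \<in> S" "C \<subseteq># B"
      then show "mps_coeff (f y) C = mps_coeff (g y) C"
        using insert.prems B subset_mset.trans by blast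
    qed
  qed
  then show ?case using insert.hyps by simp
qed simp_all

section \<open>Products of power sums\<close>

fun is_Y :: "xy_var \<Rightarrow> bool" where
  "is_Y (X i) = False"
| "is_Y (Y i) = True"

definition signed_power_sum :: "int \<Rightarrow> nat \<Rightarrow> (xy_var, complex) mps" where
  "signed_power_sum s l = (if s = 1 then power_sum_pos l else power_sum_neg l)"

lemma signed_power_sum_eq:
  assumes "s = 1 \<or> s = - 1"
  shows "signed_power_sum s l
    = formal_sum (\<lambda>i. monom 1 (replicate_mset l (X i)) + monom (of_int s) (replicate_mset l (Y i))) UNIV"
proof -
  have "monom (- 1) N = - (monom 1 N :: (xy_var, complex) mps)" for N
    by (rule mps_eqI) (simp add: mps_coeff_monom uminus_mps_def)
  then show ?thesis
    using assms by (auto simp: signed_power_sum_def power_sum_pos_def power_sum_neg_def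
        mps_var_eq_monom monom_power)
qed

text \<open>Truncation to a finite set of variables. As \<open>l\<close> is positive, the monomials
  \<open>replicate_mset l v\<close> are distinct for distinct variables, so at most one term of
  either sum contributes.\<close>

lemma mps_coeff_signed_power_sum:
  assumes s: "s = 1 \<or> s = - 1" and l: "l > 0" and V: "finite V" "set_mset B \<subseteq> V"
  shows "mps_coeff (signed_power_sum s l) B
    = mps_coeff (\<Sum>v\<in>V. monom (if is_Y v then of_int s else 1) (replicate_mset l v)) B"
proof -
  let ?c = "\<lambda>i. mps_coeff (monom 1 (replicate_mset l (X i)) + monom (of_int s) (replicate_mset l (Y i))
      :: (xy_var, complex) mps) B"
  have inj: "replicate_mset l u = replicate_mset l v \<longleftrightarrow> u = v" for u v :: xy_var
    using l by (metis gr0_implies_Suc in_replicate_mset)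
  have L: "mps_coeff (signed_power_sum s l) B = (\<Sum>i | ?c i \<noteq> 0. ?c i)"
    unfolding signed_power_sum_eq[OF s] formal_sum_def by simp
  have R: "mps_coeff (\<Sum>v\<in>V. monom (if is_Y v then of_int s else 1) (replicate_mset l v)) B
      = (\<Sum>v\<in>V. if B = replicate_mset l v then (if is_Y v then of_int s else 1) else (0::complex))"
    unfolding mps_coeff_sum mps_coeff_monom ..
  show ?thesis
  proof (cases "\<exists>v. B = replicate_mset l v")
    case True
    then obtain v where B: "B = replicate_mset l v" by blast
    have v: "v \<in> V" using V(2) l B by (auto split: if_splits)
    have R': "(\<Sum>u\<in>V. if B = replicate_mset l u then (if is_Y u then of_int s else 1) else (0::complex))
        = (if is_Y v then of_int s else 1)"
    proof -
      have "(\<Sum>u\<in>V. if B = replicate_mset l u then (if is_Y u then of_int s else 1) else (0::complex))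
        = (\<Sum>u\<in>V. if u = v then (if is_Y v then of_int s else 1) else 0)"
        by (rule sum.cong) (auto simp: B inj)
      then show ?thesis using V(1) v by simp
    qed
    have c: "?c i = (if v = X i then 1 else if v = Y i then of_int s else 0)" for i
      unfolding B by (auto simp: plus_mps_def mps_coeff_monom inj)
    have "(\<Sum>i | ?c i \<noteq> 0. ?c i) = (if is_Y v then of_int s else 1)"
    proof (cases v)
      case (X j)
      then have "{i. ?c i \<noteq> 0} = {j}" unfolding c using s by auto
      then show ?thesis using X by (simp add: c)
    next
      case (Y j)
      then have "{i. ?c i \<noteq> 0} = {j}" unfolding c using s by auto
      then show ?thesis using Y by (simp add: c)
    qed
    then show ?thesis unfolding L R R' .
  next
    case False
    then have "?c i = 0" for i by (simp add: plus_mps_def mps_coeff_monom)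
    moreover have "(\<Sum>v\<in>V. if B = replicate_mset l v then (if is_Y v then of_int s else 1) else (0::complex)) = 0"
      using False by (intro sum.neutral) auto
    ultimately show ?thesis unfolding L R by simp
  qed
qed

lemma fixed_colouring_const_on_orbit:
  assumes w: "w \<in> signed_perms n" and f: "\<And>j. j \<in> {1..n} \<Longrightarrow> f (abs_perm w j) = f j"
    and i: "i \<in> {1..n}" and j: "j \<in> orbit (abs_perm w) i"
  shows "f j = f i"
  using j
proof (induction rule: orbit.induct)
  case base
  then show ?case using f[OF i] .
next
  case (step y)
  then have "y \<in> {1..n}" using permutes_orbit_subset[OF abs_perm_permutes[OF w] i] by blast
  then show ?case using f step by simp
qed

text \<open>Expanding the product assigns a variable to every orbit of the absolute permutation,
  that is, it chooses a colouring fixed by that permutation. An orbit coloured by a y-variable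
  contributes its orbit sign, the product of the signs of \<open>w\<close> along it.\<close>

lemma mps_coeff_prod_power_sums:
  assumes w: "w \<in> signed_perms n"
  shows "mps_coeff (\<Prod>b\<in>abs_orbits n w. signed_power_sum (orbit_sign w b) (card b)) M
       = of_int (signed_fix n M is_Y w)"
proof -
  let ?O = "abs_orbits n w" and ?V = "set_mset M" and ?p = "abs_perm w" and ?A = "{1..n}"
  let ?e = "\<lambda>b v. if is_Y v then of_int (orbit_sign w b) else 1 :: complex"
  let ?m = "\<lambda>f. \<Prod>j\<in>?A. monom (if is_Y (f j) then of_int (sign_at w j) else 1 :: complex) {#f j#}"
  have V: "finite ?V" by simp
  have "mps_coeff (\<Prod>b\<in>?O. signed_power_sum (orbit_sign w b) (card b)) M
      = mps_coeff (\<Prod>b\<in>?O. \<Sum>v\<in>?V. monom (?e b v) (replicate_mset (card b) v)) M"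
  proof (rule mps_coeff_prod_cong)
    fix b B assume b: "b \<in> ?O" and B: "B \<subseteq># M"
    show "mps_coeff (signed_power_sum (orbit_sign w b) (card b)) B
        = mps_coeff (\<Sum>v\<in>?V. monom (?e b v) (replicate_mset (card b) v)) B"
    proof (rule mps_coeff_signed_power_sum[OF orbit_sign_cases _ V])
      show "card b > 0" using abs_orbits_subset[OF w b] by (simp add: card_gt_0_iff)
      show "set_mset B \<subseteq> ?V" using B by (rule set_mset_mono)
    qed
  qed
  also have "\<dots> = (\<Sum>c\<in>?O \<rightarrow>\<^sub>E ?V. mps_coeff (\<Prod>b\<in>?O. monom (?e b (c b)) (replicate_mset (card b) (c b))) M)"
    by (subst prod_sum_PiE) (simp_all add: finite_abs_orbits mps_coeff_sum)
  \<comment> \<open>The representative of an orbit picked by \<open>SOME\<close> is arbitrary; the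
    colourings on the right are constant on orbits.\<close>
  also have "\<dots> = (\<Sum>f | f \<in> ?A \<rightarrow>\<^sub>E ?V \<and> (\<forall>j\<in>?A. f (?p j) = f j). mps_coeff (?m f) M)"
  proof (rule sum.reindex_bij_witness[where
        j = "\<lambda>c. restrict (\<lambda>j. c (orbit ?p j)) ?A" and i = "\<lambda>f. restrict (\<lambda>b. f (SOME j. j \<in> b)) ?O"])
    fix c assume c: "c \<in> ?O \<rightarrow>\<^sub>E ?V"
    let ?f = "restrict (\<lambda>j. c (orbit ?p j)) ?A"
    have some: "(SOME j. j \<in> b) \<in> b" if "b \<in> ?O" for b
      using abs_orbits_subset(3)[OF w that] by (rule some_in_eq[THEN iffD2])
    have fb: "?f j = c b" if "b \<in> ?O" "j \<in> b" for b j
      using mem_abs_orbits[OF w that] abs_orbits_subset(1)[OF w that(1)] that(2) by auto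
    show "restrict (\<lambda>b. ?f (SOME j. j \<in> b)) ?O = c"
      using c fb[OF _ some] by (intro extensionalityI[of _ ?O]) (auto simp: PiE_def)
    show "?f \<in> {f. f \<in> ?A \<rightarrow>\<^sub>E ?V \<and> (\<forall>j\<in>?A. f (?p j) = f j)}"
    proof (intro CollectI conjI ballI)
      show "?f \<in> ?A \<rightarrow>\<^sub>E ?V"
      proof (rule restrict_PiE_iff[THEN iffD2], intro ballI)
        fix j assume "j \<in> ?A"
        then have "orbit ?p j \<in> ?O" unfolding abs_orbits_def by blast
        then show "c (orbit ?p j) \<in> ?V" using c by (rule PiE_mem[rotated])
      qed
      fix j assume j: "j \<in> ?A"
      have "orbit ?p (?p j) = orbit ?p j"
        by (rule orbit_eq_if_mem[OF permutation_abs_perm[OF w] orbit.base])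
      moreover have "?p j \<in> ?A" using permutes_in_image[OF abs_perm_permutes[OF w]] j by blast
      ultimately show "?f (?p j) = ?f j" using j by simp
    qed
    have "?m ?f = (\<Prod>b\<in>?O. \<Prod>j\<in>b. monom (if is_Y (?f j) then of_int (sign_at w j) else 1 :: complex) {#?f j#})"
      unfolding Union_abs_orbits[OF w, symmetric]
      using abs_orbits_subset(2)[OF w] abs_orbits_disjoint[OF w]
      by (subst prod.Union_disjoint) (auto simp: o_def)
    also have "\<dots> = (\<Prod>b\<in>?O. monom (?e b (c b)) (replicate_mset (card b) (c b)))"
    proof (rule prod.cong)
      fix b assume b: "b \<in> ?O"
      have "(\<Prod>j\<in>b. monom (if is_Y (?f j) then of_int (sign_at w j) else 1 :: complex) {#?f j#})
          = (\<Prod>j\<in>b. monom (if is_Y (c b) then of_int (sign_at w j) else 1) {#c b#})"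
        by (rule prod.cong) (simp_all only: fb[OF b])
      also have "\<dots> = monom (\<Prod>j\<in>b. if is_Y (c b) then of_int (sign_at w j) else 1) (image_mset (\<lambda>_. c b) (mset_set b))"
        by (rule prod_monom[OF abs_orbits_subset(2)[OF w b]])
      also have "\<dots> = monom (?e b (c b)) (replicate_mset (card b) (c b))"
        by (simp add: orbit_sign_def image_mset_const_eq)
      finally show "(\<Prod>j\<in>b. monom (if is_Y (?f j) then of_int (sign_at w j) else 1 :: complex) {#?f j#})
          = monom (?e b (c b)) (replicate_mset (card b) (c b))" .
    qed simp
    finally show "mps_coeff (?m ?f) M = mps_coeff (\<Prod>b\<in>?O. monom (?e b (c b)) (replicate_mset (card b) (c b))) M"
      by simp
  next
    fix f assume f: "f \<in> {f. f \<in> ?A \<rightarrow>\<^sub>E ?V \<and> (\<forall>j\<in>?A. f (?p j) = f j)}"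
    let ?c = "restrict (\<lambda>b. f (SOME j. j \<in> b)) ?O"
    have fA: "f \<in> ?A \<rightarrow>\<^sub>E ?V" and fp: "\<And>j. j \<in> ?A \<Longrightarrow> f (?p j) = f j" using f by blast+
    have some: "(SOME j. j \<in> b) \<in> b" if "b \<in> ?O" for b
      using abs_orbits_subset(3)[OF w that] by (rule some_in_eq[THEN iffD2])
    show "?c \<in> ?O \<rightarrow>\<^sub>E ?V"
    proof (rule restrict_PiE_iff[THEN iffD2], intro ballI)
      fix b assume b: "b \<in> ?O"
      have "(SOME j. j \<in> b) \<in> ?A" using some[OF b] abs_orbits_subset(1)[OF w b] by blast
      then show "f (SOME j. j \<in> b) \<in> ?V" using fA by (rule PiE_mem[rotated])
    qed
    show "restrict (\<lambda>j. ?c (orbit ?p j)) ?A = f"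
    proof (rule extensionalityI[of _ ?A])
      show "f \<in> extensional ?A" using fA by (simp add: PiE_def)
      fix j assume j: "j \<in> ?A"
      have o: "orbit ?p j \<in> ?O" unfolding abs_orbits_def using j by blast
      have "f (SOME i. i \<in> orbit ?p j) = f j"
        by (rule fixed_colouring_const_on_orbit[where f = f, OF w _ j some[OF o]]) (rule fp)
      then show "restrict (\<lambda>j. ?c (orbit ?p j)) ?A j = f j" using j o by simp
    qed simp
  qed
  also have "\<dots> = (\<Sum>f | f \<in> ?A \<rightarrow>\<^sub>E ?V \<and> (\<forall>j\<in>?A. f (?p j) = f j).
      if content n f = M then of_int (\<Prod>j\<in>?A. if is_Y (f j) then sign_at w j else 1) else 0)"
  proof (rule sum.cong)
    fix f
    have "?m f = monom (\<Prod>j\<in>?A. if is_Y (f j) then of_int (sign_at w j) else 1) (content n f)"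
      unfolding content_def by (rule prod_monom) simp
    moreover have "(\<Prod>j\<in>?A. if is_Y (f j) then of_int (sign_at w j) else 1 :: complex)
        = of_int (\<Prod>j\<in>?A. if is_Y (f j) then sign_at w j else 1)"
      unfolding of_int_prod by (rule prod.cong) simp_all
    ultimately show "mps_coeff (?m f) M = (if content n f = M
        then of_int (\<Prod>j\<in>?A. if is_Y (f j) then sign_at w j else 1) else 0)"
      by (simp only: mps_coeff_monom eq_commute[of M])
  qed simp
  \<comment> \<open>A colouring of content \<open>M\<close> takes its values in the support of
    \<open>M\<close>, so the truncated set of variables contains all colourings that count.\<close>
  also have "\<dots> = (\<Sum>f\<in>fixed_colourings n M ?p. of_int (\<Prod>j\<in>?A. if is_Y (f j) then sign_at w j else 1))"
  proof (rule sum.mono_neutral_cong_right)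
    show "finite {f. f \<in> ?A \<rightarrow>\<^sub>E ?V \<and> (\<forall>j\<in>?A. f (?p j) = f j)}"
      by (rule finite_subset[of _ "?A \<rightarrow>\<^sub>E ?V"]) (auto intro: finite_PiE)
    show "fixed_colourings n M ?p \<subseteq> {f. f \<in> ?A \<rightarrow>\<^sub>E ?V \<and> (\<forall>j\<in>?A. f (?p j) = f j)}"
      by (auto simp: fixed_colourings_def PiE_def Pi_def set_mset_content)
  qed (auto simp: fixed_colourings_def PiE_def)
  also have "\<dots> = of_int (signed_fix n M is_Y w)" by (simp only: signed_fix_def of_int_sum)
  finally show ?thesis .
qed

lemma prod_cycle_types:
  assumes w: "w \<in> signed_perms n"
  shows "(\<Prod>j\<in>#pos_cycle_type n w. power_sum_pos j) * (\<Prod>j\<in>#neg_cycle_type n w. power_sum_neg j)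
       = (\<Prod>b\<in>abs_orbits n w. signed_power_sum (orbit_sign w b) (card b))"
proof -
  let ?P = "{b \<in> abs_orbits n w. orbit_sign w b = 1}"
  let ?N = "{b \<in> abs_orbits n w. orbit_sign w b = - 1}"
  have "(\<Prod>j\<in>#pos_cycle_type n w. power_sum_pos j) = (\<Prod>b\<in>?P. signed_power_sum (orbit_sign w b) (card b))"
    unfolding pos_cycle_type_eq[OF w]
    by (simp add: multiset.map_comp o_def signed_power_sum_def flip: prod_unfold_prod_mset)
  moreover have "(\<Prod>j\<in>#neg_cycle_type n w. power_sum_neg j) = (\<Prod>b\<in>?N. signed_power_sum (orbit_sign w b) (card b))"
    unfolding neg_cycle_type_eq[OF w]
    by (simp add: multiset.map_comp o_def signed_power_sum_def flip: prod_unfold_prod_mset)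
  moreover have "abs_orbits n w = ?P \<union> ?N" using orbit_sign_cases by auto
  then have "(\<Prod>b\<in>abs_orbits n w. signed_power_sum (orbit_sign w b) (card b))
      = (\<Prod>b\<in>?P \<union> ?N. signed_power_sum (orbit_sign w b) (card b))" by simp
  moreover have "\<dots> = (\<Prod>b\<in>?P. signed_power_sum (orbit_sign w b) (card b))
      * (\<Prod>b\<in>?N. signed_power_sum (orbit_sign w b) (card b))"
    by (rule prod.union_disjoint) (auto simp: finite_abs_orbits)
  ultimately show ?thesis by simp
qed

text \<open>As \<open>signed_fix\<close> is a real induced character and the group has 2^n n!
  elements, the coefficient is the scalar product of \<open>\<chi>\<close> with that
  character.\<close>

lemma mps_coeff_ch:
  "mps_coeff (ch n \<chi>) M
     = (\<Sum>w\<in>signed_perms n. \<chi> w * of_int (signed_fix n M is_Y w)) / (2 ^ n * fact n)"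
proof -
  have "mps_coeff (mps_const (\<chi> w) * (\<Prod>j\<in>#pos_cycle_type n w. power_sum_pos j)
      * (\<Prod>j\<in>#neg_cycle_type n w. power_sum_neg j)) M = \<chi> w * of_int (signed_fix n M is_Y w)"
    if "w \<in> signed_perms n" for w
    unfolding mult.assoc prod_cycle_types[OF that] mps_coeff_const_mult mps_coeff_prod_power_sums[OF that] ..
  then show ?thesis
    unfolding ch_def mps_coeff_const_mult mps_coeff_sum by simp
qed

lemma sum_root_count:
  "(\<Sum>w\<in>signed_perms n. root_count n k w * g w) = (\<Sum>u\<in>signed_perms n. g (u ^^ k))"
proof -
  have "(\<Sum>w\<in>signed_perms n. root_count n k w * g w)
      = (\<Sum>w\<in>signed_perms n. \<Sum>u\<in>{u \<in> signed_perms n. u ^^ k = w}. g (u ^^ k))"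
    by (rule sum.cong) (simp_all add: root_count_def)
  also have "\<dots> = (\<Sum>u\<in>signed_perms n. g (u ^^ k))"
    by (rule sum.group) (auto simp: finite_signed_perms signed_perms_funpow)
  finally show ?thesis .
qed

section \<open>Coefficients of the quasisymmetric functions\<close>

definition descent :: "(int \<Rightarrow> int) \<Rightarrow> nat \<Rightarrow> bool" where
  "descent w j \<longleftrightarrow> w (int (j + 1)) <\<^sub>r w (int j)"

definition sign_of :: "(int \<Rightarrow> int) \<Rightarrow> nat \<Rightarrow> sign" where
  "sign_of w j = (if w (int j) < 0 then Minus else Plus)"

lemma sDes_eq: "sDes n w = (fst (sDes n w), restrict (sign_of w) (fst (sDes n w)))"
  by (simp add: sDes_def Let_def sign_of_def[abs_def])

lemma fst_sDes:
  "fst (sDes n w) = insert n {j \<in> {1..<n}. descent w j \<or> w (int j) < 0 \<and> 0 < w (int (j + 1))}"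
  by (simp add: sDes_def Let_def descent_def)

lemma signed_perm_int_neq_0:
  "w \<in> signed_perms n \<Longrightarrow> j \<ge> 1 \<Longrightarrow> w (int j) \<noteq> 0"
  using signed_perms_eq_0_iff[of w n "int j"] by simp

lemma signed_perm_abs_neq:
  assumes w: "w \<in> signed_perms n" and "i \<noteq> j"
  shows "abs_perm w i \<noteq> abs_perm w j"
  using permutes_inj[OF abs_perm_permutes[OF w]] assms(2) by (metis injD)

text \<open>Every change of sign is recorded: from barred to unbarred by the second clause of
  \<open>sDes\<close>, from unbarred to barred because that is a descent.\<close>

lemma sign_of_Suc_if_not_sDes:
  assumes w: "w \<in> signed_perms n" and j: "j \<in> {1..<n}" "j \<notin> fst (sDes n w)"
  shows "sign_of w j = sign_of w (Suc j)"
  using j signed_perm_int_neq_0[OF w, of j] signed_perm_int_neq_0[OF w, of "Suc j"]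
  by (auto simp: fst_sDes sign_of_def descent_def less_r_def)

lemma sign_of_const_if_not_sDes:
  assumes w: "w \<in> signed_perms n" and "1 \<le> i" "i \<le> t" "t \<le> n"
    and "\<And>s. i \<le> s \<Longrightarrow> s < t \<Longrightarrow> s \<notin> fst (sDes n w)"
  shows "sign_of w i = sign_of w t"
  using assms(3,4,5)
proof (induction t rule: dec_induct)
  case (step t)
  have "sign_of w t = sign_of w (Suc t)"
    by (rule sign_of_Suc_if_not_sDes[OF w]) (use step assms(2) in auto)
  moreover have "sign_of w i = sign_of w t" using step by simp
  ultimately show ?case by simp
qed simp

lemma sign_vector_sDes:
  assumes w: "w \<in> signed_perms n" and j: "j \<in> {1..n}"
  shows "sign_vector (sDes n w) j = sign_of w j"
proof -
  define t where "t = (LEAST s. s \<in> fst (sDes n w) \<and> j \<le> s)"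
  have ex: "n \<in> fst (sDes n w) \<and> j \<le> n" using j by (simp add: fst_sDes)
  have t: "t \<in> fst (sDes n w) \<and> j \<le> t"
    unfolding t_def by (rule LeastI[where P = "\<lambda>s. s \<in> fst (sDes n w) \<and> j \<le> s", OF ex])
  have tn: "t \<le> n"
    unfolding t_def by (rule Least_le[where P = "\<lambda>s. s \<in> fst (sDes n w) \<and> j \<le> s", OF ex])
  have "sign_of w j = sign_of w t"
    by (rule sign_of_const_if_not_sDes[OF w]) (use j t tn in \<open>auto simp: t_def dest: not_less_Least\<close>)
  moreover have "sign_vector (sDes n w) j = restrict (sign_of w) (fst (sDes n w)) t"
    unfolding t_def by (subst sDes_eq) simp
  ultimately show ?thesis using t by simp
qed

text \<open>What \<open>wDes\<close> removes are the changes from barred to unbarred, which are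
  ascents for the order used. An element of the descent set with equal signs, or with a change from
  unbarred to barred, is a descent.\<close>

lemma wDes_sDes:
  assumes w: "w \<in> signed_perms n"
  shows "wDes n (sDes n w) = {j \<in> {1..<n}. descent w j}"
proof (intro set_eqI)
  fix s
  define t where "t = (LEAST t. t \<in> fst (sDes n w) \<and> s < t)"
  let ?e = "restrict (sign_of w) (fst (sDes n w))"
  have wd: "s \<in> wDes n (sDes n w) \<longleftrightarrow> s \<in> fst (sDes n w) \<and> s \<noteq> n \<and>
      (?e s = ?e t \<or> ?e s = Plus \<and> ?e t = Minus)"
    unfolding t_def by (subst sDes_eq) (simp add: Let_def)
  show "s \<in> wDes n (sDes n w) \<longleftrightarrow> s \<in> {j \<in> {1..<n}. descent w j}"
  proof (cases "s \<in> fst (sDes n w) \<and> s \<noteq> n")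
    case True
    then have s: "s \<in> {1..<n}" by (auto simp: fst_sDes)
    have ex: "n \<in> fst (sDes n w) \<and> s < n" using s by (simp add: fst_sDes)
    have t: "t \<in> fst (sDes n w) \<and> s < t"
      unfolding t_def by (rule LeastI[where P = "\<lambda>t. t \<in> fst (sDes n w) \<and> s < t", OF ex])
    have tn: "t \<le> n"
      unfolding t_def by (rule Least_le[where P = "\<lambda>t. t \<in> fst (sDes n w) \<and> s < t", OF ex])
    \<comment> \<open>No sign changes strictly between two consecutive elements of the descent set,
      so the sign at the next element is already the sign at \<open>Suc s\<close>.\<close>
    have "sign_of w (Suc s) = sign_of w t"
      by (rule sign_of_const_if_not_sDes[OF w])
         (use s t tn in \<open>auto simp: t_def Suc_le_eq dest: not_less_Least\<close>)
    then have "s \<in> wDes n (sDes n w) \<longleftrightarrow>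
        sign_of w s = sign_of w (Suc s) \<or> sign_of w s = Plus \<and> sign_of w (Suc s) = Minus"
      using wd True t by simp
    moreover have "descent w s \<or> w (int s) < 0 \<and> 0 < w (int (s + 1))"
      using True by (auto simp: fst_sDes)
    ultimately show ?thesis
      using s signed_perm_int_neq_0[OF w, of s] signed_perm_int_neq_0[OF w, of "Suc s"]
      by (auto simp: sign_of_def descent_def less_r_def)
  next
    case False
    then show ?thesis using wd by (auto simp: fst_sDes)
  qed
qed

text \<open>The order of the letters compares two barred letters by absolute value, just like two
  unbarred ones.\<close>

lemma descent_iff_abs:
  assumes w: "w \<in> signed_perms n" and j: "j \<ge> 1"
    and same: "w (int j) < 0 \<longleftrightarrow> w (int (Suc j)) < 0"
  shows "\<not> descent w j \<longleftrightarrow> abs_perm w j < abs_perm w (Suc j)"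
proof -
  have "abs_perm w j \<noteq> abs_perm w (Suc j)" using signed_perm_abs_neq[OF w] by simp
  then show ?thesis
    using same signed_perm_int_neq_0[OF w j] signed_perm_int_neq_0[OF w, of "Suc j"]
    by (auto simp: descent_def less_r_def abs_perm_def)
qed

text \<open>The fibres of a weakly increasing colouring are intervals and carry a constant sign, so
  increase along a fibre can be tested on neighbours, where it is the absence of a descent.\<close>

lemma compat_iff_descents:
  fixes f\<^sub>0 :: "nat \<Rightarrow> 'c::linorder"
  assumes w: "w \<in> signed_perms n" and f0: "mono_on {1..n} f\<^sub>0"
  shows "compat n f\<^sub>0 neg w \<longleftrightarrow>
     (\<forall>j\<in>{1..n}. w (int j) < 0 \<longleftrightarrow> neg (f\<^sub>0 j)) \<and>
     (\<forall>j\<in>{1..<n}. f\<^sub>0 j = f\<^sub>0 (Suc j) \<longrightarrow> \<not> descent w j)" (is "_ \<longleftrightarrow> ?sg \<and> ?d")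
proof (cases ?sg)
  case True
  have des: "\<not> descent w j \<longleftrightarrow> abs_perm w j < abs_perm w (Suc j)"
    if "j \<in> {1..<n}" "f\<^sub>0 j = f\<^sub>0 (Suc j)" for j
  proof (rule descent_iff_abs[OF w])
    have "j \<in> {1..n}" "Suc j \<in> {1..n}" using that(1) by auto
    then show "w (int j) < 0 \<longleftrightarrow> w (int (Suc j)) < 0" using True that(2) by metis
  qed (use that in simp)
  have "(\<forall>i\<in>{1..n}. \<forall>j\<in>{1..n}. i < j \<and> f\<^sub>0 i = f\<^sub>0 j \<longrightarrow> abs_perm w i < abs_perm w j) \<longleftrightarrow> ?d"
  proof
    assume *: "\<forall>i\<in>{1..n}. \<forall>j\<in>{1..n}. i < j \<and> f\<^sub>0 i = f\<^sub>0 j \<longrightarrow> abs_perm w i < abs_perm w j"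
    show ?d
    proof (intro ballI impI)
      fix j assume j: "j \<in> {1..<n}" "f\<^sub>0 j = f\<^sub>0 (Suc j)"
      then have "j \<in> {1..n}" "Suc j \<in> {1..n}" by auto
      with * j(2) have "abs_perm w j < abs_perm w (Suc j)" by blast
      then show "\<not> descent w j" using des[OF j] by blast
    qed
  next
    assume d: ?d
    have "abs_perm w i < abs_perm w j"
      if "i < j" "1 \<le> i" "j \<le> n" "f\<^sub>0 i = f\<^sub>0 j" for i j
      using that
    proof (induction j)
      case (Suc j)
      have "f\<^sub>0 i \<le> f\<^sub>0 j" "f\<^sub>0 j \<le> f\<^sub>0 (Suc j)"
        using Suc.prems mono_onD[OF f0, of i j] mono_onD[OF f0, of j "Suc j"] by auto
      then have eq: "f\<^sub>0 i = f\<^sub>0 j" "f\<^sub>0 j = f\<^sub>0 (Suc j)" using Suc.prems by auto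
      have j: "j \<in> {1..<n}" using Suc.prems by auto
      have step: "abs_perm w j < abs_perm w (Suc j)" using des[OF j eq(2)] d j eq(2) by blast
      show ?case
      proof (cases "i = j")
        case False
        then have "abs_perm w i < abs_perm w j" using Suc.IH Suc.prems eq(1) by simp
        then show ?thesis using step by simp
      qed (use step in simp)
    qed simp
    then show "\<forall>i\<in>{1..n}. \<forall>j\<in>{1..n}. i < j \<and> f\<^sub>0 i = f\<^sub>0 j \<longrightarrow> abs_perm w i < abs_perm w j"
      by simp
  qed
  then show ?thesis unfolding compat_def using True by blast
qed (auto simp: compat_def)

section \<open>Variables coded by natural numbers\<close>

text \<open>The code turns the required order of the variables into the order of the natural
  numbers; half the code is the index, and even codes are the y-variables.\<close>

fun var_code :: "xy_var \<Rightarrow> nat" where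
  "var_code (Y i) = 2 * i"
| "var_code (X i) = 2 * i + 1"

definition var_decode :: "nat \<Rightarrow> xy_var" where
  "var_decode m = (if even m then Y (m div 2) else X (m div 2))"

lemma var_decode_code [simp]: "var_decode (var_code v) = v"
  by (cases v) (simp_all add: var_decode_def)

lemma var_code_decode [simp]: "var_code (var_decode m) = m"
  by (simp add: var_decode_def)

lemma even_var_code: "even (var_code v) \<longleftrightarrow> is_Y v"
  by (cases v) simp_all

lemma image_mset_var_code_eq_iff: "image_mset var_code M = image_mset var_code N \<longleftrightarrow> M = N"
proof
  assume "image_mset var_code M = image_mset var_code N"
  then have "image_mset var_decode (image_mset var_code M) = image_mset var_decode (image_mset var_code N)"
    by simp
  then show "M = N" by (simp add: multiset.map_comp o_def)
qed simp

lemma signed_fix_var_code: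
  assumes w: "w \<in> signed_perms n"
  shows "signed_fix n (image_mset var_code M) even w = signed_fix n M is_Y w"
proof -
  have pA: "abs_perm w j \<in> {1..n}" if "j \<in> {1..n}" for j
    using permutes_in_image[OF abs_perm_permutes[OF w]] that by blast
  show ?thesis
    unfolding signed_fix_def
  proof (rule sum.reindex_bij_witness[where j = "\<lambda>f. restrict (\<lambda>j. var_decode (f j)) {1..n}"
        and i = "\<lambda>f. restrict (\<lambda>j. var_code (f j)) {1..n}"])
    fix f assume f: "f \<in> fixed_colourings n (image_mset var_code M) (abs_perm w)"
    let ?g = "restrict (\<lambda>j. var_decode (f j)) {1..n}"
    show "restrict (\<lambda>j. var_code (?g j)) {1..n} = f"
      using f by (intro extensionalityI[of _ "{1..n}"]) (auto simp: fixed_colourings_def PiE_def)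
    have "content n ?g = content n (\<lambda>j. var_decode (f j))" by (rule content_cong) simp
    also have "\<dots> = image_mset var_decode (content n f)" by (rule content_comp)
    also have "\<dots> = M" using f by (simp add: fixed_colourings_def multiset.map_comp o_def)
    finally show "?g \<in> fixed_colourings n M (abs_perm w)"
      using f pA unfolding fixed_colourings_def by simp
    show "(\<Prod>j\<in>{1..n}. if is_Y (?g j) then sign_at w j else 1)
        = (\<Prod>j\<in>{1..n}. if even (f j) then sign_at w j else 1)"
      by (rule prod.cong) (simp_all add: even_var_code[symmetric])
  next
    fix f assume f: "f \<in> fixed_colourings n M (abs_perm w)"
    let ?g = "restrict (\<lambda>j. var_code (f j)) {1..n}"
    show "restrict (\<lambda>j. var_decode (?g j)) {1..n} = f"
      using f by (intro extensionalityI[of _ "{1..n}"]) (auto simp: fixed_colourings_def PiE_def)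
    have "content n ?g = content n (\<lambda>j. var_code (f j))" by (rule content_cong) simp
    also have "\<dots> = image_mset var_code (content n f)" by (rule content_comp)
    also have "\<dots> = image_mset var_code M" using f by (simp add: fixed_colourings_def)
    finally show "?g \<in> fixed_colourings n (image_mset var_code M) (abs_perm w)"
      using f pA unfolding fixed_colourings_def by simp
  qed
qed

definition F_var :: "(nat \<Rightarrow> sign) \<Rightarrow> (nat \<Rightarrow> nat) \<Rightarrow> nat \<Rightarrow> xy_var" where
  "F_var e i j = (case e j of Plus \<Rightarrow> X (i j) | Minus \<Rightarrow> Y (i j))"

definition F_indices :: "nat \<Rightarrow> (int \<Rightarrow> int) \<Rightarrow> xy_var multiset \<Rightarrow> (nat \<Rightarrow> nat) set" where
  "F_indices n w M = {i \<in> {1..n} \<rightarrow>\<^sub>E UNIV. (\<forall>j\<in>{1..<n}. i j \<le> i (Suc j)) \<and>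
     (\<forall>j\<in>{1..<n}. descent w j \<longrightarrow> i j < i (Suc j)) \<and> content n (F_var (sign_of w) i) = M}"

lemma mps_coeff_F:
  assumes w: "w \<in> signed_perms n"
  shows "mps_coeff (F n (sDes n w)) M = of_nat (card (F_indices n w M))"
proof -
  let ?I = "{i \<in> {1..n} \<rightarrow>\<^sub>E UNIV. (\<forall>j\<in>{1..<n}. i j \<le> i (j + 1)) \<and> (\<forall>j\<in>wDes n (sDes n w). i j < i (j + 1))}"
  let ?m = "\<lambda>i. \<Prod>j\<in>{1..n}. mps_var (case sign_vector (sDes n w) j of Plus \<Rightarrow> X (i j) | Minus \<Rightarrow> Y (i j))
      :: (xy_var, complex) mps"
  have m: "mps_coeff (?m i) M = (if content n (F_var (sign_of w) i) = M then 1 else 0)" for i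
  proof -
    have "?m i = (\<Prod>j\<in>{1..n}. monom 1 {#F_var (sign_of w) i j#})"
      by (rule prod.cong) (simp_all only: sign_vector_sDes[OF w] mps_var_eq_monom F_var_def)
    also have "\<dots> = monom 1 (content n (F_var (sign_of w) i))"
      by (subst prod_monom) (simp_all add: content_def)
    finally show ?thesis by (simp only: mps_coeff_monom eq_commute[of M])
  qed
  have "mps_coeff (F n (sDes n w)) M = (\<Sum>i | i \<in> ?I \<and> mps_coeff (?m i) M \<noteq> 0. mps_coeff (?m i) M)"
    unfolding F_def formal_sum_def mps_coeff_Abs ..
  also have "{i. i \<in> ?I \<and> mps_coeff (?m i) M \<noteq> 0} = F_indices n w M"
    unfolding m wDes_sDes[OF w] F_indices_def by auto
  also have "(\<Sum>i\<in>F_indices n w M. mps_coeff (?m i) M) = (\<Sum>i\<in>F_indices n w M. 1)"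
    unfolding m by (rule sum.cong) (auto simp: F_indices_def)
  finally show ?thesis by simp
qed

lemma mono_on_Suc:
  fixes f :: "nat \<Rightarrow> 'a::linorder"
  assumes "\<And>j. j \<in> {1..<n} \<Longrightarrow> f j \<le> f (Suc j)"
  shows "mono_on {1..n} f"
proof (rule mono_onI)
  fix i j assume "i \<in> {1..n}" "j \<in> {1..n}" "i \<le> j"
  from this(3,1,2) show "f i \<le> f j"
  proof (induction j rule: dec_induct)
    case (step j)
    then have "f j \<le> f (Suc j)" by (intro assms) auto
    then show ?case using step by simp
  qed simp
qed

text \<open>Along an admissible index sequence the codes of the variables increase weakly and list
  \<open>M\<close>, so they coincide with \<open>f\<^sub>0\<close>. Hence there is at most one such
  sequence, obtained by halving.\<close>

lemma F_indices_eq: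
  assumes w: "w \<in> signed_perms n" and f0: "mono_on {1..n} f\<^sub>0"
    and M: "content n f\<^sub>0 = image_mset var_code M"
  shows "F_indices n w M = (if compat n f\<^sub>0 even w then {restrict (\<lambda>j. f\<^sub>0 j div 2) {1..n}} else {})"
proof -
  have code: "var_code (F_var (sign_of w) i j) = 2 * i j + (if w (int j) < 0 then 0 else 1)" for i j
    by (simp add: F_var_def sign_of_def)
  have sub: "compat n f\<^sub>0 even w \<and> i = restrict (\<lambda>j. f\<^sub>0 j div 2) {1..n}" if i: "i \<in> F_indices n w M" for i
  proof -
    let ?g = "\<lambda>j. var_code (F_var (sign_of w) i j)"
    have mono: "mono_on {1..n} ?g"
    proof (rule mono_on_Suc)
      fix j assume j: "j \<in> {1..<n}"
      have le: "i j \<le> i (Suc j)" and lt: "descent w j \<Longrightarrow> i j < i (Suc j)"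
        using i j by (auto simp: F_indices_def)
      show "?g j \<le> ?g (Suc j)"
      proof (cases "w (int j) < 0 \<or> w (int (Suc j)) \<ge> 0")
        case True
        then show ?thesis unfolding code using le by auto
      next
        case False
        \<comment> \<open>An unbarred letter followed by a barred one is a descent, and the strict
          increase of the index outweighs the loss of 1 in the code.\<close>
        then have "descent w j"
          using signed_perm_int_neq_0[OF w, of j] j by (auto simp: descent_def less_r_def)
        then show ?thesis unfolding code using lt by simp
      qed
    qed
    have "content n ?g = content n f\<^sub>0"
      using content_comp[of n var_code "F_var (sign_of w) i"] i M by (simp add: F_indices_def)
    then have g: "?g j = f\<^sub>0 j" if "j \<in> {1..n}" for j
      using mono_on_image_mset_unique[OF mono f0 _ that] by (simp add: content_def)
    have div: "i j = f\<^sub>0 j div 2" and ev: "w (int j) < 0 \<longleftrightarrow> even (f\<^sub>0 j)" if "j \<in> {1..n}" for j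
      using g[OF that, symmetric] unfolding code by auto
    have "\<not> descent w j" if j: "j \<in> {1..<n}" "f\<^sub>0 j = f\<^sub>0 (Suc j)" for j
    proof -
      have "j \<in> {1..n}" "Suc j \<in> {1..n}" using j(1) by auto
      from div[OF this(1)] div[OF this(2)] j(2) have "i j = i (Suc j)" by simp
      then show ?thesis using i j(1) by (auto simp: F_indices_def)
    qed
    then have "compat n f\<^sub>0 even w" unfolding compat_iff_descents[OF w f0] using ev by blast
    moreover have "i = restrict (\<lambda>j. f\<^sub>0 j div 2) {1..n}"
      using i div by (intro extensionalityI[of _ "{1..n}"]) (auto simp: F_indices_def PiE_def)
    ultimately show ?thesis by blast
  qed
  have mem: "restrict (\<lambda>j. f\<^sub>0 j div 2) {1..n} \<in> F_indices n w M" if c: "compat n f\<^sub>0 even w"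
  proof -
    let ?i = "restrict (\<lambda>j. f\<^sub>0 j div 2) {1..n}"
    have sg: "w (int j) < 0 \<longleftrightarrow> even (f\<^sub>0 j)" if "j \<in> {1..n}" for j
      using c that by (simp add: compat_def)
    have des: "f\<^sub>0 j \<noteq> f\<^sub>0 (Suc j)" if "j \<in> {1..<n}" "descent w j" for j
      using c that unfolding compat_iff_descents[OF w f0] by blast
    have "var_code (F_var (sign_of w) ?i j) = f\<^sub>0 j" if "j \<in> {1..n}" for j
      unfolding code using that sg[OF that] by simp
    then have "content n (\<lambda>j. var_code (F_var (sign_of w) ?i j)) = content n f\<^sub>0"
      by (rule content_cong)
    then have cont: "content n (F_var (sign_of w) ?i) = M"
      unfolding content_comp[of n var_code] M image_mset_var_code_eq_iff .
    have le: "f\<^sub>0 j \<le> f\<^sub>0 (Suc j)" if "j \<in> {1..<n}" for j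
      using that by (intro mono_onD[OF f0]) auto
    \<comment> \<open>The codes at a descent increase strictly. Equal halves would leave only the
      codes 2m and 2m + 1, that is, a barred letter followed by an unbarred one, which is no
      descent.\<close>
    have lt: "f\<^sub>0 j div 2 < f\<^sub>0 (Suc j) div 2" if j: "j \<in> {1..<n}" "descent w j" for j
    proof (rule ccontr)
      assume "\<not> f\<^sub>0 j div 2 < f\<^sub>0 (Suc j) div 2"
      moreover have "f\<^sub>0 j < f\<^sub>0 (Suc j)" using le[OF j(1)] des[OF j] by simp
      ultimately have "even (f\<^sub>0 j)" "odd (f\<^sub>0 (Suc j))" by presburger+
      moreover have "j \<in> {1..n}" "Suc j \<in> {1..n}" using j(1) by auto
      ultimately have "w (int j) < 0" "\<not> w (int (Suc j)) < 0" using sg by blast+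
      then show False using j(2) by (auto simp: descent_def less_r_def)
    qed
    show ?thesis
      unfolding F_indices_def
    proof (intro CollectI conjI ballI impI)
      fix j assume j: "j \<in> {1..<n}"
      show "?i j \<le> ?i (Suc j)" using le[OF j] j by (simp add: div_le_mono)
      assume "descent w j"
      then show "?i j < ?i (Suc j)" using lt[OF j] j by simp
    qed (simp_all add: cont[simplified])
  qed
  show ?thesis using sub mem by auto
qed

theorem ch_root_count:
  assumes k: "k > 0"
  shows "ch n (root_count n k) = (\<Sum>w | w \<in> signed_perms n \<and> w ^^ k = id. F n (sDes n w))"
proof (rule mps_eqI)
  fix M
  let ?W = "{w. w \<in> signed_perms n \<and> w ^^ k = id}"
  have finW: "finite ?W" using finite_signed_perms[of n] by simp
  have L: "mps_coeff (ch n (root_count n k)) M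
      = of_int (\<Sum>u\<in>signed_perms n. signed_fix n M is_Y (u ^^ k)) / (2 ^ n * fact n)"
    unfolding mps_coeff_ch sum_root_count by simp
  have R: "mps_coeff (\<Sum>w\<in>?W. F n (sDes n w)) M = (\<Sum>w\<in>?W. of_nat (card (F_indices n w M)))"
    unfolding mps_coeff_sum by (rule sum.cong) (simp_all add: mps_coeff_F)
  show "mps_coeff (ch n (root_count n k)) M = mps_coeff (\<Sum>w\<in>?W. F n (sDes n w)) M"
  proof (cases "size M = n")
    case True
    then obtain f\<^sub>0 where f0: "mono_on {1..n} f\<^sub>0" "content n f\<^sub>0 = image_mset var_code M"
      using mono_on_listing_exists[of "image_mset var_code M" n] by (auto simp: content_def)
    have "(\<Sum>u\<in>signed_perms n. signed_fix n M is_Y (u ^^ k))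
        = (\<Sum>u\<in>signed_perms n. signed_fix n (content n f\<^sub>0) even (u ^^ k))"
      unfolding f0(2) by (rule sum.cong) (simp_all add: signed_fix_var_code signed_perms_funpow)
    also have "\<dots> = 2 ^ n * fact n * int (card {w \<in> signed_perms n. w ^^ k = id \<and> compat n f\<^sub>0 even w})"
      by (rule count_compat_roots[OF k f0(1)])
    finally have "mps_coeff (ch n (root_count n k)) M
        = of_nat (card {w \<in> signed_perms n. w ^^ k = id \<and> compat n f\<^sub>0 even w})"
      unfolding L by simp
    also have "{w \<in> signed_perms n. w ^^ k = id \<and> compat n f\<^sub>0 even w} = {w \<in> ?W. compat n f\<^sub>0 even w}"
      by auto
    also have "of_nat (card {w \<in> ?W. compat n f\<^sub>0 even w})
        = (\<Sum>w\<in>?W. if compat n f\<^sub>0 even w then 1 else 0 :: complex)"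
      using finW by (subst sum.inter_filter[symmetric]) auto
    also have "\<dots> = (\<Sum>w\<in>?W. of_nat (card (F_indices n w M)))"
      by (rule sum.cong) (simp_all add: F_indices_eq[OF _ f0])
    finally show ?thesis unfolding R .
  next
    case False
    \<comment> \<open>Both sides are homogeneous of degree \<open>n\<close>.\<close>
    then have "fixed_colourings n M p = {}" for p
      using size_content[of n] by (auto simp: fixed_colourings_def)
    moreover have "F_indices n w M = {}" for w
      using False size_content[of n] by (auto simp: F_indices_def)
    ultimately show ?thesis unfolding L R by (simp add: signed_fix_def)
  qed
qed

section \<open>Weights as alternating sums of compatibility conditions\<close>

text \<open>Cut the positions after every element of \<open>I\<close>; the value is the right end of
  the piece that contains \<open>j\<close>.\<close>

definition next_in :: "nat set \<Rightarrow> nat \<Rightarrow> nat" where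
  "next_in I j = (LEAST t. t \<in> I \<and> j \<le> t)"

definition blk :: "nat \<Rightarrow> nat set \<Rightarrow> nat \<Rightarrow> nat set" where
  "blk n R r = {j \<in> {1..n}. next_in R j = r}"

lemma next_in_props:
  assumes "n \<in> I" "j \<le> n"
  shows "next_in I j \<in> I" "j \<le> next_in I j" "next_in I j \<le> n"
proof -
  have ex: "n \<in> I \<and> j \<le> n" using assms by blast
  have "next_in I j \<in> I \<and> j \<le> next_in I j"
    unfolding next_in_def by (rule LeastI[where P = "\<lambda>t. t \<in> I \<and> j \<le> t", OF ex])
  then show "next_in I j \<in> I" "j \<le> next_in I j" by blast+
  show "next_in I j \<le> n"
    unfolding next_in_def by (rule Least_le[where P = "\<lambda>t. t \<in> I \<and> j \<le> t", OF ex])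
qed

lemma next_in_le: "t \<in> I \<Longrightarrow> j \<le> t \<Longrightarrow> next_in I j \<le> t"
  unfolding next_in_def by (simp add: Least_le)

lemma next_in_self: "t \<in> I \<Longrightarrow> next_in I t = t"
  using next_in_props[of t I t] next_in_le[of t I t] by simp

lemma next_in_mono: "n \<in> I \<Longrightarrow> i \<le> j \<Longrightarrow> j \<le> n \<Longrightarrow> next_in I i \<le> next_in I j"
  using next_in_props[of n I j] by (intro next_in_le) auto

lemma next_in_next_in:
  assumes "n \<in> R" "R \<subseteq> I" "j \<le> n"
  shows "next_in R (next_in I j) = next_in R j"
proof (rule antisym)
  have nI: "n \<in> I" using assms by blast
  have R: "next_in R j \<in> R" "j \<le> next_in R j" using next_in_props[OF assms(1,3)] by blast+
  then have "next_in I j \<le> next_in R j" using assms(2) by (intro next_in_le) auto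
  then show "next_in R (next_in I j) \<le> next_in R j" using R(1) by (rule next_in_le[rotated])
  show "next_in R j \<le> next_in R (next_in I j)"
    using next_in_props[OF nI assms(3)] by (intro next_in_mono[OF assms(1)]) auto
qed

lemma next_in_Suc_eq_iff:
  assumes "n \<in> I" "j < n"
  shows "next_in I j = next_in I (Suc j) \<longleftrightarrow> j \<notin> I"
proof
  assume eq: "next_in I j = next_in I (Suc j)"
  show "j \<notin> I"
  proof
    assume "j \<in> I"
    then show False using eq next_in_self[of j I] next_in_props(2)[of n I "Suc j"] assms by simp
  qed
next
  assume j: "j \<notin> I"
  have p: "next_in I j \<in> I" "j \<le> next_in I j" using next_in_props[of n I j] assms by auto
  then have "j \<noteq> next_in I j" using j by auto
  then have "next_in I (Suc j) \<le> next_in I j" using p by (intro next_in_le) auto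
  moreover have "next_in I j \<le> next_in I (Suc j)" using assms by (intro next_in_mono[of n]) auto
  ultimately show "next_in I j = next_in I (Suc j)" by simp
qed

lemma blk_self: "R \<subseteq> {1..n} \<Longrightarrow> r \<in> R \<Longrightarrow> r \<in> blk n R r"
  by (auto simp: blk_def next_in_self)

text \<open>Moebius cancellation in a Boolean interval: writing T as the union of S and a subset of
  Q - S turns the sum into a product of factors 1 - 1.\<close>

lemma alternating_sum_interval:
  assumes "finite Q"
  shows "(\<Sum>T | S \<subseteq> T \<and> T \<subseteq> Q. (- 1) ^ card T) = (if S = Q then (- 1) ^ card S else (0::int))"
proof (cases "S \<subseteq> Q")
  case True
  then have fin: "finite S" using assms finite_subset by blast
  have "(\<Sum>T | S \<subseteq> T \<and> T \<subseteq> Q. (- 1) ^ card T) = (\<Sum>U\<in>Pow (Q - S). (- 1) ^ card S * (\<Prod>i\<in>U. - 1 :: int))"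
  proof (rule sum.reindex_bij_witness[where i = "\<lambda>U. S \<union> U" and j = "\<lambda>T. T - S"])
    fix T assume T: "T \<in> {T. S \<subseteq> T \<and> T \<subseteq> Q}"
    then have "finite (T - S)" using assms finite_subset by blast
    moreover have "T = S \<union> (T - S)" using T by blast
    ultimately have "card T = card S + card (T - S)"
      using fin card_Un_disjoint[of S "T - S"] by simp
    then show "(- 1) ^ card S * (\<Prod>i\<in>T - S. - 1 :: int) = (- 1) ^ card T" by (simp add: power_add)
  qed (use True in auto)
  also have "\<dots> = (- 1) ^ card S * (\<Prod>i\<in>Q - S. 1 + (- 1))"
    unfolding sum_distrib_left[symmetric] using assms by (subst sum_Pow_prod) auto
  also have "\<dots> = (if S = Q then (- 1) ^ card S else 0)"
  proof (cases "S = Q")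
    case False
    then obtain i where "i \<in> Q - S" using True by blast
    then have "(\<Prod>i\<in>Q - S. 1 + (- 1) :: int) = 0" using assms by (intro prod_zero) auto
    then show ?thesis using False by simp
  qed simp
  finally show ?thesis .
next
  case False
  then have e: "{T. S \<subseteq> T \<and> T \<subseteq> Q} = {}" and ne: "S \<noteq> Q" by blast+
  show ?thesis unfolding e using ne by simp
qed

definition initial_in_blocks :: "nat \<Rightarrow> nat set \<Rightarrow> nat set \<Rightarrow> bool" where
  "initial_in_blocks n R S \<longleftrightarrow>
     (\<forall>i\<in>{1..n} - R. \<forall>j\<in>{1..n} - R. next_in R i = next_in R j \<and> i \<le> j \<and> j \<in> S \<longrightarrow> i \<in> S)"

text \<open>A set that is initial in every block corresponds to one marked point per block, the
  first point outside the set. Since \<open>S\<close> avoids the last point \<open>r\<close> of a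
  block, such a point exists; if \<open>S\<close> contains all other points of the block, the mark
  is \<open>r\<close>.\<close>

lemma initial_in_blocks_witness:
  assumes R: "R \<subseteq> {1..n}" "n \<in> R" and S: "S \<subseteq> {1..n} - R"
  shows "card {x \<in> PiE R (blk n R). {j \<in> {1..n} - R. j < x (next_in R j)} = S}
       = (if initial_in_blocks n R S then 1 else 0)"
proof -
  let ?Q = "\<lambda>x. {j \<in> {1..n} - R. j < x (next_in R j)}"
  have blk_le: "j \<le> r" if "j \<in> blk n R r" for j r
    using that next_in_props(2)[OF R(2), of j] by (auto simp: blk_def)
  have nextR: "next_in R j \<in> R" if "j \<in> {1..n}" for j
    using that next_in_props(1)[OF R(2)] by simp
  have le: "x r \<le> y r"
    if x: "x \<in> PiE R (blk n R)" and y: "y \<in> PiE R (blk n R)" and eq: "?Q x = ?Q y" and r: "r \<in> R" for x y r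
  proof (rule ccontr)
    assume "\<not> x r \<le> y r"
    then have lt: "y r < x r" by simp
    have xr: "x r \<in> blk n R r" and yr: "y r \<in> blk n R r" using x y r by (auto dest: PiE_mem)
    have "y r < r" using lt blk_le[OF xr] by simp
    moreover have nx: "next_in R (y r) = r" using yr by (simp add: blk_def)
    ultimately have "y r \<notin> R" using next_in_self[of "y r" R] by auto
    then have "y r \<in> ?Q x" using yr nx lt by (simp add: blk_def)
    then have "y r \<in> ?Q y" by (rule equalityD1[OF eq, THEN subsetD])
    then show False using nx by simp
  qed
  have unique: "x = y"
    if "x \<in> PiE R (blk n R)" "y \<in> PiE R (blk n R)" "?Q x = ?Q y" for x y
  proof (rule PiE_ext[OF that(1,2)])
    fix r assume "r \<in> R"
    then show "x r = y r" using le[OF that(1,2,3)] le[OF that(2,1) that(3)[symmetric]] by (simp add: antisym)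
  qed
  show ?thesis
  proof (cases "initial_in_blocks n R S")
    case True
    define x where "x = restrict (\<lambda>r. LEAST j. j \<in> blk n R r \<and> j \<notin> S) R"
    have xp: "x r \<in> blk n R r" "x r \<notin> S" and xl: "\<And>j. j \<in> blk n R r \<Longrightarrow> j < x r \<Longrightarrow> j \<in> S"
      if r: "r \<in> R" for r
    proof -
      have ex: "r \<in> blk n R r \<and> r \<notin> S" using blk_self[OF R(1) r] r S by blast
      have "x r = (LEAST j. j \<in> blk n R r \<and> j \<notin> S)" using r by (simp add: x_def)
      then have "x r \<in> blk n R r \<and> x r \<notin> S"
        using LeastI[where P = "\<lambda>j. j \<in> blk n R r \<and> j \<notin> S", OF ex] by simp
      then show "x r \<in> blk n R r" "x r \<notin> S" by blast+
      show "j \<in> S" if "j \<in> blk n R r" "j < x r" for j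
      proof -
        have "j < (LEAST j. j \<in> blk n R r \<and> j \<notin> S)" using that(2) r by (simp add: x_def)
        from not_less_Least[OF this] show ?thesis using that(1) by blast
      qed
    qed
    have xP: "x \<in> PiE R (blk n R)" using xp by (auto simp: x_def)
    have "?Q x = S"
    proof (intro equalityI subsetI)
      fix j assume j: "j \<in> ?Q x"
      then have "j \<in> blk n R (next_in R j)" by (simp add: blk_def)
      then show "j \<in> S" using xl[OF nextR] j by blast
    next
      fix j assume j: "j \<in> S"
      then have jA: "j \<in> {1..n}" "j \<notin> R" using S by auto
      let ?r = "next_in R j"
      have r: "?r \<in> R" using nextR[OF jA(1)] .
      have "j < x ?r"
      proof (rule ccontr)
        assume "\<not> j < x ?r"
        then have le: "x ?r \<le> j" by simp
        have "j < ?r" using next_in_props(2)[OF R(2), of j] jA r by (metis atLeastAtMost_iff le_neq_implies_less)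
        moreover have nx: "next_in R (x ?r) = ?r" "x ?r \<in> {1..n}" using xp(1)[OF r] by (auto simp: blk_def)
        ultimately have "x ?r \<notin> R" using le next_in_self[of "x ?r" R] by auto
        then have "x ?r \<in> S"
          using True jA nx le j unfolding initial_in_blocks_def by blast
        then show False using xp(2)[OF r] by blast
      qed
      then show "j \<in> ?Q x" using jA by simp
    qed
    then have "{x \<in> PiE R (blk n R). ?Q x = S} = {x}" using xP unique by blast
    then show ?thesis using True by simp
  next
    case False
    have "initial_in_blocks n R (?Q x)" for x by (auto simp: initial_in_blocks_def)
    then have "{x \<in> PiE R (blk n R). ?Q x = S} = {}" using False by blast
    then show ?thesis using False by (metis card.empty)
  qed
qed

text \<open>With additional cuts after the points of \<open>T\<close>, the marked point lies in the
  last piece of its block exactly if all cuts inside the block precede it.\<close>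

lemma next_in_fibre_iff:
  assumes R: "R \<subseteq> {1..n}" "n \<in> R" and T: "T \<subseteq> {1..n} - R" and x: "x \<in> PiE R (blk n R)"
  shows "(\<forall>r\<in>R. next_in (R \<union> T) (x r) = r) \<longleftrightarrow> T \<subseteq> {j \<in> {1..n} - R. j < x (next_in R j)}"
proof
  assume *: "\<forall>r\<in>R. next_in (R \<union> T) (x r) = r"
  show "T \<subseteq> {j \<in> {1..n} - R. j < x (next_in R j)}"
  proof
    fix j assume j: "j \<in> T"
    then have jA: "j \<in> {1..n}" "j \<notin> R" using T by auto
    let ?r = "next_in R j"
    have r: "?r \<in> R" "j \<le> ?r" using next_in_props[OF R(2), of j] jA by auto
    have "j < x ?r"
    proof (rule ccontr)
      assume "\<not> j < x ?r"
      then have "next_in (R \<union> T) (x ?r) \<le> j" using j by (intro next_in_le) auto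
      moreover have "next_in (R \<union> T) (x ?r) = ?r" using * r(1) by blast
      ultimately have "?r \<le> j" by simp
      then show False using r jA by simp
    qed
    then show "j \<in> {j \<in> {1..n} - R. j < x (next_in R j)}" using jA by simp
  qed
next
  assume *: "T \<subseteq> {j \<in> {1..n} - R. j < x (next_in R j)}"
  show "\<forall>r\<in>R. next_in (R \<union> T) (x r) = r"
  proof
    fix r assume r: "r \<in> R"
    have "x r \<in> blk n R r" using x r by (rule PiE_mem)
    then have xr: "x r \<in> {1..n}" "next_in R (x r) = r" by (auto simp: blk_def)
    have nI: "n \<in> R \<union> T" using R by simp
    let ?t = "next_in (R \<union> T) (x r)"
    have t: "?t \<in> R \<union> T" "x r \<le> ?t" using next_in_props[OF nI, of "x r"] xr by auto
    have nt: "next_in R ?t = r" using next_in_next_in[of n R "R \<union> T" "x r"] R xr by simp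
    have "?t \<notin> T"
    proof
      assume "?t \<in> T"
      then have "?t < x (next_in R ?t)" using * by blast
      then show False using nt t by simp
    qed
    then have "?t \<in> R" using t by blast
    from next_in_self[OF this] show "?t = r" using nt by simp
  qed
qed

text \<open>Writing the sizes of the last pieces as a number of marked points reduces the dependence
  on \<open>T\<close> to an inclusion, and alternating sums over such a condition collapse.\<close>

lemma card_fibres_eq_sum:
  assumes R: "R \<subseteq> {1..n}" "n \<in> R" and T: "T \<subseteq> {1..n} - R"
  shows "(\<Prod>r\<in>R. card {j \<in> {1..n}. next_in (R \<union> T) j = r})
     = card {x \<in> PiE R (blk n R). T \<subseteq> {j \<in> {1..n} - R. j < x (next_in R j)}}"
proof -
  have finR: "finite R" using R finite_subset by blast
  have "(\<Prod>r\<in>R. card {j \<in> {1..n}. next_in (R \<union> T) j = r})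
      = card (PiE R (\<lambda>r. {j \<in> {1..n}. next_in (R \<union> T) j = r}))"
    using finR by (simp add: card_PiE)
  also have "PiE R (\<lambda>r. {j \<in> {1..n}. next_in (R \<union> T) j = r})
      = {x \<in> PiE R (blk n R). \<forall>r\<in>R. next_in (R \<union> T) (x r) = r}"
  proof (intro equalityI subsetI)
    fix x assume x: "x \<in> PiE R (\<lambda>r. {j \<in> {1..n}. next_in (R \<union> T) j = r})"
    have p: "x r \<in> {1..n}" "next_in (R \<union> T) (x r) = r" if "r \<in> R" for r
      using PiE_mem[OF x that] by auto
    have "x r \<in> blk n R r" if r: "r \<in> R" for r
    proof -
      have "next_in R (x r) = next_in R (next_in (R \<union> T) (x r))"
        using next_in_next_in[of n R "R \<union> T" "x r"] R p(1)[OF r] by simp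
      then show ?thesis using p[OF r] r by (simp add: blk_def next_in_self)
    qed
    moreover have "x \<in> extensional R" using x by (simp add: PiE_def)
    ultimately show "x \<in> {x \<in> PiE R (blk n R). \<forall>r\<in>R. next_in (R \<union> T) (x r) = r}"
      using p(2) by (simp add: PiE_def Pi_def)
  next
    fix x assume "x \<in> {x \<in> PiE R (blk n R). \<forall>r\<in>R. next_in (R \<union> T) (x r) = r}"
    then show "x \<in> PiE R (\<lambda>r. {j \<in> {1..n}. next_in (R \<union> T) j = r})"
      by (simp add: PiE_def Pi_def blk_def)
  qed
  also have "\<dots> = {x \<in> PiE R (blk n R). T \<subseteq> {j \<in> {1..n} - R. j < x (next_in R j)}}"
    using next_in_fibre_iff[OF R T] by blast
  finally show ?thesis .
qed

text \<open>After the exchange of sums, the inner sum runs over the sets between \<open>S\<close>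
  and the set defined by the marks, and vanishes unless the two coincide. One choice of marks
  survives if \<open>S\<close> is initial in every block, none otherwise; this is where the initial
  segments in \<open>wt\<close> come from.\<close>

lemma alternating_block_sum:
  assumes R: "R \<subseteq> {1..n}" "n \<in> R" and S: "S \<subseteq> {1..n} - R"
  shows "(\<Sum>T\<in>Pow ({1..n} - R). if S \<subseteq> T
       then (- 1) ^ card T * int (\<Prod>r\<in>R. card {j \<in> {1..n}. next_in (R \<union> T) j = r}) else 0)
     = (if initial_in_blocks n R S then (- 1) ^ card S else 0)"
proof -
  let ?B = "{1..n} - R" and ?P = "PiE R (blk n R)"
  let ?Q = "\<lambda>x. {j \<in> {1..n} - R. j < x (next_in R j)}"
  have finR: "finite R" using R finite_subset by blast
  have finP: "finite ?P" using finR by (intro finite_PiE) (auto simp: blk_def)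
  have "(\<Sum>T\<in>Pow ?B. if S \<subseteq> T
       then (- 1) ^ card T * int (\<Prod>r\<in>R. card {j \<in> {1..n}. next_in (R \<union> T) j = r}) else 0)
      = (\<Sum>T\<in>Pow ?B. \<Sum>x\<in>?P. if S \<subseteq> T \<and> T \<subseteq> ?Q x then (- 1) ^ card T else 0)"
  proof (rule sum.cong)
    fix T assume "T \<in> Pow ?B"
    then have T: "T \<subseteq> ?B" by simp
    have "int (card {x \<in> ?P. T \<subseteq> ?Q x}) = (\<Sum>x\<in>?P. if T \<subseteq> ?Q x then 1 else 0)"
      using finP by (subst sum.inter_filter[symmetric]) auto
    then have "(- 1) ^ card T * int (card {x \<in> ?P. T \<subseteq> ?Q x}) = (\<Sum>x\<in>?P. if T \<subseteq> ?Q x then (- 1) ^ card T else 0)"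
      by (simp add: sum_distrib_left if_distrib[of "\<lambda>y. _ * y"] cong: if_cong)
    then show "(if S \<subseteq> T then (- 1) ^ card T * int (\<Prod>r\<in>R. card {j \<in> {1..n}. next_in (R \<union> T) j = r}) else 0)
        = (\<Sum>x\<in>?P. if S \<subseteq> T \<and> T \<subseteq> ?Q x then (- 1) ^ card T else 0)"
      unfolding card_fibres_eq_sum[OF R T] by simp
  qed simp
  also have "\<dots> = (\<Sum>x\<in>?P. \<Sum>T\<in>Pow ?B. if S \<subseteq> T \<and> T \<subseteq> ?Q x then (- 1) ^ card T else 0)"
    by (rule sum.swap)
  also have "\<dots> = (\<Sum>x\<in>?P. if ?Q x = S then (- 1) ^ card S else 0)"
  proof (rule sum.cong)
    fix x
    have "(\<Sum>T\<in>Pow ?B. if S \<subseteq> T \<and> T \<subseteq> ?Q x then (- 1) ^ card T else 0)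
        = (\<Sum>T\<in>{T \<in> Pow ?B. S \<subseteq> T \<and> T \<subseteq> ?Q x}. (- 1) ^ card T :: int)"
      by (rule sum.inter_filter[symmetric]) simp
    also have "{T \<in> Pow ?B. S \<subseteq> T \<and> T \<subseteq> ?Q x} = {T. S \<subseteq> T \<and> T \<subseteq> ?Q x}" by blast
    also have "(\<Sum>T\<in>\<dots>. (- 1) ^ card T) = (if S = ?Q x then (- 1) ^ card S else (0::int))"
      by (rule alternating_sum_interval) simp
    finally show "(\<Sum>T\<in>Pow ?B. if S \<subseteq> T \<and> T \<subseteq> ?Q x then (- 1) ^ card T else 0)
        = (if ?Q x = S then (- 1) ^ card S else (0::int))" by (simp only: eq_commute[of S])
  qed simp
  also have "\<dots> = (- 1) ^ card S * int (card {x \<in> ?P. ?Q x = S})"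
    using finP by (subst sum.inter_filter[symmetric]) auto
  also have "\<dots> = (if initial_in_blocks n R S then (- 1) ^ card S else 0)"
    unfolding initial_in_blocks_witness[OF R S] by simp
  finally show ?thesis .
qed

section \<open>Weights expanded in compatibility conditions\<close>

text \<open>The coefficients of p_m = sum over a of (-1)^(l - 1) a_l h_a, multiplied over the
  blocks: \<open>T\<close> refines the blocks, so \<open>card T\<close> is the total of the l - 1,
  and the fibre over \<open>r\<close> is the last part. A block in \<open>N\<close> is expanded in
  the y-variables, where p_m enters with a minus sign if the part is barred.\<close>

definition block_coeff :: "nat \<Rightarrow> nat set \<Rightarrow> nat set \<Rightarrow> nat set \<Rightarrow> nat set \<Rightarrow> int" where
  "block_coeff n R Bd T N =
     (- 1) ^ card T * int (\<Prod>r\<in>R. card {j \<in> {1..n}. next_in (R \<union> T) j = r}) * (- 1) ^ card (N \<inter> Bd)"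

text \<open>This is \<open>wt\<close> in terms of the set \<open>R\<close> of partial sums and the
  subset \<open>Bd\<close> of those that close a barred part.\<close>

definition block_weight :: "nat \<Rightarrow> nat set \<Rightarrow> nat set \<Rightarrow> (int \<Rightarrow> int) \<Rightarrow> int" where
  "block_weight n R Bd w =
     (if (\<forall>j\<in>{1..n}. sign_of w j = sign_of w (next_in R j)) \<and> initial_in_blocks n R (fst (sDes n w) - R)
      then (- 1) ^ (card (fst (sDes n w) - R) + card {r \<in> Bd. sign_of w r = Minus}) else 0)"

text \<open>The fibres of the colouring are the pieces cut out by \<open>R \<union> T\<close>, while
  \<open>N\<close> prescribes one sign for each block of \<open>R\<close>. Inside a block of
  constant sign the elements of the descent set outside \<open>R\<close> are exactly descents, and
  these must occur at cuts.\<close>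

lemma compat_next_in_iff:
  assumes w: "w \<in> signed_perms n" and R: "R \<subseteq> {1..n}" "n \<in> R" and T: "T \<subseteq> {1..n} - R" and N: "N \<subseteq> R"
  shows "compat n (next_in (R \<union> T)) (\<lambda>c. next_in R c \<in> N) w \<longleftrightarrow>
     (\<forall>j\<in>{1..n}. sign_of w j = sign_of w (next_in R j)) \<and> N = {r \<in> R. sign_of w r = Minus}
       \<and> fst (sDes n w) - R \<subseteq> T"
proof -
  let ?I = "R \<union> T"
  have nI: "n \<in> ?I" using R by simp
  have mono: "mono_on {1..n} (next_in ?I)"
    by (rule mono_onI) (use next_in_mono[OF nI] in auto)
  have sm: "w (int j) < 0 \<longleftrightarrow> sign_of w j = Minus" for j by (simp add: sign_of_def)
  have nn: "next_in R (next_in ?I j) = next_in R j" if "j \<in> {1..n}" for j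
    using that R by (intro next_in_next_in) auto
  have nR: "next_in R j \<in> R" if "j \<in> {1..n}" for j
    using that next_in_props(1)[OF R(2)] by simp
  have sg: "(\<forall>j\<in>{1..n}. w (int j) < 0 \<longleftrightarrow> next_in R (next_in ?I j) \<in> N) \<longleftrightarrow>
      (\<forall>j\<in>{1..n}. sign_of w j = sign_of w (next_in R j)) \<and> N = {r \<in> R. sign_of w r = Minus}"
    (is "?a \<longleftrightarrow> ?b \<and> ?c")
  proof
    assume ?a
    then have a: "sign_of w j = Minus \<longleftrightarrow> next_in R j \<in> N" if "j \<in> {1..n}" for j
      using nn that sm by simp
    have ar: "sign_of w r = Minus \<longleftrightarrow> r \<in> N" if "r \<in> R" for r
      using a[of r] that R(1) next_in_self[OF that] by auto
    have ?c using ar N by blast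
    moreover have ?b
    proof
      fix j assume j: "j \<in> {1..n}"
      have "sign_of w j = Minus \<longleftrightarrow> sign_of w (next_in R j) = Minus" using a[OF j] ar[OF nR[OF j]] by simp
      then show "sign_of w j = sign_of w (next_in R j)"
        by (cases "sign_of w j"; cases "sign_of w (next_in R j)") auto
    qed
    ultimately show "?b \<and> ?c" by blast
  next
    assume bc: "?b \<and> ?c"
    show ?a
    proof
      fix j assume j: "j \<in> {1..n}"
      show "w (int j) < 0 \<longleftrightarrow> next_in R (next_in ?I j) \<in> N"
        unfolding nn[OF j] sm using bc j nR[OF j] by auto
    qed
  qed
  have des: "(\<forall>j\<in>{1..<n}. next_in ?I j = next_in ?I (Suc j) \<longrightarrow> \<not> descent w j) \<longleftrightarrow> fst (sDes n w) - R \<subseteq> T"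
    if b: "\<forall>j\<in>{1..n}. sign_of w j = sign_of w (next_in R j)"
  proof -
    have D: "j \<in> fst (sDes n w) \<longleftrightarrow> descent w j" if j: "j \<in> {1..<n}" "j \<notin> R" for j
    proof -
      have "next_in R j = next_in R (Suc j)" using next_in_Suc_eq_iff[OF R(2)] j by simp
      moreover have "j \<in> {1..n}" "Suc j \<in> {1..n}" using j by auto
      ultimately have "sign_of w j = sign_of w (Suc j)" using b by metis
      then have "\<not> (w (int j) < 0 \<and> 0 < w (int (j + 1)))" by (auto simp: sign_of_def split: if_splits)
      then show ?thesis using j by (auto simp: fst_sDes)
    qed
    have eq: "fst (sDes n w) - R = {j \<in> {1..<n}. j \<notin> R \<and> descent w j}"
    proof (intro equalityI subsetI)
      fix j assume j: "j \<in> fst (sDes n w) - R"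
      then have "j \<in> {1..<n}" using R(2) by (auto simp: fst_sDes)
      then show "j \<in> {j \<in> {1..<n}. j \<notin> R \<and> descent w j}" using D j by blast
    next
      fix j assume "j \<in> {j \<in> {1..<n}. j \<notin> R \<and> descent w j}"
      then show "j \<in> fst (sDes n w) - R" using D by blast
    qed
    have nx: "next_in ?I j = next_in ?I (Suc j) \<longleftrightarrow> j \<notin> R \<and> j \<notin> T" if "j \<in> {1..<n}" for j
      using next_in_Suc_eq_iff[OF nI, of j] that by simp
    show ?thesis
      unfolding eq
    proof (intro iffI subsetI ballI impI)
      fix j assume a: "\<forall>j\<in>{1..<n}. next_in ?I j = next_in ?I (Suc j) \<longrightarrow> \<not> descent w j"
        and j: "j \<in> {j \<in> {1..<n}. j \<notin> R \<and> descent w j}"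
      then have j': "j \<in> {1..<n}" "j \<notin> R" "descent w j" by blast+
      from a j'(1,3) have "next_in ?I j \<noteq> next_in ?I (Suc j)" by blast
      then show "j \<in> T" using nx[OF j'(1)] j'(2) by blast
    next
      fix j assume "{j \<in> {1..<n}. j \<notin> R \<and> descent w j} \<subseteq> T" and j: "j \<in> {1..<n}"
        and "next_in ?I j = next_in ?I (Suc j)"
      then show "\<not> descent w j" using nx[OF j] by blast
    qed
  qed
  show ?thesis unfolding compat_iff_descents[OF w mono] sg using des by blast
qed

text \<open>For a given \<open>w\<close> only the set of its negative blocks contributes as
  \<open>N\<close>; the remaining sum over \<open>T\<close> is the one of
  \<open>alternating_block_sum\<close> for the descent set outside \<open>R\<close>.\<close>

lemma block_weight_expansion:
  assumes w: "w \<in> signed_perms n" and R: "R \<subseteq> {1..n}" "n \<in> R" and Bd: "Bd \<subseteq> R"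
  shows "(\<Sum>T\<in>Pow ({1..n} - R). \<Sum>N\<in>Pow R. block_coeff n R Bd T N *
       (if compat n (next_in (R \<union> T)) (\<lambda>c. next_in R c \<in> N) w then 1 else 0)) = block_weight n R Bd w"
proof -
  let ?S = "fst (sDes n w) - R" and ?N = "{r \<in> R. sign_of w r = Minus}"
  let ?c = "\<forall>j\<in>{1..n}. sign_of w j = sign_of w (next_in R j)"
  let ?C = "\<lambda>T. (- 1) ^ card T * int (\<Prod>r\<in>R. card {j \<in> {1..n}. next_in (R \<union> T) j = r})"
  have finR: "finite R" using R finite_subset by blast
  have S: "?S \<subseteq> {1..n} - R" using R by (auto simp: fst_sDes)
  have pull: "(\<Sum>T\<in>X. if b then g T * c else 0) = (if b then (\<Sum>T\<in>X. g T) * c else 0)"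
    for X :: "nat set set" and b g and c :: int
    by (cases b) (simp_all add: sum_distrib_right)
  have NB: "?N \<inter> Bd = {r \<in> Bd. sign_of w r = Minus}" using Bd by auto
  have "(\<Sum>N\<in>Pow R. block_coeff n R Bd T N *
       (if compat n (next_in (R \<union> T)) (\<lambda>c. next_in R c \<in> N) w then 1 else 0))
      = (if ?c then (if ?S \<subseteq> T then ?C T else 0) * (- 1) ^ card (?N \<inter> Bd) else 0)"
    if T: "T \<in> Pow ({1..n} - R)" for T
  proof -
    have "(\<Sum>N\<in>Pow R. block_coeff n R Bd T N *
        (if compat n (next_in (R \<union> T)) (\<lambda>c. next_in R c \<in> N) w then 1 else 0))
       = (\<Sum>N\<in>Pow R. if N = ?N then (if ?c \<and> ?S \<subseteq> T then block_coeff n R Bd T ?N else 0) else 0)"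
    proof (rule sum.cong)
      fix N assume "N \<in> Pow R"
      then have N: "N \<subseteq> R" by simp
      have T': "T \<subseteq> {1..n} - R" using T by simp
      show "block_coeff n R Bd T N * (if compat n (next_in (R \<union> T)) (\<lambda>c. next_in R c \<in> N) w then 1 else 0)
          = (if N = ?N then (if ?c \<and> ?S \<subseteq> T then block_coeff n R Bd T ?N else 0) else 0)"
        unfolding compat_next_in_iff[OF w R T' N] by (cases "N = ?N") simp_all
    qed simp
    also have "\<dots> = (if ?c \<and> ?S \<subseteq> T then block_coeff n R Bd T ?N else 0)"
      using finR by (subst sum.delta) auto
    finally show ?thesis by (simp add: block_coeff_def)
  qed
  then have "(\<Sum>T\<in>Pow ({1..n} - R). \<Sum>N\<in>Pow R. block_coeff n R Bd T N *
       (if compat n (next_in (R \<union> T)) (\<lambda>c. next_in R c \<in> N) w then 1 else 0))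
      = (\<Sum>T\<in>Pow ({1..n} - R). if ?c then (if ?S \<subseteq> T then ?C T else 0) * (- 1) ^ card (?N \<inter> Bd) else 0)"
    by (rule sum.cong[OF refl])
  also have "\<dots> = (if ?c then (\<Sum>T\<in>Pow ({1..n} - R). if ?S \<subseteq> T then ?C T else 0) * (- 1) ^ card (?N \<inter> Bd) else 0)"
    by (rule pull)
  also have "\<dots> = block_weight n R Bd w"
    unfolding alternating_block_sum[OF R S] block_weight_def NB by (simp add: power_add)
  finally show ?thesis .
qed

section \<open>Cancellation of the dual class function\<close>

text \<open>An ordered set partition of \<open>A\<close> whose parts are labelled by cumulative
  sizes. The labels then record the composition.\<close>

definition ranked :: "nat set \<Rightarrow> (nat \<Rightarrow> nat) \<Rightarrow> bool" where
  "ranked A f \<longleftrightarrow> (\<forall>j\<in>A. card {i \<in> A. f i \<le> f j} = f j)"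

definition swap_outside :: "nat set \<Rightarrow> nat \<Rightarrow> nat \<Rightarrow> (nat \<Rightarrow> nat) \<Rightarrow> nat \<Rightarrow> nat" where
  "swap_outside b q r f j = (if j \<in> b then f j else transpose q r (f j))"

text \<open>The level set of \<open>r\<close> either equals \<open>b\<close>, and then \<open>q\<close> is the preceding level, or it properly
  contains \<open>b\<close>, and then no level lies in \<open>[q, r)\<close>.  Swapping \<open>q\<close> and \<open>r\<close> outside \<open>b\<close> exchanges the
  two situations.\<close>

context
  fixes A b :: "nat set" and f :: "nat \<Rightarrow> nat" and q r :: nat
  assumes finA: "finite A" and rk: "ranked A f" and bA: "b \<subseteq> A" and bne: "b \<noteq> {}"
    and fb: "\<And>j. j \<in> b \<Longrightarrow> f j = r" and qr: "q + card b = r" and q1: "q \<ge> 1"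
begin

lemma swap_q_less_r: "q < r"
proof -
  have "card b > 0" using finite_subset[OF bA finA] bne by (simp add: card_gt_0_iff)
  then show ?thesis using qr by simp
qed

lemma swap_card_le_r: "card {i \<in> A. f i \<le> r} = r"
proof -
  obtain j where j: "j \<in> b" using bne by blast
  then have "j \<in> A" using bA by blast
  then have "card {i \<in> A. f i \<le> f j} = f j" using rk by (simp add: ranked_def)
  then show ?thesis using fb[OF j] by simp
qed

text \<open>For a level v in [q, r), the elements up to level v together with the level
  \<open>r\<close> number at most \<open>r\<close>, and the level \<open>r\<close> has at least
  \<open>card b\<close>, which is r - q. So v is at most \<open>q\<close>, and with v = q the level
  \<open>r\<close> cannot exceed \<open>b\<close>.\<close>

lemma swap_level_between:
  assumes i: "i \<in> A" "q \<le> f i" "f i < r"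
  shows "f i = q" "{j \<in> A. f j = r} = b"
proof -
  have ci: "card {j \<in> A. f j \<le> f i} = f i" using rk i(1) by (simp add: ranked_def)
  have finb: "finite b" using finite_subset[OF bA finA] .
  have "card ({j \<in> A. f j \<le> f i} \<union> b) = f i + card b"
    using ci finA finb fb i(3) by (subst card_Un_disjoint) auto
  moreover have "card ({j \<in> A. f j \<le> f i} \<union> b) \<le> card {j \<in> A. f j \<le> r}"
    using finA bA fb i(3) by (intro card_mono) auto
  ultimately have "f i \<le> q" using swap_card_le_r qr by simp
  then show fi: "f i = q" using i(2) by simp
  have "card ({j \<in> A. f j \<le> f i} \<union> {j \<in> A. f j = r}) = f i + card {j \<in> A. f j = r}"
    using ci finA i(3) by (subst card_Un_disjoint) auto
  moreover have "card ({j \<in> A. f j \<le> f i} \<union> {j \<in> A. f j = r}) \<le> card {j \<in> A. f j \<le> r}"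
    using finA i(3) by (intro card_mono) auto
  ultimately have "card {j \<in> A. f j = r} \<le> card b" using swap_card_le_r qr fi by simp
  moreover have "b \<subseteq> {j \<in> A. f j = r}" using bA fb by blast
  ultimately show "{j \<in> A. f j = r} = b" using card_seteq[of "{j \<in> A. f j = r}" b] finA by simp
qed

text \<open>Exactly r - card b = q elements lie below level \<open>r\<close>, and \<open>q\<close>
  is positive, so the highest level below \<open>r\<close> exists and has the label
  \<open>q\<close>.\<close>

lemma swap_level_q:
  assumes eq: "{j \<in> A. f j = r} = b" shows "q \<in> f ` A"
proof -
  let ?L = "{i \<in> A. f i < r}"
  have "{i \<in> A. f i \<le> r} = ?L \<union> b" unfolding eq[symmetric] by auto
  moreover have "?L \<inter> b = {}" unfolding eq[symmetric] by auto
  ultimately have "card {i \<in> A. f i \<le> r} = card ?L + card b"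
    using finA finite_subset[OF bA finA] by (simp add: card_Un_disjoint)
  then have cL: "card ?L = q" using swap_card_le_r qr by simp
  then have "?L \<noteq> {}" using q1 by (metis card.empty not_one_le_zero)
  have fin: "finite (f ` ?L)" using finA by simp
  have "Max (f ` ?L) \<in> f ` ?L" using fin \<open>?L \<noteq> {}\<close> by (intro Max_in) auto
  then obtain i where i: "i \<in> ?L" "Max (f ` ?L) = f i" by blast
  have "{j \<in> A. f j \<le> f i} = ?L"
  proof (intro equalityI subsetI)
    fix j assume "j \<in> ?L"
    then have "f j \<le> f i" unfolding i(2)[symmetric] using fin by (intro Max_ge) auto
    then show "j \<in> {j \<in> A. f j \<le> f i}" using \<open>j \<in> ?L\<close> by simp
  qed (use i in auto)
  moreover have "card {j \<in> A. f j \<le> f i} = f i" using rk i(1) by (simp add: ranked_def)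
  ultimately have "f i = q" using cL by simp
  then show ?thesis using i(1) by blast
qed

text \<open>The elements of \<open>b\<close> keep the label \<open>r\<close>, so it does not
  disappear, and labels other than \<open>q\<close> and \<open>r\<close> are untouched.\<close>

lemma swap_image_iff:
  assumes "v \<noteq> q" shows "v \<in> swap_outside b q r f ` A \<longleftrightarrow> v \<in> f ` A"
proof
  obtain j0 where j0: "j0 \<in> b" "j0 \<in> A" using bne bA by blast
  assume "v \<in> swap_outside b q r f ` A"
  then obtain j where j: "j \<in> A" "swap_outside b q r f j = v" by blast
  show "v \<in> f ` A"
  proof (cases "j \<in> b \<or> (f j \<noteq> q \<and> f j \<noteq> r)")
    case True
    then have "f j = v" using j(2) by (auto simp: swap_outside_def transpose_def split: if_splits)
    then show ?thesis using j(1) by blast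
  next
    case False
    then have "v = r" using j(2) assms by (auto simp: swap_outside_def transpose_def split: if_splits)
    then show ?thesis using j0 fb by blast
  qed
next
  obtain j0 where j0: "j0 \<in> b" "j0 \<in> A" using bne bA by blast
  assume "v \<in> f ` A"
  then obtain j where j: "j \<in> A" "f j = v" by blast
  show "v \<in> swap_outside b q r f ` A"
  proof (cases "v = r")
    case True
    then have "swap_outside b q r f j0 = v" using j0 fb by (simp add: swap_outside_def)
    then show ?thesis using j0 by blast
  next
    case False
    then have "swap_outside b q r f j = v" using assms j by (simp add: swap_outside_def transpose_def)
    then show ?thesis using j by blast
  qed
qed

text \<open>After the swap \<open>q\<close> is a label iff \<open>f\<close> gives the label
  \<open>r\<close> to some element outside \<open>b\<close>, and by the two level lemmas this
  happens iff \<open>q\<close> was no label before. This change of the image by one element reverses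
  the sign.\<close>

lemma swap_image_q: "q \<in> swap_outside b q r f ` A \<longleftrightarrow> q \<notin> f ` A"
proof
  assume "q \<in> swap_outside b q r f ` A"
  then obtain j where j: "j \<in> A" "swap_outside b q r f j = q" by (metis imageE)
  have "j \<notin> b"
  proof
    assume jb: "j \<in> b"
    then have "swap_outside b q r f j = f j" by (simp add: swap_outside_def)
    then have "r = q" using j(2) fb[OF jb] by metis
    with swap_q_less_r show False by (metis less_irrefl)
  qed
  then have "transpose q r (f j) = q" using j(2) by (simp add: swap_outside_def)
  then have "transpose q r (transpose q r (f j)) = transpose q r q" by simp
  then have "f j = r" by simp
  then have "j \<in> {j \<in> A. f j = r}" using j(1) by simp
  then have ne: "{j \<in> A. f j = r} \<noteq> b" using \<open>j \<notin> b\<close> by metis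
  show "q \<notin> f ` A"
  proof
    assume "q \<in> f ` A"
    then obtain i where i: "i \<in> A" "f i = q" by (metis imageE)
    have "{j \<in> A. f j = r} = b"
      by (rule swap_level_between(2)[OF i(1)]) (simp_all add: i(2) swap_q_less_r)
    with ne show False by contradiction
  qed
next
  assume "q \<notin> f ` A"
  with swap_level_q have ne: "{j \<in> A. f j = r} \<noteq> b" by metis
  have sub: "b \<subseteq> {j \<in> A. f j = r}" using bA fb by blast
  obtain j where j: "j \<in> A" "f j = r" "j \<notin> b"
  proof (rule ccontr)
    assume "\<not> thesis"
    with that have "{j \<in> A. f j = r} \<subseteq> b" by blast
    with sub ne show False by (metis subset_antisym)
  qed
  then have "swap_outside b q r f j = q" by (simp add: swap_outside_def)
  then show "q \<in> swap_outside b q r f ` A" using j(1) by (metis imageI)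
qed

text \<open>If \<open>q\<close> is a label after the swap, the elements up to \<open>q\<close> are
  those formerly up to \<open>r\<close> without \<open>b\<close>, and their number is r - card b =
  q. Every other label lies below \<open>q\<close> or is at least \<open>r\<close>, and its
  cumulative count does not change.\<close>

lemma swap_ranked: "ranked A (swap_outside b q r f)"
  unfolding ranked_def
proof
  let ?g = "swap_outside b q r f"
  fix j assume j: "j \<in> A"
  show "card {i \<in> A. ?g i \<le> ?g j} = ?g j"
  proof (cases "?g j = q")
    case True
    then have nq: "q \<notin> f ` A" using swap_image_q j by (metis imageI)
    have no: "\<not> (q \<le> f i \<and> f i < r)" if "i \<in> A" for i
      using swap_level_between(1)[OF that] nq that by blast
    have "{i \<in> A. ?g i \<le> q} = {i \<in> A. f i \<le> r} - b"
    proof (intro equalityI subsetI)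
      fix i assume i: "i \<in> {i \<in> A. ?g i \<le> q}"
      then have "i \<notin> b" using fb[of i] swap_q_less_r by (auto simp: swap_outside_def)
      then show "i \<in> {i \<in> A. f i \<le> r} - b"
        using i swap_q_less_r by (auto simp: swap_outside_def transpose_def split: if_splits)
    next
      fix i assume i: "i \<in> {i \<in> A. f i \<le> r} - b"
      then have "f i = r \<or> f i < q" using no[of i] by auto
      then show "i \<in> {i \<in> A. ?g i \<le> q}"
        using i swap_q_less_r by (auto simp: swap_outside_def transpose_def)
    qed
    moreover have "card ({i \<in> A. f i \<le> r} - b) = r - card b"
      using swap_card_le_r bA fb finite_subset[OF bA finA] by (subst card_Diff_subset) auto
    ultimately show ?thesis using True qr by simp
  next
    case False
    then have "?g j \<in> f ` A" using swap_image_iff[of "?g j"] j by blast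
    then obtain i where i: "i \<in> A" "f i = ?g j" by (metis imageE)
    have out: "?g j < q \<or> r \<le> ?g j"
    proof (rule ccontr)
      assume "\<not> (?g j < q \<or> r \<le> ?g j)"
      then show False using swap_level_between(1)[OF i(1)] i(2) False by simp
    qed
    have "{l \<in> A. ?g l \<le> ?g j} = {l \<in> A. f l \<le> ?g j}"
    proof -
      have "?g l \<le> v \<longleftrightarrow> f l \<le> v" if "v < q \<or> r \<le> v" for l v
        using that swap_q_less_r by (auto simp: swap_outside_def transpose_def)
      then show ?thesis using out by blast
    qed
    moreover have "card {l \<in> A. f l \<le> f i} = f i" using rk i(1) by (simp add: ranked_def)
    ultimately show ?thesis using i(2) by simp
  qed
qed

end

section \<open>The dual function as a sum over marked colourings\<close>

definition ranked_colourings :: "nat \<Rightarrow> nat set \<Rightarrow> (nat \<Rightarrow> nat) \<Rightarrow> (nat \<Rightarrow> nat) set" where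
  "ranked_colourings n R p =
     {f \<in> {1..n} \<rightarrow>\<^sub>E {1..n}. (\<forall>j\<in>{1..n}. f (p j) = f j) \<and> R \<subseteq> f ` {1..n} \<and> ranked {1..n} f}"

lemma finite_ranked_colourings: "finite (ranked_colourings n R p)"
  by (rule finite_subset[of _ "{1..n} \<rightarrow>\<^sub>E {1..n}"]) (auto simp: ranked_colourings_def intro: finite_PiE)

lemma card_filter_content: "card {i \<in> {1..n}. P (f i)} = size (filter_mset P (content n f))"
  by (simp add: content_def filter_mset_image_mset)

lemma card_next_in_le:
  assumes "I \<subseteq> {1..n}" "n \<in> I" "t \<in> I"
  shows "card {i \<in> {1..n}. next_in I i \<le> t} = t"
proof -
  have tn: "t \<le> n" using assms by auto
  have "{i \<in> {1..n}. next_in I i \<le> t} = {1..t}"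
  proof (intro equalityI subsetI)
    fix i assume "i \<in> {i \<in> {1..n}. next_in I i \<le> t}"
    then show "i \<in> {1..t}" using next_in_props(2)[OF assms(2), of i] by auto
  next
    fix i assume "i \<in> {1..t}"
    then show "i \<in> {i \<in> {1..n}. next_in I i \<le> t}" using next_in_le[OF assms(3), of i] tn by auto
  qed
  then show ?thesis by simp
qed

lemma next_in_image:
  assumes "I \<subseteq> {1..n}" "n \<in> I" shows "next_in I ` {1..n} = I"
proof (intro equalityI subsetI)
  fix t assume "t \<in> I"
  then show "t \<in> next_in I ` {1..n}" using next_in_self[of t I] assms(1) by (intro image_eqI[of _ _ t]) auto
next
  fix t assume "t \<in> next_in I ` {1..n}"
  then show "t \<in> I" using next_in_props(1)[OF assms(2)] by auto
qed

text \<open>In the sorted listing of \<open>f\<close>, the values up to a label t occupy exactly the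
  positions 1, ..., t. This forces the value at \<open>j\<close> to be the first label not below
  \<open>j\<close>.\<close>

lemma ranked_content:
  assumes f: "f ` {1..n} \<subseteq> {1..n}" and rk: "ranked {1..n} f" and n: "n \<in> f ` {1..n}"
  shows "content n f = content n (next_in (f ` {1..n}))"
proof -
  let ?I = "f ` {1..n}"
  obtain g where g: "mono_on {1..n} g" "content n g = content n f"
    using mono_on_listing_exists[OF size_content[of n f]] unfolding content_def by blast
  have gI: "g ` {1..n} = ?I" using arg_cong[OF g(2), of set_mset] unfolding set_mset_content .
  have cg: "card {i \<in> {1..n}. g i \<le> t} = t" if t: "t \<in> ?I" for t
  proof -
    obtain j where j: "t = f j" "j \<in> {1..n}" using t by (rule imageE)
    have "card {i \<in> {1..n}. g i \<le> t} = card {i \<in> {1..n}. f i \<le> t}"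
      using card_filter_content[of n "\<lambda>x. x \<le> t" g] card_filter_content[of n "\<lambda>x. x \<le> t" f] g(2)
      by (simp only:)
    also have "\<dots> = t" using rk j(2) unfolding ranked_def j(1) by (rule bspec)
    finally show ?thesis .
  qed
  have gset: "{i \<in> {1..n}. g i \<le> t} = {1..t}" if t: "t \<in> ?I" for t
  proof -
    have down: "i \<in> {i \<in> {1..n}. g i \<le> t}" if "j \<in> {i \<in> {1..n}. g i \<le> t}" "1 \<le> i" "i \<le> j" for i j
    proof -
      have "i \<in> {1..n}" "j \<in> {1..n}" using that by simp_all
      from mono_onD[OF g(1) this that(3)] show ?thesis using that by simp
    qed
    have sub: "{i \<in> {1..n}. g i \<le> t} \<subseteq> {1..t}"
    proof
      fix j assume j: "j \<in> {i \<in> {1..n}. g i \<le> t}"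
      have "{1..j} \<subseteq> {i \<in> {1..n}. g i \<le> t}"
      proof
        fix i assume "i \<in> {1..j}"
        then show "i \<in> {i \<in> {1..n}. g i \<le> t}" by (intro down[OF j]) auto
      qed
      then have "card {1..j} \<le> card {i \<in> {1..n}. g i \<le> t}" by (intro card_mono) auto
      then show "j \<in> {1..t}" using cg[OF t] j by simp
    qed
    show ?thesis by (rule card_subset_eq[OF _ sub]) (simp_all only: cg[OF t] finite_atLeastAtMost card_atLeastAtMost diff_Suc_1)
  qed
  have "g j = next_in ?I j" if j: "j \<in> {1..n}" for j
  proof (rule antisym)
    have p: "next_in ?I j \<in> ?I" "j \<le> next_in ?I j" using next_in_props[OF n, of j] j by auto
    then have "j \<in> {1..next_in ?I j}" using j by simp
    then show "g j \<le> next_in ?I j" unfolding gset[OF p(1), symmetric] by blast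
    have gj: "g j \<in> ?I" using gI j by blast
    have "j \<in> {i \<in> {1..n}. g i \<le> g j}" using j by simp
    then have "j \<le> g j" unfolding gset[OF gj] by simp
    then show "next_in ?I j \<le> g j" by (rule next_in_le[OF gj])
  qed
  then have "content n g = content n (next_in ?I)" by (rule content_cong)
  then show ?thesis using g(2) by simp
qed

text \<open>The colourings for all \<open>T\<close> are thereby gathered in one set, with
  \<open>T\<close> recovered from the image; an involution on this set is free to change
  \<open>T\<close>.\<close>

lemma fixed_colourings_next_in:
  assumes R: "R \<subseteq> {1..n}" "n \<in> R" and T: "T \<subseteq> {1..n} - R"
  shows "fixed_colourings n (content n (next_in (R \<union> T))) p
       = {f \<in> ranked_colourings n R p. f ` {1..n} - R = T}"
proof (intro equalityI subsetI)
  have I: "R \<union> T \<subseteq> {1..n}" "n \<in> R \<union> T" using R T by auto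
  fix f assume "f \<in> fixed_colourings n (content n (next_in (R \<union> T))) p"
  then have f: "f \<in> {1..n} \<rightarrow>\<^sub>E UNIV" "content n f = content n (next_in (R \<union> T))"
    "\<forall>j\<in>{1..n}. f (p j) = f j" by (auto simp: fixed_colourings_def)
  have im: "f ` {1..n} = R \<union> T" using arg_cong[OF f(2), of set_mset] unfolding set_mset_content next_in_image[OF I] .
  have "ranked {1..n} f"
    unfolding ranked_def
  proof
    fix j assume "j \<in> {1..n}"
    then have t: "f j \<in> R \<union> T" using im by blast
    have "card {i \<in> {1..n}. f i \<le> f j} = card {i \<in> {1..n}. next_in (R \<union> T) i \<le> f j}"
      using card_filter_content[of n "\<lambda>x. x \<le> f j" f]
        card_filter_content[of n "\<lambda>x. x \<le> f j" "next_in (R \<union> T)"] f(2)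
      by (simp only:)
    also have "\<dots> = f j" by (rule card_next_in_le[OF I t])
    finally show "card {i \<in> {1..n}. f i \<le> f j} = f j" .
  qed
  moreover have "f \<in> {1..n} \<rightarrow>\<^sub>E {1..n}"
  proof (rule PiE_I)
    fix j assume "j \<in> {1..n}"
    then have "f j \<in> f ` {1..n}" by (rule imageI)
    then show "f j \<in> {1..n}" unfolding im using I(1) by blast
  qed (rule PiE_arb[OF f(1)])
  moreover have "f ` {1..n} - R = T" using im T by blast
  ultimately show "f \<in> {f \<in> ranked_colourings n R p. f ` {1..n} - R = T}"
    using f(3) im by (simp add: ranked_colourings_def)
next
  fix f assume "f \<in> {f \<in> ranked_colourings n R p. f ` {1..n} - R = T}"
  then have f: "f \<in> {1..n} \<rightarrow>\<^sub>E {1..n}" "\<forall>j\<in>{1..n}. f (p j) = f j" "R \<subseteq> f ` {1..n}" "ranked {1..n} f"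
    "f ` {1..n} - R = T" by (simp_all add: ranked_colourings_def)
  have im: "f ` {1..n} = R \<union> T" using f(3,5) by blast
  have "content n f = content n (next_in (f ` {1..n}))"
  proof (rule ranked_content[OF _ f(4)])
    show "f ` {1..n} \<subseteq> {1..n}" using im R T by blast
    show "n \<in> f ` {1..n}" using im R by blast
  qed
  then show "f \<in> fixed_colourings n (content n (next_in (R \<union> T))) p"
    using f(1,2) unfolding im by (auto simp: fixed_colourings_def PiE_def)
qed

text \<open>The function K: the expansion of \<open>block_weight\<close> with every compatibility
  indicator replaced by the induced character that counts it.\<close>

definition block_char :: "nat \<Rightarrow> nat set \<Rightarrow> nat set \<Rightarrow> (int \<Rightarrow> int) \<Rightarrow> int" where
  "block_char n R Bd w = (\<Sum>T\<in>Pow ({1..n} - R). \<Sum>N\<in>Pow R.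
     block_coeff n R Bd T N * signed_fix n (content n (next_in (R \<union> T))) (\<lambda>c. next_in R c \<in> N) w)"

definition block_sign :: "nat \<Rightarrow> nat set \<Rightarrow> nat set \<Rightarrow> (int \<Rightarrow> int) \<Rightarrow> (nat \<Rightarrow> nat) \<Rightarrow> nat \<Rightarrow> int" where
  "block_sign n R Bd w f r =
     (if r \<in> Bd then - 1 else 1) * (\<Prod>j\<in>{j \<in> {1..n}. next_in R (f j) = r}. sign_at w j)"

text \<open>Both factors split over the blocks in \<open>N\<close>, so the sum over \<open>N\<close>
  becomes a product over all blocks, which is annihilated by a single block of sign -1.\<close>

lemma sum_negative_blocks:
  assumes finR: "finite R"
  shows "(\<Sum>N\<in>Pow R. (- 1) ^ card (N \<inter> Bd) *
        (\<Prod>j\<in>{1..n}. if next_in R (f j) \<in> N then sign_at w j else 1))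
     = (\<Prod>r\<in>R. 1 + block_sign n R Bd w f r)"
proof -
  have "(- 1) ^ card (N \<inter> Bd) * (\<Prod>j\<in>{1..n}. if next_in R (f j) \<in> N then sign_at w j else 1)
      = (\<Prod>r\<in>N. block_sign n R Bd w f r)" if "N \<in> Pow R" for N
  proof -
    have finN: "finite N" using that finR finite_subset by blast
    have 1: "(- 1) ^ card (N \<inter> Bd) = (\<Prod>r\<in>N. if r \<in> Bd then - 1 else 1 :: int)"
      using prod.inter_restrict[OF finN, of "\<lambda>_. - 1 :: int" Bd] by simp
    have "(\<Prod>j\<in>{1..n}. if next_in R (f j) \<in> N then sign_at w j else 1)
        = (\<Prod>j\<in>{j \<in> {1..n}. next_in R (f j) \<in> N}. sign_at w j)"
      by (rule prod.inter_filter[symmetric]) simp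
    also have "\<dots> = (\<Prod>r\<in>N. \<Prod>j\<in>{j \<in> {j \<in> {1..n}. next_in R (f j) \<in> N}. next_in R (f j) = r}. sign_at w j)"
      by (rule prod.group[symmetric]) (use finN in auto)
    also have "\<dots> = (\<Prod>r\<in>N. \<Prod>j\<in>{j \<in> {1..n}. next_in R (f j) = r}. sign_at w j)"
    proof (rule prod.cong[OF refl])
      fix r assume "r \<in> N"
      then have "{j \<in> {j \<in> {1..n}. next_in R (f j) \<in> N}. next_in R (f j) = r} = {j \<in> {1..n}. next_in R (f j) = r}"
        by auto
      then show "(\<Prod>j\<in>{j \<in> {j \<in> {1..n}. next_in R (f j) \<in> N}. next_in R (f j) = r}. sign_at w j)
          = (\<Prod>j\<in>{j \<in> {1..n}. next_in R (f j) = r}. sign_at w j)" by (rule arg_cong)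
    qed
    finally show ?thesis unfolding 1 block_sign_def prod.distrib by simp
  qed
  then have "(\<Sum>N\<in>Pow R. (- 1) ^ card (N \<inter> Bd) *
        (\<Prod>j\<in>{1..n}. if next_in R (f j) \<in> N then sign_at w j else 1))
      = (\<Sum>N\<in>Pow R. \<Prod>r\<in>N. block_sign n R Bd w f r)" by (rule sum.cong[OF refl])
  also have "\<dots> = (\<Prod>r\<in>R. 1 + block_sign n R Bd w f r)" by (rule sum_Pow_prod[OF finR])
  finally show ?thesis .
qed

definition marked_colourings :: "nat \<Rightarrow> nat set \<Rightarrow> (nat \<Rightarrow> nat) \<Rightarrow> (nat \<Rightarrow> nat) \<Rightarrow> (nat \<Rightarrow> nat) set" where
  "marked_colourings n R p x = {f \<in> ranked_colourings n R p. \<forall>r\<in>R. f (x r) = r}"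

text \<open>The sums over \<open>T\<close> and over colourings merge into one sum over ranked
  colourings, and the size of the level \<open>r\<close>, which is the last piece of its block, is
  replaced by a marked position \<open>x r\<close> on that level. For fixed marks, only signs and
  block signs remain as weights.\<close>

lemma block_char_eq:
  assumes R: "R \<subseteq> {1..n}" "n \<in> R"
  shows "block_char n R Bd w = (\<Sum>x\<in>R \<rightarrow>\<^sub>E {1..n}. \<Sum>f\<in>marked_colourings n R (abs_perm w) x.
           (- 1) ^ card (f ` {1..n} - R) * (\<Prod>r\<in>R. 1 + block_sign n R Bd w f r))"
proof -
  let ?A = "{1..n}" and ?p = "abs_perm w"
  let ?RC = "ranked_colourings n R ?p"
  let ?z = "\<lambda>f. \<Prod>r\<in>R. 1 + block_sign n R Bd w f r"
  let ?m = "\<lambda>f. int (\<Prod>r\<in>R. card {j \<in> ?A. f j = r})"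
  have finR: "finite R" using R finite_subset by blast
  have inner: "(\<Sum>N\<in>Pow R. block_coeff n R Bd T N *
        signed_fix n (content n (next_in (R \<union> T))) (\<lambda>c. next_in R c \<in> N) w)
      = (\<Sum>f\<in>{f \<in> ?RC. f ` ?A - R = T}. (- 1) ^ card (f ` ?A - R) * ?m f * ?z f)"
    if T: "T \<in> Pow (?A - R)" for T
  proof -
    let ?c = "(- 1) ^ card T * int (\<Prod>r\<in>R. card {j \<in> ?A. next_in (R \<union> T) j = r})"
    let ?F = "fixed_colourings n (content n (next_in (R \<union> T))) ?p"
    have F: "?F = {f \<in> ?RC. f ` ?A - R = T}"
      using fixed_colourings_next_in[OF R] T by simp
    have "(\<Sum>N\<in>Pow R. block_coeff n R Bd T N *
        signed_fix n (content n (next_in (R \<union> T))) (\<lambda>c. next_in R c \<in> N) w)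
      = (\<Sum>N\<in>Pow R. \<Sum>f\<in>?F. ?c * ((- 1) ^ card (N \<inter> Bd) *
          (\<Prod>j\<in>?A. if next_in R (f j) \<in> N then sign_at w j else 1)))"
      unfolding block_coeff_def signed_fix_def sum_distrib_left by (simp only: mult.assoc)
    also have "\<dots> = (\<Sum>f\<in>?F. ?c * (\<Sum>N\<in>Pow R. (- 1) ^ card (N \<inter> Bd) *
          (\<Prod>j\<in>?A. if next_in R (f j) \<in> N then sign_at w j else 1)))"
      by (subst sum.swap) (simp only: sum_distrib_left)
    also have "\<dots> = (\<Sum>f\<in>?F. (- 1) ^ card (f ` ?A - R) * ?m f * ?z f)"
    proof (rule sum.cong[OF refl])
      fix f assume f: "f \<in> ?F"
      then have c: "content n f = content n (next_in (R \<union> T))" by (simp add: fixed_colourings_def)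
      have fT: "f ` ?A - R = T" using f unfolding F by simp
      have "card {j \<in> ?A. next_in (R \<union> T) j = r} = card {j \<in> ?A. f j = r}" for r
        using card_filter_content[of n "\<lambda>y. y = r" f]
          card_filter_content[of n "\<lambda>y. y = r" "next_in (R \<union> T)"] c by (simp only:)
      then have cm: "?c = (- 1) ^ card (f ` ?A - R) * ?m f" unfolding fT by (simp only:)
      show "?c * (\<Sum>N\<in>Pow R. (- 1) ^ card (N \<inter> Bd) *
          (\<Prod>j\<in>?A. if next_in R (f j) \<in> N then sign_at w j else 1))
          = (- 1) ^ card (f ` ?A - R) * ?m f * ?z f"
        unfolding cm sum_negative_blocks[OF finR] ..
    qed
    finally show ?thesis unfolding F .
  qed
  have "block_char n R Bd w
      = (\<Sum>T\<in>Pow (?A - R). \<Sum>f\<in>{f \<in> ?RC. f ` ?A - R = T}. (- 1) ^ card (f ` ?A - R) * ?m f * ?z f)"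
    unfolding block_char_def by (rule sum.cong[OF refl inner])
  also have "\<dots> = (\<Sum>f\<in>?RC. (- 1) ^ card (f ` ?A - R) * ?m f * ?z f)"
  proof (rule sum.group)
    show "(\<lambda>f. f ` ?A - R) ` ?RC \<subseteq> Pow (?A - R)"
    proof (intro image_subsetI PowI)
      fix f assume "f \<in> ?RC"
      then have "f \<in> ?A \<rightarrow>\<^sub>E ?A" by (simp add: ranked_colourings_def)
      then have "f ` ?A \<subseteq> ?A" by (auto dest: PiE_mem)
      then show "f ` ?A - R \<subseteq> ?A - R" by blast
    qed
  qed (simp_all add: finite_ranked_colourings)
  also have "\<dots> = (\<Sum>f\<in>?RC. \<Sum>x\<in>R \<rightarrow>\<^sub>E ?A. if \<forall>r\<in>R. f (x r) = r then (- 1) ^ card (f ` ?A - R) * ?z f else 0)"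
  proof (rule sum.cong[OF refl])
    fix f
    have if_mult: "c * (if e then 1 else 0) = (if e then c else 0)" for c :: int and e by simp
    have finX: "finite (R \<rightarrow>\<^sub>E ?A)" using finR by (intro finite_PiE) auto
    have "(\<Prod>r\<in>R. card {j \<in> ?A. f j = r}) = card (PiE R (\<lambda>r. {j \<in> ?A. f j = r}))"
      using finR by (simp add: card_PiE)
    also have "PiE R (\<lambda>r. {j \<in> ?A. f j = r}) = {x \<in> R \<rightarrow>\<^sub>E ?A. \<forall>r\<in>R. f (x r) = r}"
      unfolding PiE_def Pi_def by blast
    finally have "?m f = (\<Sum>x\<in>R \<rightarrow>\<^sub>E ?A. if \<forall>r\<in>R. f (x r) = r then 1 else 0)"
      using finX by (subst sum.inter_filter[symmetric]) simp_all
    then have "(- 1) ^ card (f ` ?A - R) * ?m f * ?z f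
        = (- 1) ^ card (f ` ?A - R) * ?z f * (\<Sum>x\<in>R \<rightarrow>\<^sub>E ?A. if \<forall>r\<in>R. f (x r) = r then 1 else 0)"
      by (simp only: mult_ac)
    also have "\<dots> = (\<Sum>x\<in>R \<rightarrow>\<^sub>E ?A. (- 1) ^ card (f ` ?A - R) * ?z f * (if \<forall>r\<in>R. f (x r) = r then 1 else 0))"
      by (rule sum_distrib_left)
    also have "\<dots> = (\<Sum>x\<in>R \<rightarrow>\<^sub>E ?A. if \<forall>r\<in>R. f (x r) = r then (- 1) ^ card (f ` ?A - R) * ?z f else 0)"
      unfolding if_mult ..
    finally show "(- 1) ^ card (f ` ?A - R) * ?m f * ?z f
        = (\<Sum>x\<in>R \<rightarrow>\<^sub>E ?A. if \<forall>r\<in>R. f (x r) = r then (- 1) ^ card (f ` ?A - R) * ?z f else 0)" .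
  qed
  also have "\<dots> = (\<Sum>x\<in>R \<rightarrow>\<^sub>E ?A. \<Sum>f\<in>?RC. if \<forall>r\<in>R. f (x r) = r then (- 1) ^ card (f ` ?A - R) * ?z f else 0)"
    by (rule sum.swap)
  also have "\<dots> = (\<Sum>x\<in>R \<rightarrow>\<^sub>E ?A. \<Sum>f\<in>marked_colourings n R ?p x. (- 1) ^ card (f ` ?A - R) * ?z f)"
    unfolding marked_colourings_def
    by (rule sum.cong[OF refl], rule sum.inter_filter[symmetric]) (rule finite_ranked_colourings)
  finally show ?thesis .
qed

section \<open>Cancellation unless every marked orbit fills its block\<close>

text \<open>Otherwise the block, which ends at \<open>r\<close>, would be contained in the
  \<open>l\<close> numbers from q + 1 to \<open>r\<close>.\<close>

lemma block_interval:
  assumes R: "R \<subseteq> {1..n}" "n \<in> R" and r: "r \<in> R" and l: "q + l = r" "l < card (blk n R r)"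
  shows "q \<in> blk n R r"
proof (rule ccontr)
  assume q: "q \<notin> blk n R r"
  have "blk n R r \<subseteq> {q + 1..r}"
  proof
    fix j assume "j \<in> blk n R r"
    then have j: "j \<in> {1..n}" "next_in R j = r" by (simp_all add: blk_def)
    have jr: "j \<le> r" using next_in_props(2)[OF R(2), of j] j by simp
    have "q < j"
    proof (rule ccontr)
      assume "\<not> q < j"
      then have jq: "j \<le> q" by simp
      have rn: "r \<le> n" using R(1) r by auto
      have "next_in R q \<le> r" using r l(1) by (intro next_in_le) auto
      moreover have "next_in R j \<le> next_in R q" using jq l(1) rn by (intro next_in_mono[OF R(2)]) auto
      ultimately have "next_in R q = r" using j by simp
      then have "q \<in> blk n R r" using j jq l(1) rn by (simp add: blk_def)
      then show False using q by contradiction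
    qed
    then show "j \<in> {q + 1..r}" using jr by simp
  qed
  then have "card (blk n R r) \<le> card {q + 1..r}" by (intro card_mono) simp_all
  then show False using l by simp
qed

text \<open>The content of \<open>f\<close> is that of some refinement of the blocks, and merging
  the pieces of a refinement restores the block sizes.\<close>

lemma ranked_colouring_block_card:
  assumes R: "R \<subseteq> {1..n}" "n \<in> R" and f: "f \<in> ranked_colourings n R p"
  shows "card {j \<in> {1..n}. next_in R (f j) = r} = card (blk n R r)"
proof -
  let ?T = "f ` {1..n} - R"
  have fA: "f \<in> {1..n} \<rightarrow>\<^sub>E {1..n}" using f by (simp add: ranked_colourings_def)
  then have "f ` {1..n} \<subseteq> {1..n}" by (auto dest: PiE_mem)
  then have T: "?T \<subseteq> {1..n} - R" by blast
  have "f \<in> fixed_colourings n (content n (next_in (R \<union> ?T))) p"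
    unfolding fixed_colourings_next_in[OF R T] using f by simp
  then have c: "content n f = content n (next_in (R \<union> ?T))" by (simp add: fixed_colourings_def)
  have "content n (\<lambda>j. next_in R (f j)) = content n (\<lambda>j. next_in R (next_in (R \<union> ?T) j))"
    unfolding content_comp[of n "next_in R" f] content_comp[of n "next_in R" "next_in (R \<union> ?T)"] c ..
  also have "\<dots> = content n (next_in R)"
    by (rule content_cong, rule next_in_next_in[OF R(2)]) auto
  finally have "content n (\<lambda>j. next_in R (f j)) = content n (next_in R)" .
  then show ?thesis
    using card_filter_content[of n "\<lambda>y. y = r" "\<lambda>j. next_in R (f j)"]
      card_filter_content[of n "\<lambda>y. y = r" "next_in R"] unfolding blk_def by (simp only:)
qed

lemma sum_sign_reversing:
  fixes h :: "'b \<Rightarrow> int"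
  assumes "\<And>f. f \<in> S \<Longrightarrow> \<Phi> f \<in> S" "\<And>f. f \<in> S \<Longrightarrow> \<Phi> (\<Phi> f) = f" "\<And>f. f \<in> S \<Longrightarrow> h (\<Phi> f) = - h f"
  shows "sum h S = 0"
proof -
  have "sum h S = (\<Sum>f\<in>S. - h f)"
    by (rule sum.reindex_bij_witness[of _ \<Phi> \<Phi>]) (simp_all add: assms)
  then show ?thesis by (simp add: sum_negf)
qed

text \<open>The orbit b of the marked point lies on level \<open>r\<close>. If it does not fill the
  block, then q = r - card b is an inner point of that block. Swapping \<open>q\<close> and
  \<open>r\<close> outside b adds or removes \<open>q\<close> in the image and so reverses the sign.
  It keeps all marks, and it keeps the block to which each colour belongs, hence all block
  signs.\<close>

lemma marked_sum_eq_0: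
  assumes w: "w \<in> signed_perms n" and R: "R \<subseteq> {1..n}" "n \<in> R" and x: "x \<in> R \<rightarrow>\<^sub>E {1..n}"
    and r: "r \<in> R" and ne: "card (orbit (abs_perm w) (x r)) \<noteq> card (blk n R r)"
  shows "(\<Sum>f\<in>marked_colourings n R (abs_perm w) x.
           (- 1) ^ card (f ` {1..n} - R) * (\<Prod>r\<in>R. 1 + block_sign n R Bd w f r)) = 0"
proof (cases "marked_colourings n R (abs_perm w) x = {}")
  case False
  let ?A = "{1..n}" and ?p = "abs_perm w" and ?b = "orbit (abs_perm w) (x r)"
  let ?X = "marked_colourings n R ?p x"
  define b where "b = ?b"
  have xr: "x r \<in> ?A" using x r by (rule PiE_mem)
  have pp: "?p permutes ?A" by (rule abs_perm_permutes[OF w])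
  have bA: "b \<subseteq> ?A" unfolding b_def by (rule permutes_orbit_subset[OF pp xr])
  have xb: "x r \<in> b" unfolding b_def by (rule permutation_self_in_orbit[OF permutation_abs_perm[OF w]])
  then have bne: "b \<noteq> {}" by blast
  have finb: "finite b" using bA finite_subset by blast
  have pb: "?p j \<in> b \<longleftrightarrow> j \<in> b" for j
  proof
    assume "j \<in> b" then show "?p j \<in> b" unfolding b_def by (rule orbit.step)
  next
    assume "?p j \<in> b"
    then have "orbit ?p (?p j) = b"
      unfolding b_def by (rule orbit_eq_if_mem[OF permutation_abs_perm[OF w]])
    moreover have "orbit ?p (?p j) = orbit ?p j"
      by (rule orbit_eq_if_mem[OF permutation_abs_perm[OF w] orbit.base])
    moreover have "j \<in> orbit ?p j" by (rule permutation_self_in_orbit[OF permutation_abs_perm[OF w]])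
    ultimately show "j \<in> b" by simp
  qed
  have RC: "f \<in> ?A \<rightarrow>\<^sub>E ?A" "\<And>j. j \<in> ?A \<Longrightarrow> f (?p j) = f j" "ranked ?A f"
    "\<And>r'. r' \<in> R \<Longrightarrow> f (x r') = r'" "f \<in> ranked_colourings n R ?p" if "f \<in> ?X" for f
    using that unfolding marked_colourings_def ranked_colourings_def by auto
  have fb: "f j = r" if f: "f \<in> ?X" and j: "j \<in> b" for f j
  proof -
    have "f j = f (x r)"
      by (rule fixed_colouring_const_on_orbit[where f = f, OF w _ xr j[unfolded b_def]]) (rule RC(2)[OF f])
    then show ?thesis using RC(4)[OF f r] by simp
  qed
  obtain f0 where f0: "f0 \<in> ?X" using False by blast
  have "b \<subseteq> {j \<in> ?A. next_in R (f0 j) = r}"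
  proof
    fix j assume j: "j \<in> b"
    then show "j \<in> {j \<in> ?A. next_in R (f0 j) = r}"
      using fb[OF f0 j] next_in_self[OF r] bA by auto
  qed
  then have "card b \<le> card {j \<in> ?A. next_in R (f0 j) = r}" by (intro card_mono) simp_all
  then have lt: "card b < card (blk n R r)"
    using ranked_colouring_block_card[OF R RC(5)[OF f0], of r] ne unfolding b_def by simp
  have "card (blk n R r) \<le> r"
  proof -
    have "blk n R r \<subseteq> {1..r}" using next_in_props(2)[OF R(2)] by (auto simp: blk_def)
    then have "card (blk n R r) \<le> card {1..r}" by (intro card_mono) simp_all
    then show ?thesis by simp
  qed
  then obtain q where q: "q + card b = r" using lt by (metis le_add_diff_inverse2 less_imp_le_nat order_trans)
  have "q \<in> blk n R r" by (rule block_interval[OF R r q lt])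
  then have qA: "q \<ge> 1" "q \<le> n" and qn: "next_in R q = r" by (simp_all add: blk_def)
  have "card b > 0" using finb bne by (simp add: card_gt_0_iff)
  then have qr: "q < r" using q by simp
  \<comment> \<open>As \<open>q\<close> is not in \<open>R\<close>, its presence in the image is
    counted by the exponent of the sign.\<close>
  have qR: "q \<notin> R" using next_in_self[of q R] qn qr by auto
  have rn: "next_in R r = r" by (rule next_in_self[OF r])
  have rA: "r \<in> ?A" using R r by blast
  define \<Phi> where "\<Phi> f = restrict (swap_outside b q r f) ?A" for f
  have finA: "finite ?A" by simp
  show ?thesis
  proof (rule sum_sign_reversing[where \<Phi> = \<Phi>])
    fix f assume f: "f \<in> ?X"
    note sw = finA RC(3)[OF f] bA bne fb[OF f] q qA(1)
    let ?g = "swap_outside b q r f"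
    have im: "\<Phi> f ` ?A = ?g ` ?A" by (simp add: \<Phi>_def)
    have gin: "?g j \<in> ?A" if "j \<in> ?A" for j
    proof -
      have "f j \<in> ?A" using RC(1)[OF f] that by (rule PiE_mem)
      then show ?thesis using rA qA by (auto simp: swap_outside_def transpose_def)
    qed
    have gx: "?g (x r') = r'" if r': "r' \<in> R" for r'
    proof (cases "r' = r")
      case True
      then show ?thesis using xb RC(4)[OF f r] by (simp add: swap_outside_def)
    next
      case False
      then have "r' \<noteq> q" using qR r' by blast
      then show ?thesis using RC(4)[OF f r'] False by (simp add: swap_outside_def transpose_def)
    qed
    show "\<Phi> f \<in> ?X"
      unfolding marked_colourings_def ranked_colourings_def
    proof (intro CollectI conjI ballI)
      show "\<Phi> f \<in> ?A \<rightarrow>\<^sub>E ?A" unfolding \<Phi>_def restrict_PiE_iff using gin by blast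
      show "\<Phi> f (?p j) = \<Phi> f j" if j: "j \<in> ?A" for j
      proof -
        have "?p j \<in> ?A" using permutes_in_image[OF pp] j by blast
        then show ?thesis using RC(2)[OF f j] pb[of j] j by (simp add: \<Phi>_def swap_outside_def)
      qed
      show "R \<subseteq> \<Phi> f ` ?A"
      proof
        fix r' assume r': "r' \<in> R"
        have "x r' \<in> ?A" using x r' by (rule PiE_mem)
        then have "?g (x r') \<in> ?g ` ?A" by (rule imageI)
        then show "r' \<in> \<Phi> f ` ?A" unfolding im gx[OF r'] .
      qed
      have "ranked ?A ?g" by (rule swap_ranked[OF sw])
      then show "ranked ?A (\<Phi> f)" by (simp add: ranked_def \<Phi>_def cong: conj_cong)
      show "\<Phi> f (x r') = r'" if r': "r' \<in> R" for r'
      proof -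
        have "x r' \<in> ?A" using x r' by (rule PiE_mem)
        then show ?thesis using gx[OF r'] by (simp add: \<Phi>_def)
      qed
    qed
    show "\<Phi> (\<Phi> f) = f"
    proof (rule extensionalityI[of _ ?A])
      show "f \<in> extensional ?A" using RC(1)[OF f] by (simp add: PiE_def)
      fix j assume "j \<in> ?A"
      then show "\<Phi> (\<Phi> f) j = f j" by (simp add: \<Phi>_def swap_outside_def)
    qed (simp add: \<Phi>_def)
    have z: "block_sign n R Bd w (\<Phi> f) r' = block_sign n R Bd w f r'" for r'
    proof -
      have "next_in R (\<Phi> f j) = next_in R (f j)" if "j \<in> ?A" for j
        using that qn rn by (auto simp: \<Phi>_def swap_outside_def transpose_def)
      then have "{j \<in> ?A. next_in R (\<Phi> f j) = r'} = {j \<in> ?A. next_in R (f j) = r'}" by auto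
      then show ?thesis unfolding block_sign_def by (simp only:)
    qed
    have gi: "v \<in> ?g ` ?A \<longleftrightarrow> v \<in> f ` ?A" if "v \<noteq> q" for v
      by (rule swap_image_iff[OF sw that])
    have gq: "q \<in> ?g ` ?A \<longleftrightarrow> q \<notin> f ` ?A" by (rule swap_image_q[OF sw])
    have gen: "G - R = insert q (H - R)" if "\<And>v. v \<noteq> q \<Longrightarrow> v \<in> G \<longleftrightarrow> v \<in> H" "q \<in> G" for G H
      using that qR by (intro set_eqI) (metis Diff_iff insert_iff)
    have fin: "finite (h ` ?A - R)" for h :: "nat \<Rightarrow> nat" by simp
    have sgn: "(- 1 :: int) ^ card (\<Phi> f ` ?A - R) = - ((- 1) ^ card (f ` ?A - R))"
    proof (cases "q \<in> f ` ?A")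
      case True
      have "f ` ?A - R = insert q (\<Phi> f ` ?A - R)"
        unfolding im by (rule gen[OF _ True]) (rule gi[symmetric])
      moreover have "q \<notin> \<Phi> f ` ?A - R" unfolding im using gq True by blast
      ultimately have "card (f ` ?A - R) = Suc (card (\<Phi> f ` ?A - R))" using fin by simp
      then show ?thesis by simp
    next
      case nq: False
      then have q_in: "q \<in> ?g ` ?A" using gq by blast
      have "\<Phi> f ` ?A - R = insert q (f ` ?A - R)"
        unfolding im by (rule gen[OF _ q_in]) (rule gi)
      moreover have "q \<notin> f ` ?A - R" using nq by blast
      ultimately have "card (\<Phi> f ` ?A - R) = Suc (card (f ` ?A - R))" using fin by simp
      then show ?thesis by simp
    qed
    show "(- 1) ^ card (\<Phi> f ` ?A - R) * (\<Prod>r\<in>R. 1 + block_sign n R Bd w (\<Phi> f) r)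
        = - ((- 1) ^ card (f ` ?A - R) * (\<Prod>r\<in>R. 1 + block_sign n R Bd w f r))"
      unfolding z sgn by simp
  qed
qed simp

text \<open>The blocks are realised by distinct orbits of the right size and sign, with starting
  points \<open>x r\<close>. That these orbits exhaust all positions follows from the sizes.\<close>

definition cycles_match :: "nat \<Rightarrow> nat set \<Rightarrow> nat set \<Rightarrow> (int \<Rightarrow> int) \<Rightarrow> (nat \<Rightarrow> nat) \<Rightarrow> bool" where
  "cycles_match n R Bd w x \<longleftrightarrow>
     (\<forall>r\<in>R. x r \<in> {1..n} \<and> card (orbit (abs_perm w) (x r)) = card (blk n R r) \<and>
        orbit_sign w (orbit (abs_perm w) (x r)) = (if r \<in> Bd then - 1 else 1)) \<and>
     (\<forall>r\<in>R. \<forall>s\<in>R. r \<noteq> s \<longrightarrow> orbit (abs_perm w) (x r) \<noteq> orbit (abs_perm w) (x s))"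

text \<open>Some choice of marks has a nonzero sum, so by \<open>marked_sum_eq_0\<close> all marked
  orbits fill their blocks. In this sum some colouring has no vanishing factor, so all its block
  signs are 1, and this fixes the orbit signs.\<close>

lemma block_char_nonzero_imp_match:
  assumes w: "w \<in> signed_perms n" and R: "R \<subseteq> {1..n}" "n \<in> R" and nz: "block_char n R Bd w \<noteq> 0"
  obtains x where "cycles_match n R Bd w x"
proof -
  let ?p = "abs_perm w" and ?A = "{1..n}"
  let ?h = "\<lambda>f. (- 1) ^ card (f ` ?A - R) * (\<Prod>r\<in>R. 1 + block_sign n R Bd w f r)"
  have finR: "finite R" using R finite_subset by blast
  have "(\<Sum>x\<in>R \<rightarrow>\<^sub>E ?A. sum ?h (marked_colourings n R ?p x)) \<noteq> 0"
    using nz unfolding block_char_eq[OF R] .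
  then obtain x where x: "x \<in> R \<rightarrow>\<^sub>E ?A" "sum ?h (marked_colourings n R ?p x) \<noteq> 0"
    by (rule sum.not_neutral_contains_not_neutral)
  from x(2) obtain f where f: "f \<in> marked_colourings n R ?p x" "?h f \<noteq> 0"
    by (rule sum.not_neutral_contains_not_neutral)
  have fRC: "f \<in> ranked_colourings n R ?p" and fx: "\<And>r. r \<in> R \<Longrightarrow> f (x r) = r"
    using f(1) by (auto simp: marked_colourings_def)
  have fp: "f (?p j) = f j" if "j \<in> ?A" for j using fRC that by (simp add: ranked_colourings_def)
  have xA: "x r \<in> ?A" if "r \<in> R" for r using x(1) that by (rule PiE_mem)
  have size: "card (orbit ?p (x r)) = card (blk n R r)" if "r \<in> R" for r
    using marked_sum_eq_0[OF w R x(1) that] x(2) by blast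
  have orb: "f j = r" if "r \<in> R" "j \<in> orbit ?p (x r)" for r j
  proof -
    have "f j = f (x r)"
      by (rule fixed_colouring_const_on_orbit[where f = f, OF w _ xA[OF that(1)] that(2)]) (rule fp)
    then show ?thesis using fx[OF that(1)] by simp
  qed
  have self: "x r \<in> orbit ?p (x r)" for r
    by (rule permutation_self_in_orbit[OF permutation_abs_perm[OF w]])
  have sgn: "orbit_sign w (orbit ?p (x r)) = (if r \<in> Bd then - 1 else 1)" if r: "r \<in> R" for r
  proof -
    have sub: "orbit ?p (x r) \<subseteq> {j \<in> ?A. next_in R (f j) = r}"
    proof
      fix j assume j: "j \<in> orbit ?p (x r)"
      have "j \<in> ?A" using permutes_orbit_subset[OF abs_perm_permutes[OF w] xA[OF r]] j by blast
      then show "j \<in> {j \<in> ?A. next_in R (f j) = r}" using orb[OF r j] next_in_self[OF r] by simp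
    qed
    have "orbit ?p (x r) = {j \<in> ?A. next_in R (f j) = r}"
    proof (rule card_subset_eq[OF _ sub])
      show "card (orbit ?p (x r)) = card {j \<in> ?A. next_in R (f j) = r}"
        unfolding size[OF r] ranked_colouring_block_card[OF R fRC] ..
    qed simp
    then have z: "block_sign n R Bd w f r = (if r \<in> Bd then - 1 else 1) * orbit_sign w (orbit ?p (x r))"
      unfolding block_sign_def orbit_sign_def by (simp only:)
    have "(\<Prod>r\<in>R. 1 + block_sign n R Bd w f r) \<noteq> 0" using f(2) by auto
    then have "1 + block_sign n R Bd w f r \<noteq> 0" using finR r by auto
    then show ?thesis using z orbit_sign_cases[of w "orbit ?p (x r)"] by (auto split: if_splits)
  qed
  have "orbit ?p (x r) \<noteq> orbit ?p (x s)" if "r \<in> R" "s \<in> R" "r \<noteq> s" for r s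
  proof
    assume "orbit ?p (x r) = orbit ?p (x s)"
    then have "f (x r) = s" using orb[OF that(2)] self[of r] by simp
    then show False using fx[OF that(1)] that(3) by simp
  qed
  then have "cycles_match n R Bd w x"
    unfolding cycles_match_def using xA size sgn by blast
  then show ?thesis by (rule that)
qed

section \<open>Conjugacy\<close>

lemma funpow_conj:
  assumes "bij v" shows "(v \<circ> u \<circ> inv v) ^^ k = v \<circ> (u ^^ k) \<circ> inv v"
proof (induction k)
  case 0
  then show ?case using assms by (simp add: fun_eq_iff bij_is_surj surj_f_inv_f)
next
  case (Suc k)
  have "inv v (v y) = y" for y using assms by (simp add: bij_is_inj)
  then show ?case using Suc by (simp add: fun_eq_iff)
qed

lemma root_count_conj:
  assumes u: "u \<in> signed_perms n" and v: "v \<in> signed_perms n"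
  shows "root_count n k (v \<circ> u \<circ> inv v) = root_count n k u"
proof -
  have bv: "bij v" by (rule permutes_bij[OF signed_perms_permutes[OF v]])
  have iv: "inv v \<in> signed_perms n" by (rule signed_perms_inv[OF v])
  have e1: "inv v (v y) = y" and e2: "v (inv v y) = y" for y
    using bv by (simp_all add: bij_is_inj bij_is_surj surj_f_inv_f)
  have "bij_betw (\<lambda>y. v \<circ> y \<circ> inv v) {y \<in> signed_perms n. y ^^ k = u}
      {y \<in> signed_perms n. y ^^ k = v \<circ> u \<circ> inv v}"
  proof (rule bij_betw_byWitness[where f' = "\<lambda>y. inv v \<circ> y \<circ> v"])
    show "(\<lambda>y. inv v \<circ> y \<circ> v) ` {y \<in> signed_perms n. y ^^ k = v \<circ> u \<circ> inv v}
        \<subseteq> {y \<in> signed_perms n. y ^^ k = u}"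
    proof (intro image_subsetI CollectI conjI)
      fix y assume "y \<in> {y \<in> signed_perms n. y ^^ k = v \<circ> u \<circ> inv v}"
      then have y: "y \<in> signed_perms n" "y ^^ k = v \<circ> u \<circ> inv v" by simp_all
      show "inv v \<circ> y \<circ> v \<in> signed_perms n" by (intro signed_perms_comp iv v y(1))
      have "(inv v \<circ> y \<circ> v) ^^ k = inv v \<circ> (y ^^ k) \<circ> v"
        using funpow_conj[OF bij_imp_bij_inv[OF bv], where u = y and k = k] by (simp only: inv_inv_eq[OF bv])
      then show "(inv v \<circ> y \<circ> v) ^^ k = u" unfolding y(2) by (simp add: fun_eq_iff e1)
    qed
    show "(\<lambda>y. v \<circ> y \<circ> inv v) ` {y \<in> signed_perms n. y ^^ k = u}
        \<subseteq> {y \<in> signed_perms n. y ^^ k = v \<circ> u \<circ> inv v}"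
    proof (intro image_subsetI CollectI conjI)
      fix y assume "y \<in> {y \<in> signed_perms n. y ^^ k = u}"
      then have y: "y \<in> signed_perms n" "y ^^ k = u" by simp_all
      show "v \<circ> y \<circ> inv v \<in> signed_perms n" by (intro signed_perms_comp iv v y(1))
      show "(v \<circ> y \<circ> inv v) ^^ k = v \<circ> u \<circ> inv v" unfolding funpow_conj[OF bv] y(2) ..
    qed
  qed (simp_all add: fun_eq_iff e1 e2)
  then show ?thesis unfolding root_count_def by (simp add: bij_betw_same_card)
qed

lemma class_function_root_count: "class_function n (root_count n k)"
  unfolding class_function_def using root_count_conj by blast

section \<open>Straightening a signed permutation along the blocks\<close>

text \<open>Counted from 0, so that it serves as the exponent of \<open>w\<close> along a
  cycle.\<close>

definition block_pos :: "nat \<Rightarrow> nat set \<Rightarrow> nat \<Rightarrow> nat" where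
  "block_pos n R j = card {i \<in> blk n R (next_in R j). i < j}"

lemma block_pos_less:
  assumes "j \<in> {1..n}" shows "block_pos n R j < card (blk n R (next_in R j))"
  unfolding block_pos_def
proof (rule psubset_card_mono)
  show "finite (blk n R (next_in R j))" by (simp add: blk_def)
  show "{i \<in> blk n R (next_in R j). i < j} \<subset> blk n R (next_in R j)" using assms by (auto simp: blk_def)
qed

lemma block_pos_strict:
  assumes "i \<in> {1..n}" "j \<in> {1..n}" "next_in R i = next_in R j" "i < j"
  shows "block_pos n R i < block_pos n R j"
  unfolding block_pos_def
proof (rule psubset_card_mono)
  show "finite {l \<in> blk n R (next_in R j). l < j}" by (simp add: blk_def)
  have "i \<in> blk n R (next_in R j)" using assms(1,3) by (simp only: blk_def mem_Collect_eq)
  then show "{l \<in> blk n R (next_in R i). l < i} \<subset> {l \<in> blk n R (next_in R j). l < j}"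
    unfolding assms(3) using assms(4) by auto
qed

lemma block_pos_Suc:
  assumes R: "n \<in> R" and j: "j \<in> {1..<n}" "j \<notin> R"
  shows "next_in R (Suc j) = next_in R j" "block_pos n R (Suc j) = Suc (block_pos n R j)"
proof -
  show nx: "next_in R (Suc j) = next_in R j" using next_in_Suc_eq_iff[OF R, of j] j by simp
  have "{i \<in> blk n R (next_in R j). i < Suc j} = insert j {i \<in> blk n R (next_in R j). i < j}"
    using j(1) by (auto simp: blk_def)
  moreover have "finite {i \<in> blk n R (next_in R j). i < j}" by (simp add: blk_def)
  ultimately show "block_pos n R (Suc j) = Suc (block_pos n R j)" unfolding block_pos_def nx by simp
qed

lemma block_pos_last:
  assumes R: "R \<subseteq> {1..n}" "n \<in> R" and r: "r \<in> R"
  shows "Suc (block_pos n R r) = card (blk n R r)"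
proof -
  have nr: "next_in R r = r" by (rule next_in_self[OF r])
  have "j \<le> r" if "j \<in> blk n R r" for j
    using that next_in_props(2)[OF R(2), of j] by (auto simp: blk_def)
  then have "blk n R r = insert r {i \<in> blk n R r. i < r}" using blk_self[OF R(1) r] by (auto simp: le_less)
  moreover have "finite {i \<in> blk n R r. i < r}" by (simp add: blk_def)
  ultimately have "card (blk n R r) = Suc (card {i \<in> blk n R r. i < r})" by (metis card_insert_disjoint less_irrefl mem_Collect_eq)
  then show ?thesis unfolding block_pos_def nr by simp
qed

lemma block_first:
  assumes R: "R \<subseteq> {1..n}" "n \<in> R" and r: "r \<in> R"
  obtains j where "j \<in> {1..n}" "next_in R j = r" "block_pos n R j = 0"
proof -
  have fin: "finite (blk n R r)" by (simp add: blk_def)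
  have ne: "blk n R r \<noteq> {}" using blk_self[OF R(1) r] by blast
  let ?j = "Min (blk n R r)"
  have j: "?j \<in> blk n R r" by (rule Min_in[OF fin ne])
  then have j': "?j \<in> {1..n}" "next_in R ?j = r" by (simp_all add: blk_def)
  have "{i \<in> blk n R r. i < ?j} = {}"
  proof -
    have "\<not> i < ?j" if "i \<in> blk n R r" for i using Min_le[OF fin that] by simp
    then show ?thesis by blast
  qed
  then have "block_pos n R ?j = 0" unfolding block_pos_def j'(2) by (metis card.empty)
  with j' show ?thesis by (rule that)
qed

text \<open>While \<open>j\<close> runs through the block of \<open>r\<close>, its image runs along
  the orbit of \<open>x r\<close>. The absolute values are distinct because different blocks use
  different orbits and a block is as long as its orbit.\<close>

lemma block_straightening:
  assumes w: "w \<in> signed_perms n" and R: "R \<subseteq> {1..n}" "n \<in> R" and m: "cycles_match n R Bd w x"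
  obtains \<phi> where "\<phi> \<in> signed_perms n"
    "\<And>j. j \<in> {1..n} \<Longrightarrow> \<phi> (int j) = (w ^^ block_pos n R j) (int (x (next_in R j)))"
proof -
  let ?p = "abs_perm w" and ?A = "{1..n}"
  define p where "p j = (if j \<in> ?A then (?p ^^ block_pos n R j) (x (next_in R j)) else j)" for j
  define N where "N = {j \<in> ?A. sign_at (w ^^ block_pos n R j) (x (next_in R j)) = - 1}"
  have nR: "next_in R j \<in> R" if "j \<in> ?A" for j using that next_in_props(1)[OF R(2)] by simp
  have xA: "x r \<in> ?A" and size: "card (orbit ?p (x r)) = card (blk n R r)" if "r \<in> R" for r
    using m that unfolding cycles_match_def by blast+
  have pw: "permutation ?p" by (rule permutation_abs_perm[OF w])
  have orb: "(?p ^^ t) y \<in> orbit ?p y" for t y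
    using permutation_self_in_orbit[OF pw, of y] by (rule funpow_in_orbit)
  have inj: "inj_on p ?A"
  proof (rule inj_onI)
    fix i j assume ij: "i \<in> ?A" "j \<in> ?A" "p i = p j"
    let ?r = "next_in R i" and ?s = "next_in R j"
    have eq: "(?p ^^ block_pos n R i) (x ?r) = (?p ^^ block_pos n R j) (x ?s)"
      using ij by (simp add: p_def)
    have "orbit ?p (x ?r) = orbit ?p (x ?s)"
      using orbit_eq_if_mem[OF pw orb[of "block_pos n R i" "x ?r"]]
        orbit_eq_if_mem[OF pw orb[of "block_pos n R j" "x ?s"]] eq by simp
    then have rs: "?r = ?s" using m nR[OF ij(1)] nR[OF ij(2)] unfolding cycles_match_def by blast
    have li: "block_pos n R i < card (orbit ?p (x ?r))"
      unfolding size[OF nR[OF ij(1)]] by (rule block_pos_less[OF ij(1)])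
    have lj: "block_pos n R j < card (orbit ?p (x ?r))"
      unfolding size[OF nR[OF ij(1)]] unfolding rs by (rule block_pos_less[OF ij(2)])
    have "(?p ^^ block_pos n R i) (x ?r) = (?p ^^ block_pos n R j) (x ?r)" using eq unfolding rs .
    from inj_onD[OF orbit_card_funpow(3)[OF pw refl] this]
    have "block_pos n R i = block_pos n R j" using li lj by simp
    then show "i = j"
      using block_pos_strict[OF ij(1,2) rs] block_pos_strict[OF ij(2,1) rs[symmetric]] by (metis less_irrefl linorder_neqE_nat)
  qed
  have into: "p ` ?A \<subseteq> ?A"
  proof (intro image_subsetI)
    fix j assume j: "j \<in> ?A"
    then show "p j \<in> ?A" using funpow_in[OF abs_perm_permutes[OF w] xA[OF nR[OF j]]] by (simp add: p_def)
  qed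
  have "bij_betw p ?A ?A" unfolding bij_betw_def using inj endo_inj_surj[OF _ into inj] by simp
  then have pp: "p permutes ?A" by (rule bij_imp_permutes) (auto simp: p_def)
  have NA: "N \<subseteq> ?A" by (auto simp: N_def)
  show ?thesis
  proof (rule that[of "make_signed p N"])
    show "make_signed p N \<in> signed_perms n" by (rule make_signed_in_signed_perms[OF pp NA])
    fix j assume j: "j \<in> ?A"
    let ?t = "block_pos n R j" and ?y = "x (next_in R j)"
    have "make_signed p N (int j) = (if j \<in> N then - 1 else 1) * int (p j)"
      using signed_value[of "make_signed p N" j] sign_at_make_signed[OF pp j] abs_perm_make_signed[OF pp] by simp
    also have "(if j \<in> N then - 1 else 1) = sign_at (w ^^ ?t) ?y"
      using j sign_at_cases[of "w ^^ ?t" ?y] by (auto simp: N_def)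
    also have "int (p j) = int (abs_perm (w ^^ ?t) ?y)"
      using j by (simp add: p_def abs_perm_funpow[OF w])
    finally show "make_signed p N (int j) = (w ^^ ?t) (int ?y)" using signed_value[of "w ^^ ?t" ?y] by simp
  qed
qed

text \<open>After straightening, both elements become the same model: advance inside a block, and
  return from its end to its start, with a minus sign for blocks in \<open>Bd\<close>. Hence the
  quotient of the two straightening maps conjugates one into the other.\<close>

lemma match_imp_conj:
  assumes w: "w \<in> signed_perms n" and w': "w' \<in> signed_perms n" and R: "R \<subseteq> {1..n}" "n \<in> R"
    and m: "cycles_match n R Bd w x" and m': "cycles_match n R Bd w' x'"
  obtains v where "v \<in> signed_perms n" "w' = v \<circ> w \<circ> inv v"
proof -
  let ?A = "{1..n}"
  obtain \<phi> where \<phi>: "\<phi> \<in> signed_perms n"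
    "\<And>j. j \<in> ?A \<Longrightarrow> \<phi> (int j) = (w ^^ block_pos n R j) (int (x (next_in R j)))"
    using block_straightening[OF w R m] by blast
  obtain \<psi> where \<psi>: "\<psi> \<in> signed_perms n"
    "\<And>j. j \<in> ?A \<Longrightarrow> \<psi> (int j) = (w' ^^ block_pos n R j) (int (x' (next_in R j)))"
    using block_straightening[OF w' R m'] by blast
  define v where "v = \<psi> \<circ> inv \<phi>"
  have b\<phi>: "bij \<phi>" by (rule permutes_bij[OF signed_perms_permutes[OF \<phi>(1)]])
  have v: "v \<in> signed_perms n"
    unfolding v_def by (intro signed_perms_comp \<psi>(1) signed_perms_inv[OF \<phi>(1)])
  have v\<phi>: "v (\<phi> i) = \<psi> i" for i using b\<phi> by (simp add: v_def bij_is_inj)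
  \<comment> \<open>The model action depends on \<open>R\<close> and \<open>Bd\<close> only;
    \<open>j0\<close> is the first position of the block that ends at \<open>j\<close>.\<close>
  have step: "u (\<theta> (int j)) = (if j \<in> R then (if j \<in> Bd then - \<theta> (int j0) else \<theta> (int j0)) else \<theta> (int (Suc j)))"
    if u: "u \<in> signed_perms n" and mu: "cycles_match n R Bd u y"
      and \<theta>: "\<And>j. j \<in> ?A \<Longrightarrow> \<theta> (int j) = (u ^^ block_pos n R j) (int (y (next_in R j)))"
      and j: "j \<in> ?A" and j0: "j \<in> R \<Longrightarrow> j0 \<in> ?A \<and> next_in R j0 = j \<and> block_pos n R j0 = 0"
    for u y j j0 and \<theta> :: "int \<Rightarrow> int"
  proof (cases "j \<in> R")
    case True
    note nj = next_in_self[OF True]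
    have "u (\<theta> (int j)) = (u ^^ Suc (block_pos n R j)) (int (y j))" using \<theta>[OF j] nj by simp
    also have "Suc (block_pos n R j) = card (orbit (abs_perm u) (y j))"
      using block_pos_last[OF R True] mu True by (simp add: cycles_match_def)
    also have "(u ^^ card (orbit (abs_perm u) (y j))) (int (y j))
        = orbit_sign u (orbit (abs_perm u) (y j)) * int (y j)"
      by (rule signed_funpow_orbit[OF u]) simp
    also have "orbit_sign u (orbit (abs_perm u) (y j)) = (if j \<in> Bd then - 1 else 1)"
      using mu True by (simp add: cycles_match_def)
    finally have "u (\<theta> (int j)) = (if j \<in> Bd then - 1 else 1) * int (y j)" .
    moreover have "\<theta> (int j0) = int (y j)" using \<theta>[of j0] j0[OF True] by simp
    ultimately show ?thesis using True by simp
  next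
    case False
    then have "j \<noteq> n" using R(2) by blast
    then have jn: "j \<in> {1..<n}" using j by auto
    have "Suc j \<in> ?A" using jn by auto
    from \<theta>[OF this] have "\<theta> (int (Suc j)) = (u ^^ Suc (block_pos n R j)) (int (y (next_in R j)))"
      unfolding block_pos_Suc[OF R(2) jn False] .
    then show ?thesis using \<theta>[OF j] False by simp
  qed
  have pos: "v (w (\<phi> (int j))) = w' (v (\<phi> (int j)))" if j: "j \<in> ?A" for j
  proof -
    obtain j0 where j0: "j \<in> R \<Longrightarrow> j0 \<in> ?A \<and> next_in R j0 = j \<and> block_pos n R j0 = 0"
    proof (cases "j \<in> R")
      case True
      obtain l where "l \<in> ?A" "next_in R l = j" "block_pos n R l = 0" using block_first[OF R True] .
      then show ?thesis using that by blast
    qed (use that in blast)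
    have 1: "w (\<phi> (int j)) = (if j \<in> R then (if j \<in> Bd then - \<phi> (int j0) else \<phi> (int j0)) else \<phi> (int (Suc j)))"
      by (rule step[OF w m \<phi>(2) j j0])
    have 2: "w' (\<psi> (int j)) = (if j \<in> R then (if j \<in> Bd then - \<psi> (int j0) else \<psi> (int j0)) else \<psi> (int (Suc j)))"
      by (rule step[OF w' m' \<psi>(2) j j0])
    show ?thesis unfolding v\<phi> 1 2 using v\<phi> signed_perms_odd[OF v] by simp
  qed
  have all: "v (w y) = w' (v y)" for y
  proof -
    obtain i where i: "y = \<phi> i" using b\<phi> by (metis bij_pointE)
    show ?thesis
    proof (cases "i \<in> letters n")
      case True
      then have A: "nat \<bar>i\<bar> \<in> ?A" using nat_abs_in_iff by blast
      show ?thesis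
      proof (cases "i \<ge> 0")
        case True
        then have e: "int (nat \<bar>i\<bar>) = i" by simp
        show ?thesis using pos[OF A] unfolding e i .
      next
        case False
        then have "i = - int (nat \<bar>i\<bar>)" by simp
        then have "y = - \<phi> (int (nat \<bar>i\<bar>))" using i signed_perms_odd[OF \<phi>(1)] by metis
        then show ?thesis
          using pos[OF A] signed_perms_odd[OF v] signed_perms_odd[OF w] signed_perms_odd[OF w'] by simp
      qed
    next
      case False
      have out: "u i = i" if "u \<in> signed_perms n" for u
        using signed_perms_permutes[OF that] False by (rule permutes_not_in)
      show ?thesis unfolding i out[OF \<phi>(1)] out[OF w] out[OF v] out[OF w'] ..
    qed
  qed
  have bv: "bij v" by (rule permutes_bij[OF signed_perms_permutes[OF v]])
  have "w' = v \<circ> w \<circ> inv v"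
    using all bv by (simp add: fun_eq_iff bij_is_surj surj_f_inv_f)
  with v show ?thesis by (rule that)
qed

section \<open>Fine sets\<close>

text \<open>\<open>count_compat_roots\<close> is applied to each term of the expansion; the
  coefficients do not involve \<open>k\<close>.\<close>

lemma sum_block_weight:
  assumes k: "k > 0" and R: "R \<subseteq> {1..n}" "n \<in> R" and Bd: "Bd \<subseteq> R"
  shows "2 ^ n * fact n * (\<Sum>w | w \<in> signed_perms n \<and> w ^^ k = id. block_weight n R Bd w)
       = (\<Sum>u\<in>signed_perms n. block_char n R Bd (u ^^ k))"
proof -
  let ?W = "{w. w \<in> signed_perms n \<and> w ^^ k = id}"
  let ?X = "Pow ({1..n} - R)" and ?Y = "Pow R"
  let ?c = "\<lambda>T N w. compat n (next_in (R \<union> T)) (\<lambda>c. next_in R c \<in> N) w"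
  have finW: "finite ?W" using finite_signed_perms[of n] by simp
  have count: "(\<Sum>u\<in>signed_perms n. signed_fix n (content n (next_in (R \<union> T))) (\<lambda>c. next_in R c \<in> N) (u ^^ k))
      = 2 ^ n * fact n * (\<Sum>w\<in>?W. if ?c T N w then 1 else 0)" for T N
  proof -
    have nI: "n \<in> R \<union> T" using R by simp
    have mono: "mono_on {1..n} (next_in (R \<union> T))"
      by (rule mono_onI) (use next_in_mono[OF nI] in auto)
    have "{w \<in> signed_perms n. w ^^ k = id \<and> ?c T N w} = {w \<in> ?W. ?c T N w}" by blast
    moreover have "(\<Sum>w\<in>?W. if ?c T N w then 1 else 0) = int (card {w \<in> ?W. ?c T N w})"
      using finW by (subst sum.inter_filter[symmetric]) simp_all
    ultimately show ?thesis using count_compat_roots[OF k mono, of "\<lambda>c. next_in R c \<in> N"] by simp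
  qed
  have "(\<Sum>w\<in>?W. block_weight n R Bd w)
      = (\<Sum>w\<in>?W. \<Sum>T\<in>?X. \<Sum>N\<in>?Y. block_coeff n R Bd T N * (if ?c T N w then 1 else 0))"
    by (rule sum.cong[OF refl], rule block_weight_expansion[OF _ R Bd, symmetric]) blast
  also have "\<dots> = (\<Sum>T\<in>?X. \<Sum>w\<in>?W. \<Sum>N\<in>?Y. block_coeff n R Bd T N * (if ?c T N w then 1 else 0))"
    by (rule sum.swap)
  also have "\<dots> = (\<Sum>T\<in>?X. \<Sum>N\<in>?Y. \<Sum>w\<in>?W. block_coeff n R Bd T N * (if ?c T N w then 1 else 0))"
    by (rule sum.cong[OF refl], rule sum.swap)
  also have "\<dots> = (\<Sum>T\<in>?X. \<Sum>N\<in>?Y. block_coeff n R Bd T N * (\<Sum>w\<in>?W. if ?c T N w then 1 else 0))"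
    by (simp only: sum_distrib_left)
  finally have L: "(\<Sum>w\<in>?W. block_weight n R Bd w)
      = (\<Sum>T\<in>?X. \<Sum>N\<in>?Y. block_coeff n R Bd T N * (\<Sum>w\<in>?W. if ?c T N w then 1 else 0))" .
  have "(\<Sum>u\<in>signed_perms n. block_char n R Bd (u ^^ k))
      = (\<Sum>T\<in>?X. \<Sum>u\<in>signed_perms n. \<Sum>N\<in>?Y. block_coeff n R Bd T N *
          signed_fix n (content n (next_in (R \<union> T))) (\<lambda>c. next_in R c \<in> N) (u ^^ k))"
    unfolding block_char_def by (rule sum.swap)
  also have "\<dots> = (\<Sum>T\<in>?X. \<Sum>N\<in>?Y. \<Sum>u\<in>signed_perms n. block_coeff n R Bd T N *
          signed_fix n (content n (next_in (R \<union> T))) (\<lambda>c. next_in R c \<in> N) (u ^^ k))"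
    by (rule sum.cong[OF refl], rule sum.swap)
  also have "\<dots> = (\<Sum>T\<in>?X. \<Sum>N\<in>?Y. block_coeff n R Bd T N *
      (2 ^ n * fact n * (\<Sum>w\<in>?W. if ?c T N w then 1 else 0)))"
    by (simp only: sum_distrib_left[symmetric] count)
  also have "\<dots> = (\<Sum>T\<in>?X. \<Sum>N\<in>?Y. 2 ^ n * fact n *
      (block_coeff n R Bd T N * (\<Sum>w\<in>?W. if ?c T N w then 1 else 0)))"
    by (simp only: mult.left_commute)
  also have "\<dots> = 2 ^ n * fact n * (\<Sum>w\<in>?W. block_weight n R Bd w)"
    unfolding L by (simp only: sum_distrib_left)
  finally show ?thesis by simp
qed

lemma block_weight_id:
  assumes R: "n \<in> R" shows "block_weight n R Bd id = 1"
proof -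
  have s: "sign_of id j = Plus" for j by (simp add: sign_of_def)
  have "\<not> descent id j" for j by (simp add: descent_def less_r_def)
  then have e: "fst (sDes n id) - R = {}" using R by (auto simp: fst_sDes)
  show ?thesis unfolding block_weight_def e by (simp add: s initial_in_blocks_def)
qed

text \<open>Wherever \<open>block_char\<close> does not vanish, the element is conjugate to
  \<open>w\<close>, so \<open>root_count\<close> may be replaced under the sum by its value at
  \<open>w\<close>. The remaining total is given by \<open>sum_block_weight\<close> at exponent 1,
  where the only root is the identity, of weight 1.\<close>

lemma root_count_eq_sum_block_weight:
  assumes k: "k > 0" and R: "R \<subseteq> {1..n}" "n \<in> R" and Bd: "Bd \<subseteq> R"
    and w: "w \<in> signed_perms n" and m: "cycles_match n R Bd w x"
  shows "root_count n k w = of_int (\<Sum>v | v \<in> signed_perms n \<and> v ^^ k = id. block_weight n R Bd v)"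
proof -
  let ?S = "\<Sum>v | v \<in> signed_perms n \<and> v ^^ k = id. block_weight n R Bd v"
  have "root_count n k u * of_int (block_char n R Bd u) = root_count n k w * of_int (block_char n R Bd u)"
    if u: "u \<in> signed_perms n" for u
  proof (cases "block_char n R Bd u = 0")
    case False
    obtain y where y: "cycles_match n R Bd u y" using block_char_nonzero_imp_match[OF u R False] .
    obtain v where v: "v \<in> signed_perms n" "w = v \<circ> u \<circ> inv v" using match_imp_conj[OF u w R y m] .
    then have "root_count n k w = root_count n k u" using root_count_conj[OF u v(1)] by simp
    then show ?thesis by simp
  qed simp
  then have "(\<Sum>u\<in>signed_perms n. root_count n k u * of_int (block_char n R Bd u))
      = (\<Sum>u\<in>signed_perms n. root_count n k w * of_int (block_char n R Bd u))"
    by (rule sum.cong[OF refl])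
  also have "\<dots> = root_count n k w * of_int (\<Sum>u\<in>signed_perms n. block_char n R Bd u)"
    by (simp only: sum_distrib_left of_int_sum)
  also have "(\<Sum>u\<in>signed_perms n. block_char n R Bd u) = 2 ^ n * fact n"
  proof -
    have e: "{v. v \<in> signed_perms n \<and> v ^^ 1 = id} = {id}" using signed_perms_id by auto
    have "2 ^ n * fact n * (\<Sum>v | v \<in> signed_perms n \<and> v ^^ 1 = id. block_weight n R Bd v)
        = (\<Sum>u\<in>signed_perms n. block_char n R Bd (u ^^ 1))"
      by (rule sum_block_weight[OF _ R Bd]) simp
    then show ?thesis unfolding e by (simp add: block_weight_id[OF R(2)])
  qed
  finally have "(\<Sum>u\<in>signed_perms n. of_int (block_char n R Bd (u ^^ k)))
      = root_count n k w * of_int (2 ^ n * fact n)" unfolding sum_root_count .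
  then have "of_int (2 ^ n * fact n * ?S) = root_count n k w * of_int (2 ^ n * fact n)"
    unfolding sum_block_weight[OF k R Bd] of_int_sum .
  then have eq: "of_int ?S * of_int (2 ^ n * fact n) = root_count n k w * of_int (2 ^ n * fact n)"
    unfolding of_int_mult[of "2 ^ n * fact n"] mult.commute[of _ "of_int ?S"] .
  have nz: "(of_int (2 ^ n * fact n) :: complex) \<noteq> 0" by simp
  from iffD1[OF mult_right_cancel[OF nz] eq] show ?thesis by (rule sym)
qed

lemma image_mset_eq_imp_injection:
  assumes "finite S" "finite T" "image_mset f (mset_set S) = image_mset g (mset_set T)"
  obtains h where "inj_on h S" "\<And>s. s \<in> S \<Longrightarrow> h s \<in> T \<and> g (h s) = f s"
proof -
  have "\<exists>h. inj_on h S \<and> (\<forall>s\<in>S. h s \<in> T \<and> g (h s) = f s)"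
    using assms
  proof (induction S arbitrary: T rule: finite_induct)
    case (insert s S)
    have "f s \<in># image_mset g (mset_set T)"
      unfolding insert.prems(2)[symmetric] using insert.hyps by simp
    then obtain t where t: "t \<in> T" "g t = f s" using insert.prems(1) by auto
    have "mset_set T = add_mset t (mset_set (T - {t}))"
      using mset_set.remove[OF insert.prems(1) t(1)] by simp
    then have "image_mset f (mset_set S) = image_mset g (mset_set (T - {t}))"
      using insert.prems(2) insert.hyps t(2) by simp
    then obtain h where h: "inj_on h S" "\<forall>s\<in>S. h s \<in> T - {t} \<and> g (h s) = f s"
      using insert.IH[of "T - {t}"] insert.prems(1) by blast
    let ?h = "h(s := t)"
    have "inj_on ?h (insert s S)"
      using h insert.hyps by (auto simp: inj_on_def)
    moreover have "\<forall>a\<in>insert s S. ?h a \<in> T \<and> g (?h a) = f a"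
      using h(2) t insert.hyps by auto
    ultimately show ?case by blast
  qed simp
  then show ?thesis using that by blast
qed

section \<open>From signed compositions to blocks\<close>

context
  fixes n :: nat and \<gamma> :: signed_comp
  assumes \<gamma>: "\<gamma> \<in> signed_comps n" and n: "n \<ge> 1"
begin

abbreviation (input) "psum \<equiv> partial_sum \<gamma>"

definition barred_set :: "nat set" where
  "barred_set = psum ` {i \<in> {1..length \<gamma>}. snd (\<gamma> ! (i - 1)) = Minus}"

lemma psum_0: "psum 0 = 0"
  by (simp add: partial_sum_def)

lemma psum_length: "psum (length \<gamma>) = n"
  using \<gamma> by (simp add: partial_sum_def signed_comps_def)

lemma psum_Suc: "i < length \<gamma> \<Longrightarrow> psum (Suc i) = psum i + fst (\<gamma> ! i)"
  by (simp add: partial_sum_def take_Suc_conv_app_nth)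

lemma psum_less:
  assumes "i < j" "j \<le> length \<gamma>" shows "psum i < psum j"
  using assms
proof (induction j)
  case (Suc j)
  have "\<gamma> ! j \<in> set \<gamma>" using Suc.prems by simp
  then have "fst (\<gamma> ! j) > 0" using \<gamma> by (simp add: signed_comps_def)
  then have "psum j < psum (Suc j)" using psum_Suc[of j] Suc.prems by simp
  then show ?case using Suc by (cases "i = j") auto
qed simp

lemma psum_inj: "inj_on psum {1..length \<gamma>}"
  by (rule inj_onI) (metis atLeastAtMost_iff less_irrefl linorder_neqE_nat psum_less)

lemma comp_set_subset: "comp_set \<gamma> \<subseteq> {1..n}"
proof
  fix r assume "r \<in> comp_set \<gamma>"
  then obtain i where i: "i \<in> {1..length \<gamma>}" "r = psum i" unfolding comp_set_def by blast
  have "psum 0 < psum i" using i by (intro psum_less) auto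
  moreover have "psum i \<le> psum (length \<gamma>)"
    using i psum_less[of i "length \<gamma>"] by (cases "i = length \<gamma>") auto
  ultimately show "r \<in> {1..n}" using i(2) psum_0 psum_length by simp
qed

lemma n_in_comp_set: "n \<in> comp_set \<gamma>"
proof -
  have "length \<gamma> \<noteq> 0" using psum_length psum_0 n by (metis not_one_le_zero)
  then have "length \<gamma> \<in> {1..length \<gamma>}" by (simp add: Suc_le_eq)
  then show ?thesis unfolding comp_set_def by (rule image_eqI[rotated]) (simp add: psum_length)
qed

lemma psum_in_comp_set: "i \<in> {1..length \<gamma>} \<Longrightarrow> psum i \<in> comp_set \<gamma>"
  by (simp add: comp_set_def)

lemma barred_set_subset: "barred_set \<subseteq> comp_set \<gamma>"
  by (auto simp: barred_set_def comp_set_def)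

lemma psum_in_barred_iff:
  assumes i: "i \<in> {1..length \<gamma>}" shows "psum i \<in> barred_set \<longleftrightarrow> snd (\<gamma> ! (i - 1)) = Minus"
proof -
  have "{i \<in> {1..length \<gamma>}. snd (\<gamma> ! (i - 1)) = Minus} \<subseteq> {1..length \<gamma>}" by blast
  from inj_on_image_mem_iff[OF psum_inj i this] show ?thesis unfolding barred_set_def using i by blast
qed

text \<open>Partial sums increase strictly, so the first partial sum not below \<open>j\<close>
  closes the part that contains \<open>j\<close>.\<close>

lemma block_eq_blk:
  assumes i: "i \<in> {1..length \<gamma>}"
  shows "block \<gamma> i = blk n (comp_set \<gamma>) (psum i)"
proof (intro equalityI subsetI)
  have ri: "psum i \<in> comp_set \<gamma>" by (rule psum_in_comp_set[OF i])
  then have rn: "psum i \<le> n" using comp_set_subset by auto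
  fix j assume "j \<in> block \<gamma> i"
  then have j: "psum (i - 1) < j" "j \<le> psum i" by (auto simp: block_def)
  have le: "next_in (comp_set \<gamma>) j \<le> psum i" by (rule next_in_le[OF ri j(2)])
  have p: "next_in (comp_set \<gamma>) j \<in> comp_set \<gamma>" "j \<le> next_in (comp_set \<gamma>) j"
    using next_in_props[OF n_in_comp_set, of j] j rn by auto
  then obtain l where l: "next_in (comp_set \<gamma>) j = psum l" "l \<in> {1..length \<gamma>}"
    unfolding comp_set_def by (rule_tac imageE)
  have "i \<le> l"
  proof (rule ccontr)
    assume "\<not> i \<le> l"
    then have "l \<le> i - 1" by simp
    moreover have "i - 1 \<le> length \<gamma>" using i by auto
    ultimately have "psum l \<le> psum (i - 1)"
      using psum_less[of l "i - 1"] by (cases "l = i - 1") auto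
    then show False using p(2) l j by simp
  qed
  then have "psum i \<le> psum l" using psum_less[of i l] l by (cases "i = l") auto
  then show "j \<in> blk n (comp_set \<gamma>) (psum i)" using le l j rn by (simp add: blk_def)
next
  fix j assume "j \<in> blk n (comp_set \<gamma>) (psum i)"
  then have j: "j \<in> {1..n}" "next_in (comp_set \<gamma>) j = psum i" by (simp_all add: blk_def)
  have "j \<le> psum i" using next_in_props(2)[OF n_in_comp_set, of j] j by simp
  moreover have "psum (i - 1) < j"
  proof (cases "i = 1")
    case True
    then show ?thesis using psum_0 j by simp
  next
    case False
    then have i1: "i - 1 \<in> {1..length \<gamma>}" using i by auto
    show ?thesis
    proof (rule ccontr)
      assume "\<not> psum (i - 1) < j"
      then have "psum i \<le> psum (i - 1)"
        using next_in_le[OF psum_in_comp_set[OF i1], of j] j by simp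
      moreover have "psum (i - 1) < psum i" using i by (intro psum_less) auto
      ultimately show False by simp
    qed
  qed
  ultimately show "j \<in> block \<gamma> i" by (simp add: block_def)
qed

lemma card_blk_psum:
  assumes i: "i \<in> {1..length \<gamma>}"
  shows "card (blk n (comp_set \<gamma>) (psum i)) = fst (\<gamma> ! (i - 1))"
proof -
  have "psum i = psum (i - 1) + fst (\<gamma> ! (i - 1))" using psum_Suc[of "i - 1"] i by auto
  then show ?thesis unfolding block_eq_blk[OF i, symmetric] block_def by simp
qed

lemma inner_block_eq:
  assumes i: "i \<in> {1..length \<gamma>}"
  shows "inner_block \<gamma> i = blk n (comp_set \<gamma>) (psum i) - comp_set \<gamma>"
proof -
  have "inner_block \<gamma> i = block \<gamma> i - {psum i}"
  proof -
    have "psum (i - 1) < psum i" using i by (intro psum_less) auto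
    then show ?thesis by (auto simp: inner_block_def block_def)
  qed
  also have "\<dots> = blk n (comp_set \<gamma>) (psum i) - comp_set \<gamma>"
  proof -
    have "j = psum i" if "j \<in> blk n (comp_set \<gamma>) (psum i)" "j \<in> comp_set \<gamma>" for j
      using that next_in_self[of j "comp_set \<gamma>"] by (simp add: blk_def)
    moreover have "psum i \<in> comp_set \<gamma>" by (rule psum_in_comp_set[OF i])
    ultimately show ?thesis unfolding block_eq_blk[OF i] by blast
  qed
  finally show ?thesis .
qed

lemma next_in_comp_set_obtain:
  assumes j: "j \<in> {1..n}"
  obtains i where "i \<in> {1..length \<gamma>}" "next_in (comp_set \<gamma>) j = psum i"
proof -
  have "next_in (comp_set \<gamma>) j \<in> comp_set \<gamma>" using next_in_props(1)[OF n_in_comp_set] j by simp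
  then show ?thesis using that unfolding comp_set_def by blast
qed

text \<open>Each block contains its last point, from which a constant sign can be read off, and
  distinct parts have distinct partial sums, so negative barred parts may be counted by their
  partial sums.\<close>

lemma wt_eq_block_weight:
  assumes w: "w \<in> signed_perms n"
  shows "wt \<gamma> (sDes n w) = block_weight n (comp_set \<gamma>) barred_set w"
proof -
  let ?R = "comp_set \<gamma>" and ?S = "fst (sDes n w)" and ?I = "{1..length \<gamma>}"
  let ?const = "\<forall>j\<in>{1..n}. sign_of w j = sign_of w (next_in ?R j)"
  have blkA: "j \<in> {1..n}" "next_in ?R j = psum i" if "i \<in> ?I" "j \<in> block \<gamma> i" for i j
    using that(2) unfolding block_eq_blk[OF that(1)] by (simp_all add: blk_def)
  have sv: "sign_vector (sDes n w) j = sign_of w j" if "i \<in> ?I" "j \<in> block \<gamma> i" for i j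
    by (rule sign_vector_sDes[OF w blkA(1)[OF that]])
  have last: "psum i \<in> block \<gamma> i" if "i \<in> ?I" for i
    unfolding block_eq_blk[OF that] by (rule blk_self[OF comp_set_subset psum_in_comp_set[OF that]])
  have c: "(\<forall>i\<in>?I. \<exists>s. \<forall>j\<in>block \<gamma> i. sign_vector (sDes n w) j = s) \<longleftrightarrow> ?const"
  proof
    assume a: "\<forall>i\<in>?I. \<exists>s. \<forall>j\<in>block \<gamma> i. sign_vector (sDes n w) j = s"
    show ?const
    proof
      fix j assume j: "j \<in> {1..n}"
      obtain i where i: "i \<in> ?I" "next_in ?R j = psum i" by (rule next_in_comp_set_obtain[OF j])
      have jb: "j \<in> block \<gamma> i" unfolding block_eq_blk[OF i(1)] using i(2) j by (simp add: blk_def)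
      have "sign_vector (sDes n w) j = sign_vector (sDes n w) (psum i)"
        using a i(1) jb last[OF i(1)] by metis
      then show "sign_of w j = sign_of w (next_in ?R j)"
        unfolding i(2) sv[OF i(1) jb] sv[OF i(1) last[OF i(1)]] .
    qed
  next
    assume a: ?const
    show "\<forall>i\<in>?I. \<exists>s. \<forall>j\<in>block \<gamma> i. sign_vector (sDes n w) j = s"
    proof (intro ballI exI)
      fix i j assume i: "i \<in> ?I" and j: "j \<in> block \<gamma> i"
      have "sign_of w j = sign_of w (next_in ?R j)" using a blkA(1)[OF i j] by (rule bspec)
      then show "sign_vector (sDes n w) j = sign_of w (psum i)"
        unfolding sv[OF i j] blkA(2)[OF i j] .
    qed
  qed
  have ini: "(\<forall>i\<in>?I. initial_segment (?S \<inter> inner_block \<gamma> i) (inner_block \<gamma> i))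
      \<longleftrightarrow> initial_in_blocks n ?R (?S - ?R)"
  proof
    assume a: "\<forall>i\<in>?I. initial_segment (?S \<inter> inner_block \<gamma> i) (inner_block \<gamma> i)"
    show "initial_in_blocks n ?R (?S - ?R)"
      unfolding initial_in_blocks_def
    proof (intro ballI impI)
      fix l j assume l: "l \<in> {1..n} - ?R" and j: "j \<in> {1..n} - ?R"
        and h: "next_in ?R l = next_in ?R j \<and> l \<le> j \<and> j \<in> ?S - ?R"
      have "j \<in> {1..n}" using j by blast
      then obtain i where i: "i \<in> ?I" "next_in ?R j = psum i" by (rule next_in_comp_set_obtain)
      have "next_in ?R l = psum i" using h i(2) by metis
      then have lb: "l \<in> inner_block \<gamma> i" unfolding inner_block_eq[OF i(1)] using l by (simp add: blk_def)
      have jb: "j \<in> ?S \<inter> inner_block \<gamma> i" unfolding inner_block_eq[OF i(1)] using j i(2) h by (simp add: blk_def)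
      have "l \<in> ?S \<inter> inner_block \<gamma> i"
        using a i(1) lb jb h unfolding initial_segment_def by blast
      then show "l \<in> ?S - ?R" using l by blast
    qed
  next
    assume a: "initial_in_blocks n ?R (?S - ?R)"
    show "\<forall>i\<in>?I. initial_segment (?S \<inter> inner_block \<gamma> i) (inner_block \<gamma> i)"
      unfolding initial_segment_def
    proof (intro ballI conjI impI)
      fix i j l assume i: "i \<in> ?I" and j: "j \<in> ?S \<inter> inner_block \<gamma> i" and l: "l \<in> inner_block \<gamma> i" and "l \<le> j"
      have l': "l \<in> {1..n} - ?R" "next_in ?R l = psum i"
        using l unfolding inner_block_eq[OF i] by (simp_all add: blk_def)
      have j': "j \<in> {1..n} - ?R" "next_in ?R j = psum i" "j \<in> ?S - ?R"
        using j unfolding inner_block_eq[OF i] by (simp_all add: blk_def)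
      have "next_in ?R l = next_in ?R j" using l'(2) j'(2) by simp
      then have "l \<in> ?S - ?R"
        using a l'(1) j'(1,3) \<open>l \<le> j\<close> unfolding initial_in_blocks_def by blast
      then show "l \<in> ?S \<inter> inner_block \<gamma> i" using l by blast
    qed blast
  qed
  have bar: "barred_neg_blocks \<gamma> (sDes n w) = card {r \<in> barred_set. sign_of w r = Minus}" if a: ?const
  proof -
    let ?J = "{i \<in> ?I. (\<forall>j\<in>block \<gamma> i. sign_vector (sDes n w) j = Minus) \<and> snd (\<gamma> ! (i - 1)) = Minus}"
    have e: "(\<forall>j\<in>block \<gamma> i. sign_vector (sDes n w) j = Minus) \<longleftrightarrow> sign_of w (psum i) = Minus" if i: "i \<in> ?I" for i
    proof
      assume "\<forall>j\<in>block \<gamma> i. sign_vector (sDes n w) j = Minus"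
      then have "sign_vector (sDes n w) (psum i) = Minus" using last[OF i] by (rule bspec)
      then show "sign_of w (psum i) = Minus" unfolding sv[OF i last[OF i]] .
    next
      assume m: "sign_of w (psum i) = Minus"
      show "\<forall>j\<in>block \<gamma> i. sign_vector (sDes n w) j = Minus"
      proof
        fix j assume j: "j \<in> block \<gamma> i"
        have "sign_of w j = sign_of w (next_in ?R j)" using a blkA(1)[OF i j] by (rule bspec)
        then show "sign_vector (sDes n w) j = Minus" unfolding sv[OF i j] blkA(2)[OF i j] m .
      qed
    qed
    have "psum ` ?J = {r \<in> barred_set. sign_of w r = Minus}"
      unfolding barred_set_def using e by blast
    moreover have "card (psum ` ?J) = card ?J"
      by (rule card_image) (rule inj_on_subset[OF psum_inj], blast)
    ultimately show ?thesis unfolding barred_neg_blocks_def by simp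
  qed
  have "(\<exists>i\<in>?I. \<not> initial_segment (?S \<inter> inner_block \<gamma> i) (inner_block \<gamma> i) \<or>
      \<not> (\<exists>s. \<forall>j\<in>block \<gamma> i. sign_vector (sDes n w) j = s))
      \<longleftrightarrow> \<not> (?const \<and> initial_in_blocks n ?R (?S - ?R))"
    unfolding c[symmetric] ini[symmetric] by blast
  moreover have "(if \<not> e then 0 else a) = (if e then a else 0)" for e and a :: int by simp
  ultimately have "wt \<gamma> (sDes n w) = (if ?const \<and> initial_in_blocks n ?R (?S - ?R)
      then (- 1) ^ (card (?S - ?R) + barred_neg_blocks \<gamma> (sDes n w)) else 0)"
    unfolding wt_def by (simp only:)
  also have "\<dots> = block_weight n ?R barred_set w"
    unfolding block_weight_def
  proof (rule if_cong[OF refl _ refl])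
    assume "?const \<and> initial_in_blocks n ?R (?S - ?R)"
    then have c: ?const by (rule conjunct1)
    show "(- 1) ^ (card (?S - ?R) + barred_neg_blocks \<gamma> (sDes n w))
        = (- 1 :: int) ^ (card (?S - ?R) + card {r \<in> barred_set. sign_of w r = Minus})"
      unfolding bar[OF c] ..
  qed
  finally show ?thesis .
qed

text \<open>With \<open>P\<close> testing for either sign, this expresses both components of
  \<open>comp_type\<close> by block sizes.\<close>

lemma mset_filter_psum:
  "mset (map fst (filter (\<lambda>p. P (snd p)) \<gamma>))
     = image_mset (\<lambda>r. card (blk n (comp_set \<gamma>) r))
         (mset_set (psum ` {i \<in> {1..length \<gamma>}. P (snd (\<gamma> ! (i - 1)))}))"
proof -
  let ?J = "{i \<in> {1..length \<gamma>}. P (snd (\<gamma> ! (i - 1)))}"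
  have "map (\<lambda>i. \<gamma> ! (i - 1)) [1..<Suc (length \<gamma>)] = \<gamma>"
    by (auto intro!: nth_equalityI simp del: upt_Suc)
  then have "mset \<gamma> = mset (map (\<lambda>i. \<gamma> ! (i - 1)) [1..<Suc (length \<gamma>)])" by simp
  also have "\<dots> = image_mset (\<lambda>i. \<gamma> ! (i - 1)) (mset_set {1..length \<gamma>})"
    by (simp add: mset_upt atLeastLessThanSuc_atLeastAtMost del: upt_Suc)
  finally have g: "mset \<gamma> = image_mset (\<lambda>i. \<gamma> ! (i - 1)) (mset_set {1..length \<gamma>})" .
  have "mset (map fst (filter (\<lambda>p. P (snd p)) \<gamma>)) = image_mset fst (filter_mset (\<lambda>p. P (snd p)) (mset \<gamma>))"
    by simp
  also have "\<dots> = image_mset (\<lambda>i. fst (\<gamma> ! (i - 1))) (mset_set ?J)"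
    unfolding g by (simp add: filter_mset_image_mset multiset.map_comp o_def)
  also have "\<dots> = image_mset (\<lambda>i. card (blk n (comp_set \<gamma>) (psum i))) (mset_set ?J)"
  proof (rule image_mset_cong)
    fix i assume "i \<in># mset_set ?J"
    then have "i \<in> {1..length \<gamma>}" by simp
    then show "fst (\<gamma> ! (i - 1)) = card (blk n (comp_set \<gamma>) (psum i))" by (rule card_blk_psum[symmetric])
  qed
  also have "\<dots> = image_mset (\<lambda>r. card (blk n (comp_set \<gamma>) r)) (image_mset psum (mset_set ?J))"
    by (simp add: multiset.map_comp o_def)
  also have "image_mset psum (mset_set ?J) = mset_set (psum ` ?J)"
    by (rule image_mset_mset_set) (rule inj_on_subset[OF psum_inj], blast)
  finally show ?thesis .
qed

text \<open>Equal multisets of lengths give injections from unbarred parts to orbits of sign 1 and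
  from barred parts to orbits of sign -1, preserving the size. The two injections cannot collide
  because the orbit signs differ.\<close>

lemma cycle_type_imp_match:
  assumes w: "w \<in> signed_perms n" and t: "signed_cycle_type n w = comp_type \<gamma>"
  obtains x where "cycles_match n (comp_set \<gamma>) barred_set w x"
proof -
  let ?R = "comp_set \<gamma>" and ?O = "abs_orbits n w"
  let ?P = "psum ` {i \<in> {1..length \<gamma>}. snd (\<gamma> ! (i - 1)) = Plus}"
  let ?f = "\<lambda>r. card (blk n ?R r)"
  have "image_mset ?f (mset_set ?P) = image_mset card (mset_set {b \<in> ?O. orbit_sign w b = 1})"
    using t unfolding signed_cycle_type_def comp_type_def pos_cycle_type_eq[OF w]
      mset_filter_psum[of "\<lambda>s. s = Plus"] by simp
  then obtain hP where hP: "inj_on hP ?P"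
    "\<And>r. r \<in> ?P \<Longrightarrow> hP r \<in> {b \<in> ?O. orbit_sign w b = 1} \<and> card (hP r) = ?f r"
    by (rule image_mset_eq_imp_injection[rotated 2]) (simp_all add: finite_abs_orbits)
  have "image_mset ?f (mset_set barred_set) = image_mset card (mset_set {b \<in> ?O. orbit_sign w b = - 1})"
    using t unfolding signed_cycle_type_def comp_type_def neg_cycle_type_eq[OF w]
      mset_filter_psum[of "\<lambda>s. s = Minus"] barred_set_def by simp
  then obtain hN where hN: "inj_on hN barred_set"
    "\<And>r. r \<in> barred_set \<Longrightarrow> hN r \<in> {b \<in> ?O. orbit_sign w b = - 1} \<and> card (hN r) = ?f r"
    by (rule image_mset_eq_imp_injection[rotated 2]) (simp_all add: finite_abs_orbits barred_set_def)
  have RP: "r \<in> ?P" if r: "r \<in> ?R" "r \<notin> barred_set" for r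
  proof -
    obtain i where i: "r = psum i" "i \<in> {1..length \<gamma>}" using r(1) unfolding comp_set_def by (rule imageE)
    have "snd (\<gamma> ! (i - 1)) \<noteq> Minus" using r(2) psum_in_barred_iff[OF i(2)] i(1) by simp
    then have "snd (\<gamma> ! (i - 1)) = Plus" by (cases "snd (\<gamma> ! (i - 1))") simp_all
    then show ?thesis using i by blast
  qed
  define h where "h r = (if r \<in> barred_set then hN r else hP r)" for r
  have h: "h r \<in> ?O" "orbit_sign w (h r) = (if r \<in> barred_set then - 1 else 1)" "card (h r) = ?f r"
    if "r \<in> ?R" for r
    using that hP(2)[OF RP[OF that]] hN(2)[of r] by (auto simp: h_def)
  have hne: "h r \<noteq> h s" if rs: "r \<in> ?R" "s \<in> ?R" "r \<noteq> s" for r s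
  proof (cases "r \<in> barred_set \<longleftrightarrow> s \<in> barred_set")
    case True
    show ?thesis
    proof (cases "r \<in> barred_set")
      case rb: True
      then show ?thesis using True inj_onD[OF hN(1)] rs(3) by (auto simp: h_def)
    next
      case rb: False
      then show ?thesis using True inj_onD[OF hP(1)] RP rs by (auto simp: h_def)
    qed
  next
    case False
    then have "orbit_sign w (h r) \<noteq> orbit_sign w (h s)" using h(2)[OF rs(1)] h(2)[OF rs(2)] by auto
    then show ?thesis by metis
  qed
  \<comment> \<open>Any point of the matched orbit may serve as the start of the cycle.\<close>
  define x where "x r = (SOME j. j \<in> h r)" for r
  have xh: "x r \<in> h r" if "r \<in> ?R" for r
    unfolding x_def using abs_orbits_subset(3)[OF w h(1)[OF that]] by (rule some_in_eq[THEN iffD2])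
  have orb: "orbit (abs_perm w) (x r) = h r" if "r \<in> ?R" for r
    by (rule mem_abs_orbits[OF w h(1)[OF that] xh[OF that]])
  have xA: "x r \<in> {1..n}" if "r \<in> ?R" for r
    using abs_orbits_subset(1)[OF w h(1)[OF that]] xh[OF that] by blast
  have "cycles_match n ?R barred_set w x"
    unfolding cycles_match_def
  proof (intro conjI ballI impI)
    fix r assume r: "r \<in> ?R"
    show "x r \<in> {1..n}" by (rule xA[OF r])
    show "card (orbit (abs_perm w) (x r)) = card (blk n ?R r)" unfolding orb[OF r] by (rule h(3)[OF r])
    show "orbit_sign w (orbit (abs_perm w) (x r)) = (if r \<in> barred_set then - 1 else 1)"
      unfolding orb[OF r] by (rule h(2)[OF r])
  next
    fix r s assume "r \<in> ?R" "s \<in> ?R" "r \<noteq> s"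
    then show "orbit (abs_perm w) (x r) \<noteq> orbit (abs_perm w) (x s)" using orb hne by metis
  qed
  then show ?thesis by (rule that)
qed

lemma root_count_eq_sum_wt:
  assumes k: "k > 0" and w: "w \<in> signed_perms n" and t: "signed_cycle_type n w = comp_type \<gamma>"
  shows "root_count n k w = of_int (\<Sum>v | v \<in> signed_perms n \<and> v ^^ k = id. wt \<gamma> (sDes n v))"
proof -
  obtain x where x: "cycles_match n (comp_set \<gamma>) barred_set w x" by (rule cycle_type_imp_match[OF w t])
  have "(\<Sum>v | v \<in> signed_perms n \<and> v ^^ k = id. wt \<gamma> (sDes n v))
      = (\<Sum>v | v \<in> signed_perms n \<and> v ^^ k = id. block_weight n (comp_set \<gamma>) barred_set v)"
    by (rule sum.cong[OF refl], rule wt_eq_block_weight) blast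
  then show ?thesis
    using root_count_eq_sum_block_weight[OF k comp_set_subset n_in_comp_set barred_set_subset w x] by simp
qed

end

theorem theorem7p8:
  fixes n k :: nat
  assumes "n \<ge> 1" and "odd k"
  shows "fine_set n {w \<in> signed_perms n. w ^^ k = id} (sDes n) (root_count n k) \<and>
         ch n (root_count n k) = (\<Sum>w | w \<in> signed_perms n \<and> w ^^ k = id. F n (sDes n w))"
proof
  have k: "k > 0" using assms(2) by (rule odd_pos)
  show "fine_set n {w \<in> signed_perms n. w ^^ k = id} (sDes n) (root_count n k)"
    unfolding fine_set_def
  proof (intro conjI ballI impI)
    show "finite {w \<in> signed_perms n. w ^^ k = id}" using finite_signed_perms[of n] by simp
    show "class_function n (root_count n k)" by (rule class_function_root_count)
    fix \<gamma> w assume "\<gamma> \<in> signed_comps n" "w \<in> signed_perms n" "signed_cycle_type n w = comp_type \<gamma>"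
    then show "root_count n k w = of_int (\<Sum>b\<in>{w \<in> signed_perms n. w ^^ k = id}. wt \<gamma> (sDes n b))"
      by (rule root_count_eq_sum_wt[OF _ assms(1) k])
  qed
  show "ch n (root_count n k) = (\<Sum>w | w \<in> signed_perms n \<and> w ^^ k = id. F n (sDes n w))"
    by (rule ch_root_count[OF k])
qed

end
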